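(* Let all data be as in the context. Let $c_1,c_2,c_3,c_4>0$ be arbitrary and choose $\rho,\rho_z,a,b>0$ such that $$\gamma_\beta:=a\underline\mu-\bar\lambda\bar\phi^2>0,\qquad \gamma_z:=b-a\bar\mu e^{\rho}>0 .$$ Put $d_\beta:=e^\rho$, $d_z:=e^{\rho_zD}$, $Q_0:=\|q_1(0,\cdot)\|_{L^2}^2+\|q_2(0,\cdot)\|_{L^2}^2$, and define $$M_V:=\frac{3+3ad_\beta+2bd_z}{c_V}\Big(1+\frac1{c_T}\Big)+\frac1{c_1c_V}+\frac{ad_\beta}{c_Vc_2}+\frac{bd_z}{c_Vc_3}+\frac{3bd_zc_3Q_0}{c_Tc_V}+\frac{bd_z}{c_Vc_4},$$ $$M_\beta:=c_1+ad_\beta c_2+bd_zc_4,\qquad M_z:=3bd_zc_3,\qquad \nu:=\min\{\rho\underline\lambda,\rho\underline\mu,\rho_z\}>0 .$$ Then for every joint mode $j\in\mathcal R$ the generator satisfies, along classical solutions of the target system in mode $j$, $$\mathcal L V(Y,\delta_j)\le-(\nu-M_0M_V\Delta_j)V(Y)-(\gamma_\beta-M_0M_\beta\Delta_j)\beta^2(0,t)-(\gamma_z-M_0M_z\Delta_j)z^2(0,t).$$ Consequently, if $$\Delta_{\max}<\varepsilon^\star:=\min\left\{\frac{\nu}{2M_0M_V},\frac{\gamma_\beta}{2M_0M_\beta},\frac{\gamma_z}{2M_0M_z}\right\},$$ then, with $\kappa:=\nu-M_0M_V\Delta_{\max}>0$, for each fixed mode $j\in\mathcal R$, along classical solutions of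 the target system in mode $j$, $$\frac{d}{dt}V(Y(t))\le-\kappa V(Y(t)),$$ equivalently $\mathcal L V(Y,\delta_j)\le-\kappa V(Y)$.
   Context: **Parameters.** $D>0$ is a constant delay. $\mathcal R=\{1,\dots,r\}$ is the finite set of modes of a Markov process with bounded transition rates; mode $j$ has parameter vector $\delta_j=(\lambda_j,\mu_j,\sigma_j^+,\sigma_j^-,\phi_j)$. For all $j$: $0<\underline\lambda\le\lambda_j\le\bar\lambda$, $0<\underline\mu\le\mu_j\le\bar\mu$, $\underline\sigma^\pm\le\sigma_j^\pm\le\bar\sigma^\pm$, $\underline\phi\le\phi_j\le\bar\phi$ and $|\phi_j|\le\bar\phi$. The nominal vector $\delta_0=(\lambda_0,\mu_0,\sigma_0^+,\sigma_0^-,\phi_0)$ has $\lambda_0,\mu_0>0$, $\phi_0\ne0$. $\Delta_j:=|\lambda_j-\lambda_0|+|\mu_j-\mu_0|+|\sigma_j^+-\sigma_0^+|+|\sigma_j^--\sigma_0^-|+|\phi_j-\phi_0|$, $\Delta_{\max}:=\max_{j\in\mathcal R}\Delta_j$. **Nominal kernels.** On $\mathcal T_1=\{0\le\xi\le x\le1\}$: $\lambda_0(\partial_x+\partial_\xi)K^{uu}=-\sigma_0^-K^{uv}$, $\lambda_0\partial_xK^{uv}-\mu_0\partial_\xi K^{uv}=-\sigma_0^+K^{uu}$, $\mu_0\partial_xK^{vu}-\lambda_0\partial_\xi K^{vu}=\sigma_0^-K^{vv}$, $\mu_0(\partial_x+\partial_\xi)K^{vv}=\sigma_0^+K^{vu}$,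 with $K^{uv}(x,x)=\frac{\sigma_0^+}{\lambda_0+\mu_0}$, $K^{uu}(x,0)=\frac{\mu_0}{\lambda_0\phi_0}K^{uv}(x,0)$, $K^{vu}(x,x)=-\frac{\sigma_0^-}{\lambda_0+\mu_0}$, $K^{vv}(x,0)=\frac{\lambda_0\phi_0}{\mu_0}K^{vu}(x,0)$. On $\mathcal T_2=[0,1]^2$: $\frac1D\partial_xq_1-\lambda_0\partial_\xi q_1=\sigma_0^-q_2$, $\frac1D\partial_xq_2+\mu_0\partial_\xi q_2=\sigma_0^+q_1$, with $q_1(x,1)=0$, $q_1(x,0)=\frac{\mu_0}{\phi_0\lambda_0}q_2(x,0)$, $q_1(0,\xi)=K^{vu}(1,\xi)$, $q_2(0,\xi)=K^{vv}(1,\xi)$; and $p(x)=D\mu_0q_2(x,1)$. **Nominal transformation** $(u,v,\eta)\mapsto Y=(\alpha,\beta,z)$: $\alpha(x)=u(x)-\int_0^x[K^{uu}(x,\xi)u(\xi)+K^{uv}(x,\xi)v(\xi)]d\xi$, $\beta(x)=v(x)-\int_0^x[K^{vu}(x,\xi)u(\xi)+K^{vv}(x,\xi)v(\xi)]d\xi$, $z(x)=\eta(x)-\int_0^xp(x-\xi)\eta(\xi)d\xi-\int_0^1q_1(x,\xi)u(\xi)d\xi-\int_0^1q_2(x,\xi)v(\xi)d\xi$. It is boundedly invertible on $L^2([0,1])^3$; $0<c_T\le C_T$ are constants with $c_T\|(u,v,\eta)\|_{L^2}^2\le\|(\alpha,\beta,z)\|_{L^2}^2\le C_T\|(u,v,\eta)\|_{L^2}^2$.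 **Target system in mode $j$**: $\partial_t\alpha+\lambda_j\partial_x\alpha=\mathcal F_j$, $\partial_t\beta-\mu_j\partial_x\beta=\mathcal G_j$, $D\partial_tz=\partial_xz+\mathcal H_j$, $\alpha(0,t)=\phi_j\beta(0,t)$, $\beta(1,t)=z(0,t)$, $z(1,t)=0$, where (with $(u,v,\eta)$ the preimage of $Y$ under the transformation) $\mathcal F_j=f_{1j}v(x,t)+f_{2j}(x)\beta(0,t)+\int_0^x[f_{3j}(x,\xi)u(\xi,t)+f_{4j}(x,\xi)v(\xi,t)]d\xi$, $\mathcal G_j=g_{1j}u(x,t)+g_{2j}(x)\beta(0,t)+\int_0^x[g_{3j}(x,\xi)u(\xi,t)+g_{4j}(x,\xi)v(\xi,t)]d\xi$, $\mathcal H_j=h_{1j}(x)\eta(0,t)+h_{2j}(x)\beta(0,t)+\int_0^1[h_{3j}(x,\xi)u(\xi,t)+h_{4j}(x,\xi)v(\xi,t)]d\xi$, with coefficients (kernels without arguments are at $(x,\xi)$) $f_{1j}=\sigma_j^+-\sigma_0^+\frac{\lambda_j+\mu_j}{\lambda_0+\mu_0}$, $f_{2j}(x)=(\mu_j-\frac{\lambda_j\phi_j\mu_0}{\lambda_0\phi_0})K^{uv}(x,0)$, $f_{3j}=(\frac{\lambda_j}{\lambda_0}\sigma_0^--\sigma_j^-)K^{uv}$, $f_{4j}=(\lambda_0-\lambda_j)\partial_xK^{uv}+(\mu_j-\mu_0)\partial_\xi K^{uv}-(\sigma_j^+-\sigma_0^+)K^{uu}$; $g_{1j}=\sigma_j^--\frac{\lambda_j+\mu_j}{\lambda_0+\mu_0}\sigma_0^-$,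 $g_{2j}(x)=(-\lambda_j\phi_j+\mu_j\frac{\lambda_0\phi_0}{\mu_0})K^{vu}(x,0)$, $g_{3j}=(\mu_j-\mu_0)\partial_xK^{vu}-(\lambda_j-\lambda_0)\partial_\xi K^{vu}-(\sigma_j^--\sigma_0^-)K^{vv}$, $g_{4j}=(\frac{\sigma_0^+\mu_j}{\mu_0}-\sigma_j^+)K^{vu}$; $h_{1j}(x)=p(x)-D\mu_jq_2(x,1)$, $h_{2j}(x)=D\mu_jq_2(x,0)-D\lambda_j\phi_jq_1(x,0)$, $h_{3j}=D(\lambda_0-\lambda_j)\partial_\xi q_1+D(\sigma_0^--\sigma_j^-)q_2$, $h_{4j}=D(\mu_0-\mu_j)\partial_\xi q_2+D(\sigma_0^+-\sigma_j^+)q_1$. $M_0>0$ is a constant such that for all $j\in\mathcal R$ and all admissible $(x,\xi)$ ($\mathcal T_1$ for $f,g$; $\mathcal T_2$ for $h$): $\sum_{i=1}^4|f_{ij}|\le M_0\Delta_j$, $\sum_{i=1}^4|g_{ij}|\le M_0\Delta_j$, $\sum_{i=1}^4|h_{ij}|\le M_0\Delta_j$. **Lyapunov functional and generator.** $V(Y)=\int_0^1e^{-\rho x}\alpha^2dx+a\int_0^1e^{\rho x}\beta^2dx+bD\int_0^1e^{\rho_zDx}z^2dx$; $0<c_V\le C_V$ are constants with $c_V\|Y\|_{L^2}^2\le V(Y)\le C_V\|Y\|_{L^2}^2$. The infinitesimal generator is $\mathcal LV(Y,\delta_j)=\limsup_{\Delta t\to0^+}\frac1{\Delta t}\big(\mathbb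 E(V(Y(t+\Delta t))\mid\delta(t)=\delta_j)-V(Y(t))\big)$. Since $V$ does not depend on the mode and the state is not reset at jumps, it is given by $\mathcal LV(Y,\delta_j)=\mathcal DV(Y)[A_jY+P_jY]$, where $\mathcal DV$ is the Fréchet derivative, $A_jY=(-\lambda_j\partial_x\alpha,\ \mu_j\partial_x\beta,\ D^{-1}\partial_xz)$ and $P_jY=(\mathcal F_j,\mathcal G_j,\mathcal H_j/D)$. *)

theory Defs
  imports "HOL-Probability.Probability"
begin

record mode =
  lam :: real
  mu :: real
  sigp :: real
  sigm :: real
  phi :: real

definition mode_dist :: "mode \<Rightarrow> mode \<Rightarrow> real" where
  "mode_dist d d0 = \<bar>lam d - lam d0\<bar> + \<bar>mu d - mu d0\<bar> + \<bar>sigp d - sigp d0\<bar>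
     + \<bar>sigm d - sigm d0\<bar> + \<bar>phi d - phi d0\<bar>"

record kernels =
  Kuu :: "real \<Rightarrow> real \<Rightarrow> real"
  Kuv :: "real \<Rightarrow> real \<Rightarrow> real"
  Kvu :: "real \<Rightarrow> real \<Rightarrow> real"
  Kvv :: "real \<Rightarrow> real \<Rightarrow> real"
  q1 :: "real \<Rightarrow> real \<Rightarrow> real"
  q2 :: "real \<Rightarrow> real \<Rightarrow> real"

definition tri_dom :: "(real \<times> real) set" where
  "tri_dom = {(x, \<xi>). 0 \<le> \<xi> \<and> \<xi> \<le> x \<and> x \<le> 1}"

definition sq_dom :: "(real \<times> real) set" where
  "sq_dom = {0..1} \<times> {0..1}"

definition pd1 :: "(real \<times> real) set \<Rightarrow> (real \<Rightarrow> real \<Rightarrow> real) \<Rightarrow> real \<Rightarrow> real \<Rightarrow> real" where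
  "pd1 S k x \<xi> = frechet_derivative (\<lambda>(x, \<xi>). k x \<xi>) (at (x, \<xi>) within S) (1, 0)"

definition pd2 :: "(real \<times> real) set \<Rightarrow> (real \<Rightarrow> real \<Rightarrow> real) \<Rightarrow> real \<Rightarrow> real \<Rightarrow> real" where
  "pd2 S k x \<xi> = frechet_derivative (\<lambda>(x, \<xi>). k x \<xi>) (at (x, \<xi>) within S) (0, 1)"

definition C1_on :: "(real \<times> real) set \<Rightarrow> (real \<Rightarrow> real \<Rightarrow> real) \<Rightarrow> bool" where
  "C1_on S k \<longleftrightarrow> (\<lambda>(x, \<xi>). k x \<xi>) differentiable_on S
     \<and> continuous_on S (\<lambda>(x, \<xi>). pd1 S k x \<xi>) \<and> continuous_on S (\<lambda>(x, \<xi>). pd2 S k x \<xi>)"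

definition K_kernel_eqs :: "mode \<Rightarrow> kernels \<Rightarrow> bool" where
  "K_kernel_eqs d0 K \<longleftrightarrow>
     C1_on tri_dom (Kuu K) \<and> C1_on tri_dom (Kuv K) \<and> C1_on tri_dom (Kvu K) \<and> C1_on tri_dom (Kvv K)
   \<and> (\<forall>(x, \<xi>) \<in> tri_dom.
        lam d0 * (pd1 tri_dom (Kuu K) x \<xi> + pd2 tri_dom (Kuu K) x \<xi>) = - sigm d0 * Kuv K x \<xi>
      \<and> lam d0 * pd1 tri_dom (Kuv K) x \<xi> - mu d0 * pd2 tri_dom (Kuv K) x \<xi> = - sigp d0 * Kuu K x \<xi>
      \<and> mu d0 * pd1 tri_dom (Kvu K) x \<xi> - lam d0 * pd2 tri_dom (Kvu K) x \<xi> = sigm d0 * Kvv K x \<xi>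
      \<and> mu d0 * (pd1 tri_dom (Kvv K) x \<xi> + pd2 tri_dom (Kvv K) x \<xi>) = sigp d0 * Kvu K x \<xi>)
   \<and> (\<forall>x \<in> {0..1}.
        Kuv K x x = sigp d0 / (lam d0 + mu d0)
      \<and> Kuu K x 0 = mu d0 / (lam d0 * phi d0) * Kuv K x 0
      \<and> Kvu K x x = - sigm d0 / (lam d0 + mu d0)
      \<and> Kvv K x 0 = lam d0 * phi d0 / mu d0 * Kvu K x 0)"

text \<open>
  The data of \<open>q1\<close> do not match at the corner \<open>(0, 1)\<close>: \<open>q1 x 1 = 0\<close>, whereas
  \<open>q1 0 1 = Kvu 1 1 = - sigm / (lam + mu)\<close>. Unless \<open>sigm\<close> vanishes, the solution is therefore
  discontinuous across the characteristic through that corner and its reflection at \<open>\<xi> = 0\<close>.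
  Hence the differential equations are required at the points of differentiability,
  which are almost all points of the square. Jumps only travel along characteristics,
  i.e. each component is continuous along its own ones. Solutions that are continuously
  differentiable on the whole square are included.
\<close>

definition q_regular :: "kernels \<Rightarrow> (real \<times> real) set" where
  "q_regular K = {p \<in> sq_dom. (\<lambda>(x, \<xi>). q1 K x \<xi>) differentiable (at p within sq_dom)
     \<and> (\<lambda>(x, \<xi>). q2 K x \<xi>) differentiable (at p within sq_dom)}"

definition q_kernel_eqs :: "real \<Rightarrow> mode \<Rightarrow> kernels \<Rightarrow> bool" where
  "q_kernel_eqs D d0 K \<longleftrightarrow>
     negligible (sq_dom - q_regular K)
   \<and> (\<forall>(x, \<xi>) \<in> q_regular K.
        1 / D * pd1 sq_dom (q1 K) x \<xi> - lam d0 * pd2 sq_dom (q1 K) x \<xi> = sigm d0 * q2 K x \<xi>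
      \<and> 1 / D * pd1 sq_dom (q2 K) x \<xi> + mu d0 * pd2 sq_dom (q2 K) x \<xi> = sigp d0 * q1 K x \<xi>)
   \<and> (\<forall>(x, \<xi>) \<in> sq_dom.
        continuous_on {s. (x + s / D, \<xi> - lam d0 * s) \<in> sq_dom} (\<lambda>s. q1 K (x + s / D) (\<xi> - lam d0 * s))
      \<and> continuous_on {s. (x + s / D, \<xi> + mu d0 * s) \<in> sq_dom} (\<lambda>s. q2 K (x + s / D) (\<xi> + mu d0 * s)))
   \<and> (\<forall>x \<in> {0<..1}. q1 K x 1 = 0)
   \<and> (\<forall>x \<in> {0..1}. q1 K x 0 = mu d0 / (phi d0 * lam d0) * q2 K x 0)
   \<and> (\<forall>\<xi> \<in> {0..1}. q1 K 0 \<xi> = Kvu K 1 \<xi> \<and> q2 K 0 \<xi> = Kvv K 1 \<xi>)"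

definition pker :: "real \<Rightarrow> mode \<Rightarrow> kernels \<Rightarrow> real \<Rightarrow> real" where
  "pker D d0 K x = D * mu d0 * q2 K x 1"

text \<open>
  A state is a triple of functions on \<open>[0, 1]\<close>, encoded as one function into the Euclidean
  space \<open>real \<times> real \<times> real\<close>; its values outside \<open>[0, 1]\<close> are irrelevant.
\<close>

type_synonym state = "real \<Rightarrow> real \<times> real \<times> real"

abbreviation c1st :: "real \<times> real \<times> real \<Rightarrow> real" where "c1st y \<equiv> fst y"
abbreviation c2nd :: "real \<times> real \<times> real \<Rightarrow> real" where "c2nd y \<equiv> fst (snd y)"
abbreviation c3rd :: "real \<times> real \<times> real \<Rightarrow> real" where "c3rd y \<equiv> snd (snd y)"

definition L2 :: "(real \<Rightarrow> 'a::euclidean_space) \<Rightarrow> bool" where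
  "L2 f \<longleftrightarrow> f \<in> borel_measurable (lebesgue_on {0..1})
     \<and> integrable (lebesgue_on {0..1}) (\<lambda>x. (norm (f x))\<^sup>2)"

definition L2norm :: "(real \<Rightarrow> 'a::euclidean_space) \<Rightarrow> real" where
  "L2norm f = sqrt (LINT x|lebesgue_on {0..1}. (norm (f x))\<^sup>2)"

definition transf :: "real \<Rightarrow> mode \<Rightarrow> kernels \<Rightarrow> state \<Rightarrow> state" where
  "transf D d0 K w = (\<lambda>x.
     (c1st (w x)
        - (LINT \<xi>|lebesgue_on {0..x}. Kuu K x \<xi> * c1st (w \<xi>) + Kuv K x \<xi> * c2nd (w \<xi>)),
      c2nd (w x)
        - (LINT \<xi>|lebesgue_on {0..x}. Kvu K x \<xi> * c1st (w \<xi>) + Kvv K x \<xi> * c2nd (w \<xi>)),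
      c3rd (w x)
        - (LINT \<xi>|lebesgue_on {0..x}. pker D d0 K (x - \<xi>) * c3rd (w \<xi>))
        - (LINT \<xi>|lebesgue_on {0..1}. q1 K x \<xi> * c1st (w \<xi>))
        - (LINT \<xi>|lebesgue_on {0..1}. q2 K x \<xi> * c2nd (w \<xi>))))"

definition L2_bijective :: "(state \<Rightarrow> state) \<Rightarrow> bool" where
  "L2_bijective \<Phi> \<longleftrightarrow> (\<forall>w. L2 w \<longrightarrow> L2 (\<Phi> w))
     \<and> (\<forall>y. L2 y \<longrightarrow> (\<exists>w. L2 w \<and> (AE x in lebesgue_on {0..1}. \<Phi> w x = y x)))
     \<and> (\<forall>w w'. L2 w \<longrightarrow> L2 w' \<longrightarrow> (AE x in lebesgue_on {0..1}. \<Phi> w x = \<Phi> w' x)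
           \<longrightarrow> (AE x in lebesgue_on {0..1}. w x = w' x))"

text \<open>
  The preimage is taken pointwise because \<open>\<eta>(0)\<close> enters the target system. Changing \<open>w\<close> on a null
  set does not affect the integrals in \<open>transf\<close>, so a preimage almost everywhere can be modified
  to a pointwise one, and the latter is unique on \<open>[0, 1]\<close>.
\<close>

definition preimg :: "real \<Rightarrow> mode \<Rightarrow> kernels \<Rightarrow> state \<Rightarrow> state" where
  "preimg D d0 K y = (SOME w. L2 w \<and> (\<forall>x \<in> {0..1}. transf D d0 K w x = y x))"

definition f1 :: "mode \<Rightarrow> mode \<Rightarrow> real" where
  "f1 d0 d = sigp d - sigp d0 * ((lam d + mu d) / (lam d0 + mu d0))"

definition f2 :: "mode \<Rightarrow> kernels \<Rightarrow> mode \<Rightarrow> real \<Rightarrow> real" where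
  "f2 d0 K d x = (mu d - lam d * phi d * mu d0 / (lam d0 * phi d0)) * Kuv K x 0"

definition f3 :: "mode \<Rightarrow> kernels \<Rightarrow> mode \<Rightarrow> real \<Rightarrow> real \<Rightarrow> real" where
  "f3 d0 K d x \<xi> = (lam d / lam d0 * sigm d0 - sigm d) * Kuv K x \<xi>"

definition f4 :: "mode \<Rightarrow> kernels \<Rightarrow> mode \<Rightarrow> real \<Rightarrow> real \<Rightarrow> real" where
  "f4 d0 K d x \<xi> = (lam d0 - lam d) * pd1 tri_dom (Kuv K) x \<xi>
     + (mu d - mu d0) * pd2 tri_dom (Kuv K) x \<xi> - (sigp d - sigp d0) * Kuu K x \<xi>"

definition g1 :: "mode \<Rightarrow> mode \<Rightarrow> real" where
  "g1 d0 d = sigm d - (lam d + mu d) / (lam d0 + mu d0) * sigm d0"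

definition g2 :: "mode \<Rightarrow> kernels \<Rightarrow> mode \<Rightarrow> real \<Rightarrow> real" where
  "g2 d0 K d x = (- lam d * phi d + mu d * (lam d0 * phi d0 / mu d0)) * Kvu K x 0"

definition g3 :: "mode \<Rightarrow> kernels \<Rightarrow> mode \<Rightarrow> real \<Rightarrow> real \<Rightarrow> real" where
  "g3 d0 K d x \<xi> = (mu d - mu d0) * pd1 tri_dom (Kvu K) x \<xi>
     - (lam d - lam d0) * pd2 tri_dom (Kvu K) x \<xi> - (sigm d - sigm d0) * Kvv K x \<xi>"

definition g4 :: "mode \<Rightarrow> kernels \<Rightarrow> mode \<Rightarrow> real \<Rightarrow> real \<Rightarrow> real" where
  "g4 d0 K d x \<xi> = (sigp d0 * mu d / mu d0 - sigp d) * Kvu K x \<xi>"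

definition h1 :: "real \<Rightarrow> mode \<Rightarrow> kernels \<Rightarrow> mode \<Rightarrow> real \<Rightarrow> real" where
  "h1 D d0 K d x = pker D d0 K x - D * mu d * q2 K x 1"

definition h2 :: "real \<Rightarrow> kernels \<Rightarrow> mode \<Rightarrow> real \<Rightarrow> real" where
  "h2 D K d x = D * mu d * q2 K x 0 - D * lam d * phi d * q1 K x 0"

definition h3 :: "real \<Rightarrow> mode \<Rightarrow> kernels \<Rightarrow> mode \<Rightarrow> real \<Rightarrow> real \<Rightarrow> real" where
  "h3 D d0 K d x \<xi> = D * (lam d0 - lam d) * pd2 sq_dom (q1 K) x \<xi> + D * (sigm d0 - sigm d) * q2 K x \<xi>"

definition h4 :: "real \<Rightarrow> mode \<Rightarrow> kernels \<Rightarrow> mode \<Rightarrow> real \<Rightarrow> real \<Rightarrow> real" where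
  "h4 D d0 K d x \<xi> = D * (mu d0 - mu d) * pd2 sq_dom (q2 K) x \<xi> + D * (sigp d0 - sigp d) * q1 K x \<xi>"

definition pertF :: "real \<Rightarrow> mode \<Rightarrow> kernels \<Rightarrow> mode \<Rightarrow> state \<Rightarrow> real \<Rightarrow> real" where
  "pertF D d0 K d y x = (let w = preimg D d0 K y in
     f1 d0 d * c2nd (w x) + f2 d0 K d x * c2nd (y 0)
     + (LINT \<xi>|lebesgue_on {0..x}. f3 d0 K d x \<xi> * c1st (w \<xi>) + f4 d0 K d x \<xi> * c2nd (w \<xi>)))"

definition pertG :: "real \<Rightarrow> mode \<Rightarrow> kernels \<Rightarrow> mode \<Rightarrow> state \<Rightarrow> real \<Rightarrow> real" where
  "pertG D d0 K d y x = (let w = preimg D d0 K y in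
     g1 d0 d * c1st (w x) + g2 d0 K d x * c2nd (y 0)
     + (LINT \<xi>|lebesgue_on {0..x}. g3 d0 K d x \<xi> * c1st (w \<xi>) + g4 d0 K d x \<xi> * c2nd (w \<xi>)))"

definition pertH :: "real \<Rightarrow> mode \<Rightarrow> kernels \<Rightarrow> mode \<Rightarrow> state \<Rightarrow> real \<Rightarrow> real" where
  "pertH D d0 K d y x = (let w = preimg D d0 K y in
     h1 D d0 K d x * c3rd (w 0) + h2 D K d x * c2nd (y 0)
     + (LINT \<xi>|lebesgue_on {0..1}. h3 D d0 K d x \<xi> * c1st (w \<xi>) + h4 D d0 K d x \<xi> * c2nd (w \<xi>)))"

definition pert :: "real \<Rightarrow> mode \<Rightarrow> kernels \<Rightarrow> mode \<Rightarrow> state \<Rightarrow> state" where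
  "pert D d0 K d y = (\<lambda>x. (pertF D d0 K d y x, pertG D d0 K d y x, pertH D d0 K d y x / D))"

text \<open>
  \<open>has_wderiv y y'\<close>: \<open>y\<close> is the continuous representative of an \<open>H\<^sup>1\<close> function with
  weak derivative \<open>y'\<close>. For continuously differentiable \<open>y\<close> this is the ordinary derivative.
\<close>

definition has_wderiv :: "state \<Rightarrow> state \<Rightarrow> bool" where
  "has_wderiv y y' \<longleftrightarrow> L2 y' \<and> (\<forall>x \<in> {0..1}. y x = y 0 + (LINT s|lebesgue_on {0..x}. y' s))"

definition wderiv :: "state \<Rightarrow> state" where
  "wderiv y = (SOME y'. has_wderiv y y')"

definition transport :: "real \<Rightarrow> mode \<Rightarrow> state \<Rightarrow> state" where
  "transport D d y =
     (\<lambda>x. (- lam d * c1st (wderiv y x), mu d * c2nd (wderiv y x), c3rd (wderiv y x) / D))"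

definition target_domain :: "mode \<Rightarrow> state \<Rightarrow> bool" where
  "target_domain d y \<longleftrightarrow> (\<exists>y'. has_wderiv y y')
     \<and> c1st (y 0) = phi d * c2nd (y 0) \<and> c2nd (y 1) = c3rd (y 0) \<and> c3rd (y 1) = 0"

definition target_rhs :: "real \<Rightarrow> mode \<Rightarrow> kernels \<Rightarrow> mode \<Rightarrow> state \<Rightarrow> state" where
  "target_rhs D d0 K d y = (\<lambda>x. transport D d y x + pert D d0 K d y x)"

text \<open>
  Classical solutions on the time interval \<open>[0, T]\<close> in the sense of semigroup theory:
  continuously differentiable in time with values in \<open>L\<^sup>2\<close>, in \<open>H\<^sup>1\<close> and subject to the boundary
  conditions at every time. Functions that are continuously differentiable on
  \<open>[0, T] \<times> [0, 1]\<close> and satisfy the target system pointwise are among them. That narrower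
  class is too small in general, since \<open>h1\<close> and \<open>h2\<close> inherit the jumps of \<open>q1\<close> and \<open>q2\<close>.
\<close>

definition classical_solution ::
  "real \<Rightarrow> mode \<Rightarrow> kernels \<Rightarrow> mode \<Rightarrow> real \<Rightarrow> (real \<Rightarrow> state) \<Rightarrow> bool" where
  "classical_solution D d0 K d T Y \<longleftrightarrow> (\<exists>Y'. \<forall>t \<in> {0..T}.
     target_domain d (Y t) \<and> L2 (Y' t)
   \<and> ((\<lambda>s. L2norm (\<lambda>x. (Y s x - Y t x) /\<^sub>R (s - t) - Y' t x)) \<longlongrightarrow> 0) (at t within {0..T})
   \<and> ((\<lambda>s. L2norm (\<lambda>x. Y' s x - Y' t x)) \<longlongrightarrow> 0) (at t within {0..T})
   \<and> (AE x in lebesgue_on {0..1}. Y' t x = target_rhs D d0 K d (Y t) x))"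

definition lyap :: "real \<Rightarrow> real \<Rightarrow> real \<Rightarrow> real \<Rightarrow> real \<Rightarrow> state \<Rightarrow> real" where
  "lyap D \<rho> \<rho>z a b y =
     (LINT x|lebesgue_on {0..1}. exp (- \<rho> * x) * (c1st (y x))\<^sup>2)
   + a * (LINT x|lebesgue_on {0..1}. exp (\<rho> * x) * (c2nd (y x))\<^sup>2)
   + b * D * (LINT x|lebesgue_on {0..1}. exp (\<rho>z * D * x) * (c3rd (y x))\<^sup>2)"

definition has_L2_frechet :: "(state \<Rightarrow> real) \<Rightarrow> (state \<Rightarrow> real) \<Rightarrow> state \<Rightarrow> bool" where
  "has_L2_frechet \<Phi> L y \<longleftrightarrow>
     (\<forall>h k. L2 h \<longrightarrow> L2 k \<longrightarrow> L (\<lambda>x. h x + k x) = L h + L k)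
   \<and> (\<forall>c h. L2 h \<longrightarrow> L (\<lambda>x. c *\<^sub>R h x) = c * L h)
   \<and> (\<exists>B. \<forall>h. L2 h \<longrightarrow> \<bar>L h\<bar> \<le> B * L2norm h)
   \<and> (\<forall>e>0. \<exists>\<epsilon>>0. \<forall>h. L2 h \<longrightarrow> L2norm h < \<epsilon> \<longrightarrow>
        \<bar>\<Phi> (\<lambda>x. y x + h x) - \<Phi> y - L h\<bar> \<le> e * L2norm h)"

definition L2_frechet :: "(state \<Rightarrow> real) \<Rightarrow> state \<Rightarrow> state \<Rightarrow> real" where
  "L2_frechet \<Phi> y = (SOME L. has_L2_frechet \<Phi> L y)"

text \<open>
  Mode process on the time axis \<open>[t0, \<infinity>)\<close>. For a chain with measurable transition rates
  bounded by some constant, the probability of passing from \<open>i\<close> to \<open>k \<noteq> i\<close> during a time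
  \<open>h\<close> is at most a constant times \<open>h\<close>; the last clause states the boundedness of the rates in
  this integrated form, without restricting their regularity in time.
\<close>

definition mode_process :: "'w measure \<Rightarrow> nat set \<Rightarrow> real \<Rightarrow> (real \<Rightarrow> 'w \<Rightarrow> nat) \<Rightarrow> bool" where
  "mode_process P R t0 m \<longleftrightarrow> prob_space P
   \<and> (\<forall>s\<ge>t0. m s \<in> measurable P (count_space R))
   \<and> (\<forall>\<omega> \<in> space P. \<forall>s\<ge>t0. \<exists>e>0. \<forall>s' \<in> {s..<s + e}. m s' \<omega> = m s \<omega>)
   \<and> (\<forall>n (ts :: nat \<Rightarrow> real) ks s k.
        t0 \<le> ts 0 \<longrightarrow> (\<forall>i<n. ts i < ts (Suc i)) \<longrightarrow> ts n < s \<longrightarrow>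
        \<P>(\<omega> in P. \<forall>i\<le>n. m (ts i) \<omega> = ks i) > 0 \<longrightarrow>
        \<P>(\<omega> in P. m s \<omega> = k \<bar> \<forall>i\<le>n. m (ts i) \<omega> = ks i)
          = \<P>(\<omega> in P. m s \<omega> = k \<bar> m (ts n) \<omega> = ks n))
   \<and> (\<exists>\<tau>. \<forall>s\<ge>t0. \<forall>h\<ge>0. \<forall>i\<in>R. \<forall>k\<in>R. i \<noteq> k \<longrightarrow> \<P>(\<omega> in P. m (s + h) \<omega> = k \<bar> m s \<omega> = i) \<le> \<tau> * h)"

text \<open>
  Realisation \<open>(m, X)\<close> of mode and state from time \<open>t\<close> on, given that the mode at time \<open>t\<close> is \<open>j\<close>
  and the state is \<open>Y t\<close>, where \<open>Y\<close> solves the target system in mode \<open>j\<close> on \<open>[0, T]\<close>.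
  The state follows \<open>Y\<close> until the first jump of the mode; it is not reset at jumps, i.e. it leaves
  its value at time \<open>t\<close> continuously in \<open>L\<^sup>2\<close>, uniformly over the realisations of the mode
  process. The motion after the first jump does not matter otherwise.
\<close>

definition switched_process ::
  "nat set \<Rightarrow> 'w measure \<Rightarrow> (real \<Rightarrow> 'w \<Rightarrow> nat) \<Rightarrow> (real \<Rightarrow> 'w \<Rightarrow> state)
     \<Rightarrow> nat \<Rightarrow> real \<Rightarrow> real \<Rightarrow> (real \<Rightarrow> state) \<Rightarrow> bool" where
  "switched_process R P m X j t T Y \<longleftrightarrow>
     mode_process P R t m
   \<and> \<P>(\<omega> in P. m t \<omega> = j) > 0
   \<and> (\<forall>s\<ge>t. (\<lambda>(\<omega>, x). X s \<omega> x) \<in> borel_measurable (P \<Otimes>\<^sub>M lebesgue_on {0..1}))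
   \<and> (\<forall>s\<ge>t. \<forall>\<omega> \<in> space P. L2 (X s \<omega>))
   \<and> (\<forall>\<omega> \<in> space P. \<forall>s \<in> {t..T}. (\<forall>s' \<in> {t..s}. m s' \<omega> = j) \<longrightarrow>
        (AE x in lebesgue_on {0..1}. X s \<omega> x = Y s x))
   \<and> (\<forall>e>0. \<exists>\<epsilon>>0. \<forall>h \<in> {0..<\<epsilon>}. \<forall>\<omega> \<in> space P. m t \<omega> = j \<longrightarrow>
        L2norm (\<lambda>x. X (t + h) \<omega> x - X t \<omega> x) < e)"

definition generator ::
  "(state \<Rightarrow> real) \<Rightarrow> 'w measure \<Rightarrow> (real \<Rightarrow> 'w \<Rightarrow> nat) \<Rightarrow> (real \<Rightarrow> 'w \<Rightarrow> state)
     \<Rightarrow> nat \<Rightarrow> real \<Rightarrow> state \<Rightarrow> ereal" where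
  "generator \<Phi> P m X j t y = Limsup (at_right 0) (\<lambda>h. ereal
     (((LINT \<omega>|uniform_measure P {\<omega> \<in> space P. m t \<omega> = j}. \<Phi> (X (t + h) \<omega>)) - \<Phi> y) / h))"

end

theory Submission
  imports Defs
begin

text \<open>
  \<open>V\<close> is the square of a weighted \<open>L\<^sup>2\<close> norm, so with the corresponding bilinear form \<open>B\<close> its
  derivative at \<open>y\<close> is \<open>h \<mapsto> 2 B(y, h)\<close>. For the transport part of the right-hand side, integration
  by parts against the exponential weights yields \<open>- \<nu> V\<close> together with boundary terms, which the
  boundary conditions turn into \<open>- \<gamma>\<beta> \<beta>(0)\<^sup>2 - \<gamma>z z(0)\<^sup>2\<close>. The perturbation is linear in
  \<open>(u, v, \<eta>)\<close> and \<open>\<beta>(0)\<close> with coefficients of size \<open>M0 \<Delta>\<close>; Young's inequality, with weights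
  \<open>c1, \<dots>, c4\<close> for the point values, bounds its contribution, where \<open>\<eta>(0)\<close> is read off
  from the third component of the transformation at \<open>x = 0\<close>. For the generator, a mode process with
  bounded rates jumps before time \<open>h\<close> with probability \<open>O(h)\<close> only.
\<close>

subsection \<open>Square integrable functions on the unit interval\<close>

text \<open>States are functions rather than classes modulo null sets: many equalities hold only
  almost everywhere, yet the point values beta(0), z(0) and eta(0) matter. Measurability of the
  perturbation is never derived from its formula. Its upper estimates use nonnegative integrable
  majorants, and against these a non-integrable function does no harm, because its Bochner integral
  is 0. Square integrability of the whole right-hand side is inherited from the time derivative of
  the solution, which agrees with it almost everywhere; this uses completeness of Lebesgue measure.
  Since \<open>q1\<close> and \<open>q2\<close> may jump, the coefficients of the third equation are
  controlled only at almost all points of the square, so their bounds are used on almost every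
  section. For the generator, the Markov property is available at finitely many times only; the
  event of no jump is therefore reached through dyadic grids and right-constant paths.\<close>

lemma complete_measure_restrict_space:
  assumes "complete_measure M" "S \<in> sets M"
  shows "complete_measure (restrict_space M S)"
proof
  fix A B assume "B \<subseteq> A" "A \<in> null_sets (restrict_space M S)"
  then show "B \<in> sets (restrict_space M S)"
    using assms by (auto simp: null_sets_restrict_space sets_restrict_space_iff
        dest: complete_measure.complete[OF assms(1)])
qed

text \<open>Outside the exceptional null set the preimages under both functions coincide, and inside
  it completeness makes every subset measurable.\<close>

lemma (in complete_measure) borel_measurable_cong_AE:
  fixes f g :: "'a \<Rightarrow> 'b :: topological_space"
  assumes "AE x in M. f x = g x" "f \<in> borel_measurable M"
  shows "g \<in> borel_measurable M"
proof (rule measurableI)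
  fix A :: "'b set" assume A: "A \<in> sets borel"
  have N: "{x \<in> space M. f x \<noteq> g x} \<in> null_sets M"
    using assms(1) by (simp add: AE_iff_null_sets)
  have "g -` A \<inter> space M = (f -` A \<inter> space M - {x \<in> space M. f x \<noteq> g x}) \<union> (g -` A \<inter> {x \<in> space M. f x \<noteq> g x})"
    by auto
  moreover have "g -` A \<inter> {x \<in> space M. f x \<noteq> g x} \<in> sets M"
    by (rule complete[OF _ N]) auto
  ultimately show "g -` A \<inter> space M \<in> sets M"
    using measurable_sets[OF assms(2) A] N by auto
qed simp

lemma (in complete_measure) integrable_cong_AE_complete:
  fixes f g :: "'a \<Rightarrow> 'b :: {banach, second_countable_topology}"
  assumes "AE x in M. f x = g x"
  shows "integrable M f \<longleftrightarrow> integrable M g"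
proof -
  have "AE x in M. g x = f x" using assms by auto
  then have "f \<in> borel_measurable M \<longleftrightarrow> g \<in> borel_measurable M"
    using borel_measurable_cong_AE[OF assms] borel_measurable_cong_AE[of g f] by blast
  then show ?thesis
    using assms by (metis integrable_cong_AE borel_measurable_integrable)
qed

lemma (in complete_measure) integral_cong_AE_complete:
  fixes f g :: "'a \<Rightarrow> 'b :: {banach, second_countable_topology}"
  assumes "AE x in M. f x = g x"
  shows "integral\<^sup>L M f = integral\<^sup>L M g"
proof (cases "integrable M f")
  case True
  then have "integrable M g" using integrable_cong_AE_complete[OF assms] by simp
  with True assms show ?thesis by (intro integral_cong_AE) auto
next
  case False
  then show ?thesis
    using integrable_cong_AE_complete[OF assms] by (simp add: not_integrable_integral_eq)
qed

lemma complete_lebesgue_on: "S \<in> sets lebesgue \<Longrightarrow> complete_measure (lebesgue_on S)"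
  by (intro complete_measure_restrict_space completion.complete_measure_axioms)

lemma sigma_finite_lebesgue_on_Icc: "sigma_finite_measure (lebesgue_on {a..b::real})"
  by (intro finite_measure.sigma_finite_measure finite_measure_lebesgue_on) simp

lemma AE_lebesgue_on_subset:
  assumes "AE x in lebesgue_on T. P x" "S \<subseteq> T" "S \<in> sets lebesgue" "T \<in> sets lebesgue"
  shows "AE x in lebesgue_on S. P x"
  using assms by (auto simp: AE_restrict_space_iff)

text \<open>If \<open>f\<close> is not integrable, its integral is 0 by convention, and the
  nonnegative majorant takes care of this case. The perturbation can thus be estimated without a
  measurability proof for it.\<close>

lemma integral_le_of_AE_le:
  fixes f g :: "'a \<Rightarrow> real"
  assumes "integrable M g" "AE x in M. f x \<le> g x" "AE x in M. 0 \<le> g x"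
  shows "integral\<^sup>L M f \<le> integral\<^sup>L M g"
proof (cases "integrable M f")
  case True
  then show ?thesis using assms by (intro integral_mono_AE) auto
next
  case False
  then show ?thesis using assms by (simp add: not_integrable_integral_eq integral_nonneg_AE)
qed

abbreviation unit_leb :: "real measure" where
  "unit_leb \<equiv> lebesgue_on {0..1}"

interpretation unit_leb: complete_measure unit_leb
  by (rule complete_lebesgue_on) simp

interpretation unit_leb: prob_space unit_leb
  by (rule prob_spaceI) (simp add: emeasure_restrict_space)

lemma measure_unit_leb [simp]: "measure unit_leb {0..1} = 1"
  using unit_leb.prob_space by simp

lemma integrable_mult_of_squares:
  fixes f g :: "'a \<Rightarrow> real"
  assumes [measurable]: "f \<in> borel_measurable M" "g \<in> borel_measurable M"
    and "integrable M (\<lambda>x. (f x)\<^sup>2)" "integrable M (\<lambda>x. (g x)\<^sup>2)"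
  shows "integrable M (\<lambda>x. f x * g x)"
proof (rule Bochner_Integration.integrable_bound)
  show "integrable M (\<lambda>x. (f x)\<^sup>2 + (g x)\<^sup>2)" using assms by simp
  show "AE x in M. norm (f x * g x) \<le> norm ((f x)\<^sup>2 + (g x)\<^sup>2)"
  proof (rule AE_I2)
    fix x
    have "2 * \<bar>f x * g x\<bar> \<le> (f x)\<^sup>2 + (g x)\<^sup>2"
      using sum_squares_bound[of "\<bar>f x\<bar>" "\<bar>g x\<bar>"] by (simp add: abs_mult)
    then show "norm (f x * g x) \<le> norm ((f x)\<^sup>2 + (g x)\<^sup>2)"
      using sum_power2_ge_zero[of "f x" "g x"] by simp
  qed
qed simp

lemma norm_triple_square:
  fixes p :: "real \<times> real \<times> real"
  shows "(norm p)\<^sup>2 = (c1st p)\<^sup>2 + (c2nd p)\<^sup>2 + (c3rd p)\<^sup>2"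
  by (cases p) (auto simp: norm_Pair)

definition sq_int :: "(real \<Rightarrow> real) \<Rightarrow> bool" where
  "sq_int f \<longleftrightarrow> f \<in> borel_measurable unit_leb \<and> integrable unit_leb (\<lambda>x. (f x)\<^sup>2)"

lemma sq_int_mult: "sq_int f \<Longrightarrow> sq_int g \<Longrightarrow> integrable unit_leb (\<lambda>x. f x * g x)"
  unfolding sq_int_def by (intro integrable_mult_of_squares) auto

lemma sq_int_const: "sq_int (\<lambda>x. c)"
  unfolding sq_int_def by simp

lemma sq_int_integrable: "sq_int f \<Longrightarrow> integrable unit_leb f"
  using sq_int_mult[of f "\<lambda>_. 1"] sq_int_const[of 1] by simp

lemma sq_int_square: "sq_int f \<Longrightarrow> integrable unit_leb (\<lambda>x. (f x)\<^sup>2)"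
  by (simp add: sq_int_def)

lemma sq_int_add:
  assumes "sq_int f" "sq_int g"
  shows "sq_int (\<lambda>x. f x + g x)"
  using assms sq_int_mult[OF assms] unfolding sq_int_def
  by (auto simp: power2_sum mult.assoc intro!: borel_measurable_add)

lemma sq_int_cmult:
  assumes "sq_int f"
  shows "sq_int (\<lambda>x. c * f x)"
  using assms unfolding sq_int_def
  by (auto simp: power_mult_distrib intro!: borel_measurable_times)

lemma sq_int_diff:
  assumes "sq_int f" "sq_int g"
  shows "sq_int (\<lambda>x. f x - g x)"
  using sq_int_add[OF assms(1) sq_int_cmult[OF assms(2), of "-1"]] by simp

lemma borel_measurable_triple_iff:
  fixes y :: "'a \<Rightarrow> real \<times> real \<times> real"
  shows "y \<in> borel_measurable M \<longleftrightarrow> (\<lambda>x. c1st (y x)) \<in> borel_measurable M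
    \<and> (\<lambda>x. c2nd (y x)) \<in> borel_measurable M \<and> (\<lambda>x. c3rd (y x)) \<in> borel_measurable M"
proof
  assume [measurable]: "y \<in> borel_measurable M"
  have "fst \<in> borel_measurable (borel :: (real \<times> real \<times> real) measure)"
    "(\<lambda>p. fst (snd p)) \<in> borel_measurable (borel :: (real \<times> real \<times> real) measure)"
    "(\<lambda>p. snd (snd p)) \<in> borel_measurable (borel :: (real \<times> real \<times> real) measure)"
    by (intro borel_measurable_continuous_onI continuous_intros)+
  then show "(\<lambda>x. c1st (y x)) \<in> borel_measurable M
    \<and> (\<lambda>x. c2nd (y x)) \<in> borel_measurable M \<and> (\<lambda>x. c3rd (y x)) \<in> borel_measurable M"
    using measurable_compose[OF \<open>y \<in> borel_measurable M\<close>] by blast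
next
  assume "(\<lambda>x. c1st (y x)) \<in> borel_measurable M
    \<and> (\<lambda>x. c2nd (y x)) \<in> borel_measurable M \<and> (\<lambda>x. c3rd (y x)) \<in> borel_measurable M"
  then have "(\<lambda>x. (c1st (y x), c2nd (y x), c3rd (y x))) \<in> borel_measurable M"
    by (intro borel_measurable_Pair) auto
  then show "y \<in> borel_measurable M" by simp
qed

lemma L2_iff_sq_int:
  fixes y :: state
  shows "L2 y \<longleftrightarrow> sq_int (\<lambda>x. c1st (y x)) \<and> sq_int (\<lambda>x. c2nd (y x)) \<and> sq_int (\<lambda>x. c3rd (y x))"
proof
  assume L: "L2 y"
  then have [measurable]: "(\<lambda>x. c1st (y x)) \<in> borel_measurable unit_leb"
    "(\<lambda>x. c2nd (y x)) \<in> borel_measurable unit_leb" "(\<lambda>x. c3rd (y x)) \<in> borel_measurable unit_leb"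
    unfolding L2_def borel_measurable_triple_iff by auto
  have i: "integrable unit_leb (\<lambda>x. (c1st (y x))\<^sup>2 + (c2nd (y x))\<^sup>2 + (c3rd (y x))\<^sup>2)"
    using L by (simp add: L2_def norm_triple_square)
  show "sq_int (\<lambda>x. c1st (y x)) \<and> sq_int (\<lambda>x. c2nd (y x)) \<and> sq_int (\<lambda>x. c3rd (y x))"
    unfolding sq_int_def by (auto intro!: Bochner_Integration.integrable_bound[OF i] AE_I2)
next
  assume "sq_int (\<lambda>x. c1st (y x)) \<and> sq_int (\<lambda>x. c2nd (y x)) \<and> sq_int (\<lambda>x. c3rd (y x))"
  then show "L2 y"
    by (simp add: sq_int_def L2_def norm_triple_square borel_measurable_triple_iff)
qed

lemma L2D:
  assumes "L2 (y :: state)"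
  shows "sq_int (\<lambda>x. c1st (y x))" "sq_int (\<lambda>x. c2nd (y x))" "sq_int (\<lambda>x. c3rd (y x))"
  using assms by (auto simp: L2_iff_sq_int)

lemma L2norm_square: "(L2norm f)\<^sup>2 = (LINT x|unit_leb. (norm (f x))\<^sup>2)"
  unfolding L2norm_def by (simp add: integral_nonneg_AE)

lemma L2norm_nonneg: "0 \<le> L2norm f"
  unfolding L2norm_def by (simp add: integral_nonneg_AE)

lemma L2norm_square_components:
  fixes y :: state
  assumes "L2 y"
  shows "(L2norm y)\<^sup>2 = (LINT x|unit_leb. (c1st (y x))\<^sup>2) + (LINT x|unit_leb. (c2nd (y x))\<^sup>2)
    + (LINT x|unit_leb. (c3rd (y x))\<^sup>2)"
  using L2D[OF assms] by (simp add: L2norm_square norm_triple_square sq_int_square)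

lemma L2_add: "L2 y \<Longrightarrow> L2 z \<Longrightarrow> L2 (\<lambda>x. y x + z x :: real \<times> real \<times> real)"
  by (simp add: L2_iff_sq_int sq_int_add)

lemma L2_diff: "L2 y \<Longrightarrow> L2 z \<Longrightarrow> L2 (\<lambda>x. y x - z x :: real \<times> real \<times> real)"
  by (simp add: L2_iff_sq_int sq_int_diff)

lemma L2_scaleR: "L2 y \<Longrightarrow> L2 (\<lambda>x. c *\<^sub>R y x :: real \<times> real \<times> real)"
  by (simp add: L2_iff_sq_int sq_int_cmult)

text \<open>Through this fact \<open>target_rhs\<close> is square integrable along a solution: it
  agrees almost everywhere with the time derivative.\<close>

lemma L2_cong_AE:
  fixes f g :: "real \<Rightarrow> 'a::euclidean_space"
  assumes "AE x in unit_leb. f x = g x" "L2 f"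
  shows "L2 g"
proof -
  have "AE x in unit_leb. (norm (f x))\<^sup>2 = (norm (g x))\<^sup>2" using assms(1) by auto
  then show ?thesis
    using assms(2) unit_leb.borel_measurable_cong_AE[OF assms(1)]
      unit_leb.integrable_cong_AE_complete[of "\<lambda>x. (norm (f x))\<^sup>2" "\<lambda>x. (norm (g x))\<^sup>2"]
    by (simp add: L2_def)
qed

lemma L2norm_cong_AE:
  assumes "AE x in unit_leb. f x = g x"
  shows "L2norm f = L2norm g"
  unfolding L2norm_def using assms
  by (intro arg_cong[where f=sqrt] unit_leb.integral_cong_AE_complete) auto

subsection \<open>Weak derivatives and integration by parts\<close>

text \<open>Absolute continuity on the unit interval with density \<open>f'\<close>. This scalar
  class is closed under products because its continuous members are bounded, which multiplication by
  the exponential weights and squaring require.\<close>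

definition weak_deriv :: "(real \<Rightarrow> real) \<Rightarrow> (real \<Rightarrow> real) \<Rightarrow> bool" where
  "weak_deriv f f' \<longleftrightarrow> integrable unit_leb f'
     \<and> (\<forall>x\<in>{0..1}. f x = f 0 + (LINT s|lebesgue_on {0..x}. f' s))"

lemma weak_deriv_continuous:
  assumes "weak_deriv f f'"
  shows "continuous_on {0..1} f"
proof -
  have "continuous_on {0..1} (\<lambda>x. f 0 + (LINT s|lebesgue_on {0..x}. f' s))"
    using assms unfolding weak_deriv_def
    by (intro continuous_intros indefinite_integral_continuous_real) (elim conjE)
  then show ?thesis
    by (rule continuous_on_eq) (use assms in \<open>unfold weak_deriv_def, metis\<close>)
qed

lemma continuous_sq_int:
  assumes "continuous_on {0..1} f"
  shows "sq_int f"
  unfolding sq_int_def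
  using assms by (auto intro!: continuous_imp_integrable_real continuous_intros
      continuous_imp_measurable_on_sets_lebesgue)

lemma integrable_mult_continuous:
  fixes f g :: "real \<Rightarrow> real"
  assumes "continuous_on {a..b} f" "integrable (lebesgue_on {a..b}) g"
  shows "integrable (lebesgue_on {a..b}) (\<lambda>x. f x * g x)"
proof -
  obtain B where B: "\<And>x. x \<in> {a..b} \<Longrightarrow> \<bar>f x\<bar> \<le> B"
    using compact_imp_bounded[OF compact_continuous_image[OF assms(1) compact_Icc]]
    unfolding bounded_iff by (auto simp del: atLeastAtMost_iff)
  have [measurable]: "f \<in> borel_measurable (lebesgue_on {a..b})"
    using assms(1) by (intro continuous_imp_measurable_on_sets_lebesgue) auto
  show ?thesis
  proof (rule Bochner_Integration.integrable_bound)
    show "integrable (lebesgue_on {a..b}) (\<lambda>x. B * \<bar>g x\<bar>)" using assms(2) by simp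
    show "(\<lambda>x. f x * g x) \<in> borel_measurable (lebesgue_on {a..b})" using assms(2) by measurable
    show "AE x in lebesgue_on {a..b}. norm (f x * g x) \<le> norm (B * \<bar>g x\<bar>)"
    proof (rule AE_I2)
      fix x assume "x \<in> space (lebesgue_on {a..b})"
      then have "\<bar>f x\<bar> * \<bar>g x\<bar> \<le> B * \<bar>g x\<bar>" using B[of x] by (intro mult_right_mono) auto
      then show "norm (f x * g x) \<le> norm (B * \<bar>g x\<bar>)" by (simp add: abs_mult) (meson abs_ge_self abs_ge_zero mult_right_mono order_trans)
    qed
  qed
qed

text \<open>A fixed domain with a truncated integrand turns an integral with variable upper limit
  into a section of a function on the square, ready for Fubini.\<close>

lemma integral_lebesgue_on_Icc_restrict:
  fixes f :: "real \<Rightarrow> real"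
  assumes "t \<le> c"
  shows "(LINT s|lebesgue_on {a..t}. f s) = (LINT s|lebesgue_on {a..c}. (if s \<le> t then f s else 0))"
proof -
  have "(LINT s|lebesgue_on {a..c}. (if s \<le> t then f s else 0))
      = (LINT s|lebesgue_on {a..c}. (if s \<in> {a..t} then f s else 0))"
    by (intro Bochner_Integration.integral_cong) auto
  also have "\<dots> = (LINT s|lebesgue_on {a..t}. f s)"
    using assms by (intro integral_restrict) auto
  finally show ?thesis by simp
qed

lemma AE_lebesgue_on_neq:
  fixes t :: real
  assumes "S \<in> sets lebesgue"
  shows "AE s in lebesgue_on S. s \<noteq> t"
proof -
  have "AE s in lebesgue. s \<noteq> t"
    using AE_lborel_singleton AE_completion by blast
  then have "AE s in lebesgue. s \<in> S \<longrightarrow> s \<noteq> t" by eventually_elim simp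
  then show ?thesis using assms by (simp add: AE_restrict_space_iff)
qed

text \<open>Fubini on the square, split along its diagonal.\<close>

lemma product_of_integrals:
  fixes f g :: "real \<Rightarrow> real"
  assumes f: "integrable (lebesgue_on {a..c}) f" and g: "integrable (lebesgue_on {a..c}) g"
  shows "(LINT s|lebesgue_on {a..c}. f s) * (LINT s|lebesgue_on {a..c}. g s)
    = (LINT t|lebesgue_on {a..c}. f t * (LINT s|lebesgue_on {a..t}. g s)
        + (LINT s|lebesgue_on {a..t}. f s) * g t)"
proof -
  let ?M = "lebesgue_on {a..c}"
  interpret M: sigma_finite_measure ?M by (rule sigma_finite_lebesgue_on_Icc)
  interpret P: pair_sigma_finite ?M ?M ..
  have idm [measurable]: "(\<lambda>x. x) \<in> borel_measurable ?M"
    using id_borel_measurable_lebesgue_on unfolding id_def .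
  note [measurable] = borel_measurable_integrable[OF f] borel_measurable_integrable[OF g]
  have fs [measurable]: "fst \<in> borel_measurable (?M \<Otimes>\<^sub>M ?M)"
    using measurable_compose[OF measurable_fst idm] by simp
  have sn [measurable]: "snd \<in> borel_measurable (?M \<Otimes>\<^sub>M ?M)"
    using measurable_compose[OF measurable_snd idm] by simp
  define H where "H = (\<lambda>(s, t). f s * g t)"
  define H1 where "H1 = (\<lambda>p. if snd p \<le> fst p then H p else 0)"
  define H2 where "H2 = (\<lambda>p. if fst p < snd p then H p else 0)"
  have H_meas [measurable]: "H \<in> borel_measurable (?M \<Otimes>\<^sub>M ?M)"
    unfolding H_def by measurable
  have H: "integrable (?M \<Otimes>\<^sub>M ?M) H"
  proof (rule P.Fubini_integrable)
    show "integrable ?M (\<lambda>x. LINT y|?M. norm (H (x, y)))"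
      using f g by (simp add: H_def abs_mult)
    show "AE x in ?M. integrable ?M (\<lambda>y. H (x, y))"
      using g by (simp add: H_def)
  qed simp
  have H1: "integrable (?M \<Otimes>\<^sub>M ?M) H1"
    by (rule Bochner_Integration.integrable_bound[OF H]) (auto simp: H1_def)
  have H2: "integrable (?M \<Otimes>\<^sub>M ?M) H2"
    by (rule Bochner_Integration.integrable_bound[OF H]) (auto simp: H2_def)
  have "(LINT s|?M. f s) * (LINT s|?M. g s) = integral\<^sup>L (?M \<Otimes>\<^sub>M ?M) H"
    by (subst P.integral_fst'[OF H, symmetric]) (simp add: H_def)
  also have "\<dots> = integral\<^sup>L (?M \<Otimes>\<^sub>M ?M) (\<lambda>p. H1 p + H2 p)"
    by (intro Bochner_Integration.integral_cong) (auto simp: H1_def H2_def)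
  also have "\<dots> = integral\<^sup>L (?M \<Otimes>\<^sub>M ?M) H1 + integral\<^sup>L (?M \<Otimes>\<^sub>M ?M) H2"
    using H1 H2 by simp
  also have "integral\<^sup>L (?M \<Otimes>\<^sub>M ?M) H1 = (LINT t|?M. f t * (LINT s|lebesgue_on {a..t}. g s))"
  proof (subst P.integral_fst'[OF H1, symmetric], rule Bochner_Integration.integral_cong[OF refl])
    fix t assume t: "t \<in> space ?M"
    have "(LINT y|?M. H1 (t, y)) = (LINT y|?M. f t * (if y \<le> t then g y else 0))"
      by (intro Bochner_Integration.integral_cong) (auto simp: H1_def H_def)
    then show "(LINT y|?M. H1 (t, y)) = f t * (LINT s|lebesgue_on {a..t}. g s)"
      using t by (simp add: integral_lebesgue_on_Icc_restrict[of t c])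
  qed
  also have "integral\<^sup>L (?M \<Otimes>\<^sub>M ?M) H2 = (LINT t|?M. (LINT s|lebesgue_on {a..t}. f s) * g t)"
  proof -
    have "integral\<^sup>L (?M \<Otimes>\<^sub>M ?M) H2 = (LINT p|(?M \<Otimes>\<^sub>M ?M). (case p of (x, y) \<Rightarrow> H2 (y, x)))"
      using P.integral_product_swap[of H2] borel_measurable_integrable[OF H2] by simp
    also have "\<dots> = (LINT t|?M. LINT s|?M. H2 (s, t))"
      using P.integral_fst'[OF P.integrable_product_swap[OF H2]] by simp
    also have "\<dots> = (LINT t|?M. (LINT s|lebesgue_on {a..t}. f s) * g t)"
    proof (rule Bochner_Integration.integral_cong[OF refl])
      fix t assume t: "t \<in> space ?M"
      have "(LINT s|?M. H2 (s, t)) = (LINT s|?M. (if s \<le> t then f s else 0) * g t)"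
      proof (rule complete_measure.integral_cong_AE_complete[OF complete_lebesgue_on])
        show "AE s in ?M. H2 (s, t) = (if s \<le> t then f s else 0) * g t"
        proof -
          \<comment> \<open>\<open>H2\<close> lives strictly off the diagonal, whereas the truncated
            integral includes s = t; the two integrands differ only at this point.\<close>
          have "AE s in ?M. s \<noteq> t" by (rule AE_lebesgue_on_neq) simp
          then show ?thesis by eventually_elim (auto simp: H2_def H_def)
        qed
      qed simp
      then show "(LINT s|?M. H2 (s, t)) = (LINT s|lebesgue_on {a..t}. f s) * g t"
        using t by (simp add: integral_lebesgue_on_Icc_restrict[of t c])
    qed
    finally show ?thesis .
  qed
  finally have "(LINT s|?M. f s) * (LINT s|?M. g s) = (LINT t|?M. f t * (LINT s|lebesgue_on {a..t}. g s))
      + (LINT t|?M. (LINT s|lebesgue_on {a..t}. f s) * g t)" .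
  also have "\<dots> = (LINT t|?M. f t * (LINT s|lebesgue_on {a..t}. g s) + (LINT s|lebesgue_on {a..t}. f s) * g t)"
  proof (rule Bochner_Integration.integral_add[symmetric])
    show "integrable ?M (\<lambda>t. f t * (LINT s|lebesgue_on {a..t}. g s))"
      using integrable_mult_continuous[OF indefinite_integral_continuous_real[OF g] f]
      by (simp add: mult.commute)
    show "integrable ?M (\<lambda>t. (LINT s|lebesgue_on {a..t}. f s) * g t)"
      using integrable_mult_continuous[OF indefinite_integral_continuous_real[OF f] g] .
  qed
  finally show ?thesis .
qed

text \<open>Write f = f(0) + F and g = g(0) + G with primitives F, G vanishing at 0. For F G the
  product rule is \<open>product_of_integrals\<close>, and the cross terms with f(0) and g(0) are
  linear.\<close>

lemma weak_deriv_mult: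
  assumes f: "weak_deriv f f'" and g: "weak_deriv g g'"
  shows "weak_deriv (\<lambda>x. f x * g x) (\<lambda>x. f' x * g x + f x * g' x)"
  unfolding weak_deriv_def
proof (intro conjI ballI)
  note cf = weak_deriv_continuous[OF f] and cg = weak_deriv_continuous[OF g]
  have i: "integrable unit_leb f'" "integrable unit_leb g'"
    using f g unfolding weak_deriv_def by blast+
  show "integrable unit_leb (\<lambda>x. f' x * g x + f x * g' x)"
    using integrable_mult_continuous[OF cf i(2)] integrable_mult_continuous[OF cg i(1)]
    by (simp add: mult.commute)
  fix x :: real assume x: "x \<in> {0..1}"
  let ?M = "lebesgue_on {0..x}"
  have ix: "integrable ?M f'" "integrable ?M g'"
    using x by (auto intro!: integrable_subinterval[OF i(1)] integrable_subinterval[OF i(2)])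
  define F where "F = (\<lambda>t. LINT s|lebesgue_on {0..t}. f' s)"
  define G where "G = (\<lambda>t. LINT s|lebesgue_on {0..t}. g' s)"
  have fF: "f t = f 0 + F t" and gG: "g t = g 0 + G t" if "t \<in> {0..1}" for t
    using f g that unfolding weak_deriv_def F_def G_def by metis+
  have ii: "integrable ?M (\<lambda>t. f' t * G t)" "integrable ?M (\<lambda>t. F t * g' t)"
    using integrable_mult_continuous[OF indefinite_integral_continuous_real[OF ix(2)] ix(1)]
      integrable_mult_continuous[OF indefinite_integral_continuous_real[OF ix(1)] ix(2)]
    by (simp_all add: mult.commute F_def G_def)
  have "(LINT t|?M. f' t * g t + f t * g' t)
      = (LINT t|?M. (f' t * G t + F t * g' t) + (f' t * g 0 + f 0 * g' t))"
  proof (rule Bochner_Integration.integral_cong[OF refl])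
    fix t assume "t \<in> space ?M"
    then have "t \<in> {0..1}" using x by auto
    from fF[OF this] gG[OF this]
    show "f' t * g t + f t * g' t = (f' t * G t + F t * g' t) + (f' t * g 0 + f 0 * g' t)"
      by (simp only:) (simp add: algebra_simps)
  qed
  also have "\<dots> = (LINT t|?M. f' t * G t + F t * g' t) + (F x * g 0 + f 0 * G x)"
    using ii ix by (simp add: F_def G_def)
  also have "(LINT t|?M. f' t * G t + F t * g' t) = F x * G x"
    using product_of_integrals[OF ix] by (simp add: F_def G_def)
  finally have e: "(LINT t|?M. f' t * g t + f t * g' t) = F x * G x + (F x * g 0 + f 0 * G x)" .
  show "f x * g x = f 0 * g 0 + (LINT t|?M. f' t * g t + f t * g' t)"
  proof -
    have "f x * g x = (f 0 + F x) * (g 0 + G x)"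
      by (rule arg_cong2[where f = "(*)", OF fF[OF x] gG[OF x]])
    also have "\<dots> = f 0 * g 0 + (F x * G x + (F x * g 0 + f 0 * G x))"
      by (simp only: distrib_left distrib_right add_ac)
    finally show ?thesis unfolding e .
  qed
qed

lemma weak_deriv_exp: "weak_deriv (\<lambda>x. exp (k * x)) (\<lambda>x. k * exp (k * x))"
  unfolding weak_deriv_def
proof (intro conjI ballI)
  show "integrable unit_leb (\<lambda>x. k * exp (k * x))"
    by (rule continuous_imp_integrable_real) (intro continuous_intros)
  fix x :: real assume x: "x \<in> {0..1}"
  have "((\<lambda>s. k * exp (k * s)) has_integral (exp (k * x) - exp (k * 0))) {0..x}"
  proof (rule fundamental_theorem_of_calculus)
    show "((\<lambda>s. exp (k * s)) has_vector_derivative k * exp (k * s)) (at s within {0..x})" for s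
      unfolding has_real_derivative_iff_has_vector_derivative[symmetric]
      by (rule derivative_eq_intros refl)+ simp
  qed (use x in simp)
  note I = integral_unique[OF this]
  have "integrable (lebesgue_on {0..x}) (\<lambda>s. k * exp (k * s))"
    by (rule continuous_imp_integrable_real) (intro continuous_intros)
  then have "(LINT s|lebesgue_on {0..x}. k * exp (k * s)) = exp (k * x) - exp (k * 0)"
    unfolding I[symmetric] by (rule lebesgue_integral_eq_integral) simp
  then show "exp (k * x) = exp (k * 0) + (LINT s|lebesgue_on {0..x}. k * exp (k * s))"
    by (simp only:)
qed

text \<open>The product rule for e^(kx) times f squared, evaluated at x = 1. The derivative of the
  weight reproduces the weight times k, which is the origin of the decay rate.\<close>

lemma weighted_by_parts:
  assumes f: "weak_deriv f f'"
  shows "(LINT x|unit_leb. exp (k * x) * (2 * f x * f' x))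
    = exp k * (f 1)\<^sup>2 - (f 0)\<^sup>2 - k * (LINT x|unit_leb. exp (k * x) * (f x)\<^sup>2)"
proof -
  note cf = weak_deriv_continuous[OF f]
  have i: "integrable unit_leb f'" using f unfolding weak_deriv_def by blast
  have i1: "integrable unit_leb (\<lambda>x. exp (k * x) * (f x)\<^sup>2)"
    by (rule continuous_imp_integrable_real) (intro continuous_intros cf)
  have "integrable unit_leb (\<lambda>x. (exp (k * x) * (2 * f x)) * f' x)"
    by (rule integrable_mult_continuous[OF _ i]) (intro continuous_intros cf)
  then have i2: "integrable unit_leb (\<lambda>x. exp (k * x) * (2 * f x * f' x))"
    by (simp add: mult.assoc)
  have "weak_deriv (\<lambda>x. exp (k * x) * (f x * f x))
     (\<lambda>x. k * exp (k * x) * (f x * f x) + exp (k * x) * (f' x * f x + f x * f' x))"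
    by (intro weak_deriv_mult weak_deriv_exp f)
  then have "exp k * (f 1 * f 1) = f 0 * f 0
      + (LINT x|unit_leb. k * exp (k * x) * (f x * f x) + exp (k * x) * (f' x * f x + f x * f' x))"
    unfolding weak_deriv_def by (elim conjE) (drule bspec[of _ _ 1], simp_all)
  also have "(LINT x|unit_leb. k * exp (k * x) * (f x * f x) + exp (k * x) * (f' x * f x + f x * f' x))
      = (LINT x|unit_leb. k * (exp (k * x) * (f x)\<^sup>2) + exp (k * x) * (2 * f x * f' x))"
    by (intro Bochner_Integration.integral_cong) (auto simp: algebra_simps power2_eq_square)
  also have "\<dots> = k * (LINT x|unit_leb. exp (k * x) * (f x)\<^sup>2)
      + (LINT x|unit_leb. exp (k * x) * (2 * f x * f' x))"
    using i1 i2 by simp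
  finally have e: "exp k * (f 1 * f 1) = f 0 * f 0 + (k * (LINT x|unit_leb. exp (k * x) * (f x)\<^sup>2)
      + (LINT x|unit_leb. exp (k * x) * (2 * f x * f' x)))" .
  have "A = B + (C + I) \<Longrightarrow> I = A - B - C" for A B C I :: real by simp
  from this[OF e] show ?thesis unfolding power2_eq_square .
qed

lemma integral_triple:
  fixes f :: "real \<Rightarrow> real \<times> real \<times> real"
  assumes "integrable M f"
  shows "integral\<^sup>L M f = (LINT x|M. c1st (f x), LINT x|M. c2nd (f x), LINT x|M. c3rd (f x))"
  using integral_bounded_linear[OF bounded_linear_fst assms]
    integral_bounded_linear[OF bounded_linear_compose[OF bounded_linear_fst bounded_linear_snd] assms]
    integral_bounded_linear[OF bounded_linear_compose[OF bounded_linear_snd bounded_linear_snd] assms]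
  by (simp add: prod_eq_iff)

lemma L2_integrable:
  fixes f :: "real \<Rightarrow> 'a::euclidean_space"
  assumes "L2 f"
  shows "integrable unit_leb f"
proof (rule Bochner_Integration.integrable_bound)
  show "integrable unit_leb (\<lambda>x. 1 + (norm (f x))\<^sup>2)"
    using assms by (simp add: L2_def)
  show "AE x in unit_leb. norm (f x) \<le> norm (1 + (norm (f x))\<^sup>2)"
  proof (rule AE_I2)
    fix x
    have "2 * norm (f x) \<le> 1 + (norm (f x))\<^sup>2"
      using sum_squares_bound[of 1 "norm (f x)"] by simp
    then show "norm (f x) \<le> norm (1 + (norm (f x))\<^sup>2)"
      using norm_ge_zero[of "f x"] by (simp del: norm_ge_zero)
  qed
qed (use assms in \<open>simp add: L2_def\<close>)

lemma has_wderiv_weak_deriv: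
  assumes "has_wderiv y y'"
  shows "weak_deriv (\<lambda>x. c1st (y x)) (\<lambda>x. c1st (y' x))"
    and "weak_deriv (\<lambda>x. c2nd (y x)) (\<lambda>x. c2nd (y' x))"
    and "weak_deriv (\<lambda>x. c3rd (y x)) (\<lambda>x. c3rd (y' x))"
proof -
  have L: "L2 y'" using assms by (simp add: has_wderiv_def)
  have i: "integrable unit_leb (\<lambda>x. c1st (y' x))" "integrable unit_leb (\<lambda>x. c2nd (y' x))"
    "integrable unit_leb (\<lambda>x. c3rd (y' x))"
    using L2D[OF L] by (auto intro: sq_int_integrable)
  from integrable_subinterval[OF L2_integrable[OF L]]
  have "integrable (lebesgue_on {0..x}) y'" if "x \<in> {0..1}" for x
    using that by auto
  then have eq: "y x = y 0 + (LINT s|lebesgue_on {0..x}. c1st (y' s), LINT s|lebesgue_on {0..x}. c2nd (y' s),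
      LINT s|lebesgue_on {0..x}. c3rd (y' s))" if "x \<in> {0..1}" for x
    using assms that unfolding has_wderiv_def by (metis integral_triple)
  have *: "c1st (y x) = c1st (y 0) + (LINT s|lebesgue_on {0..x}. c1st (y' s))"
    "c2nd (y x) = c2nd (y 0) + (LINT s|lebesgue_on {0..x}. c2nd (y' s))"
    "c3rd (y x) = c3rd (y 0) + (LINT s|lebesgue_on {0..x}. c3rd (y' s))" if "x \<in> {0..1}" for x
    by (subst eq[OF that], simp)+
  show "weak_deriv (\<lambda>x. c1st (y x)) (\<lambda>x. c1st (y' x))"
    "weak_deriv (\<lambda>x. c2nd (y x)) (\<lambda>x. c2nd (y' x))"
    "weak_deriv (\<lambda>x. c3rd (y x)) (\<lambda>x. c3rd (y' x))"
    unfolding weak_deriv_def by (intro conjI ballI i *, assumption)+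
qed

lemma has_wderiv_L2:
  assumes "has_wderiv y y'"
  shows "L2 y"
  using has_wderiv_weak_deriv[OF assms]
  by (simp add: L2_iff_sq_int continuous_sq_int weak_deriv_continuous)

lemma has_wderiv_wderiv:
  assumes "target_domain d y"
  shows "has_wderiv y (wderiv y)"
  using assms unfolding target_domain_def wderiv_def by (metis someI_ex)

lemma target_domain_L2: "target_domain d y \<Longrightarrow> L2 y"
  using has_wderiv_L2 has_wderiv_wderiv by blast

lemma transport_L2:
  assumes "target_domain d y"
  shows "L2 (transport D d y)"
proof -
  have "L2 (wderiv y)" using has_wderiv_wderiv[OF assms] by (simp add: has_wderiv_def)
  note L = L2D[OF this]
  show ?thesis
    using sq_int_cmult[OF L(1), of "- lam d"] sq_int_cmult[OF L(2), of "mu d"]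
      sq_int_cmult[OF L(3), of "1 / D"]
    by (simp add: L2_iff_sq_int transport_def)
qed

subsection \<open>The Lyapunov functional\<close>

definition exp_inner :: "real \<Rightarrow> (real \<Rightarrow> real) \<Rightarrow> (real \<Rightarrow> real) \<Rightarrow> real" where
  "exp_inner k f g = (LINT x|unit_leb. exp (k * x) * (f x * g x))"

lemma integrable_exp_mult:
  assumes "integrable unit_leb f"
  shows "integrable unit_leb (\<lambda>x. exp (k * x) * f x)"
  by (rule integrable_mult_continuous[OF _ assms]) (intro continuous_intros)

lemma integrable_exp_inner: "sq_int f \<Longrightarrow> sq_int g \<Longrightarrow> integrable unit_leb (\<lambda>x. exp (k * x) * (f x * g x))"
  by (intro integrable_exp_mult sq_int_mult)

lemma exp_inner_add:
  assumes "sq_int f" "sq_int g" "sq_int h"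
  shows "exp_inner k f (\<lambda>x. g x + h x) = exp_inner k f g + exp_inner k f h"
  using integrable_exp_inner[OF assms(1,2), of k] integrable_exp_inner[OF assms(1,3), of k]
  unfolding exp_inner_def distrib_left by simp

lemma exp_inner_cmult: "exp_inner k f (\<lambda>x. c * g x) = c * exp_inner k f g"
  unfolding exp_inner_def by (simp add: mult.left_commute)

lemma exp_inner_commute: "exp_inner k f g = exp_inner k g f"
  unfolding exp_inner_def by (simp add: mult.commute)

lemma exp_inner_self_nonneg: "0 \<le> exp_inner k f f"
  unfolding exp_inner_def by (simp add: integral_nonneg_AE)

definition lyap_form :: "real \<Rightarrow> real \<Rightarrow> real \<Rightarrow> real \<Rightarrow> real \<Rightarrow> state \<Rightarrow> state \<Rightarrow> real" where
  "lyap_form D \<rho> \<rho>z a b y h =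
     exp_inner (- \<rho>) (\<lambda>x. c1st (y x)) (\<lambda>x. c1st (h x))
   + a * exp_inner \<rho> (\<lambda>x. c2nd (y x)) (\<lambda>x. c2nd (h x))
   + b * D * exp_inner (\<rho>z * D) (\<lambda>x. c3rd (y x)) (\<lambda>x. c3rd (h x))"

lemma lyap_eq_form: "lyap D \<rho> \<rho>z a b y = lyap_form D \<rho> \<rho>z a b y y"
  by (simp add: lyap_def lyap_form_def exp_inner_def power2_eq_square)

lemma lyap_form_add:
  assumes "L2 y" "L2 h" "L2 k"
  shows "lyap_form D \<rho> \<rho>z a b y (\<lambda>x. h x + k x) = lyap_form D \<rho> \<rho>z a b y h + lyap_form D \<rho> \<rho>z a b y k"
  using L2D[OF assms(1)] L2D[OF assms(2)] L2D[OF assms(3)]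
  by (simp add: lyap_form_def exp_inner_add algebra_simps)

lemma lyap_form_scaleR: "lyap_form D \<rho> \<rho>z a b y (\<lambda>x. c *\<^sub>R h x) = c * lyap_form D \<rho> \<rho>z a b y h"
  by (simp add: lyap_form_def exp_inner_cmult algebra_simps)

lemma lyap_form_commute: "lyap_form D \<rho> \<rho>z a b y h = lyap_form D \<rho> \<rho>z a b h y"
  unfolding lyap_form_def by (simp add: exp_inner_commute)

lemma lyap_nonneg:
  assumes "0 < D" "0 < a" "0 < b"
  shows "0 \<le> lyap D \<rho> \<rho>z a b y"
  using assms by (simp add: lyap_eq_form lyap_form_def exp_inner_self_nonneg)

lemma lyap_add:
  assumes "L2 y" "L2 h"
  shows "lyap D \<rho> \<rho>z a b (\<lambda>x. y x + h x)
    = lyap D \<rho> \<rho>z a b y + 2 * lyap_form D \<rho> \<rho>z a b y h + lyap D \<rho> \<rho>z a b h"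
proof -
  note s = L2_add[OF assms]
  have "lyap D \<rho> \<rho>z a b (\<lambda>x. y x + h x)
      = lyap_form D \<rho> \<rho>z a b (\<lambda>x. y x + h x) y + lyap_form D \<rho> \<rho>z a b (\<lambda>x. y x + h x) h"
    unfolding lyap_eq_form by (rule lyap_form_add[OF s assms])
  also have "\<dots> = lyap_form D \<rho> \<rho>z a b y (\<lambda>x. y x + h x) + lyap_form D \<rho> \<rho>z a b h (\<lambda>x. y x + h x)"
    by (simp only: lyap_form_commute[of D \<rho> \<rho>z a b "\<lambda>x. y x + h x"])
  finally show ?thesis
    using lyap_form_commute[of D \<rho> \<rho>z a b h y]
    by (simp only: lyap_form_add[OF assms(1) assms] lyap_form_add[OF assms(2) assms] lyap_eq_form)
qed

lemma lyap_scaleR: "lyap D \<rho> \<rho>z a b (\<lambda>x. c *\<^sub>R h x) = c\<^sup>2 * lyap D \<rho> \<rho>z a b h"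
  unfolding lyap_eq_form power2_eq_square
  by (simp only: lyap_form_scaleR lyap_form_commute[of D \<rho> \<rho>z a b "\<lambda>x. c *\<^sub>R h x"] mult.assoc)

text \<open>Before its first jump the switched state is tied to the solution almost everywhere only;
  this transfers the value of the functional.\<close>

lemma lyap_cong_AE:
  assumes "AE x in unit_leb. y x = z x"
  shows "lyap D \<rho> \<rho>z a b y = lyap D \<rho> \<rho>z a b z"
proof -
  have "(LINT x|unit_leb. exp (- \<rho> * x) * (c1st (y x))\<^sup>2) = (LINT x|unit_leb. exp (- \<rho> * x) * (c1st (z x))\<^sup>2)"
    "(LINT x|unit_leb. exp (\<rho> * x) * (c2nd (y x))\<^sup>2) = (LINT x|unit_leb. exp (\<rho> * x) * (c2nd (z x))\<^sup>2)"
    "(LINT x|unit_leb. exp (\<rho>z * D * x) * (c3rd (y x))\<^sup>2) = (LINT x|unit_leb. exp (\<rho>z * D * x) * (c3rd (z x))\<^sup>2)"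
    by (intro unit_leb.integral_cong_AE_complete, use assms in eventually_elim, simp)+
  then show ?thesis unfolding lyap_def by presburger
qed

lemma lyap_form_cong_AE:
  assumes "AE x in unit_leb. h x = k x"
  shows "lyap_form D \<rho> \<rho>z a b y h = lyap_form D \<rho> \<rho>z a b y k"
proof -
  have "exp_inner c f (\<lambda>x. c1st (h x)) = exp_inner c f (\<lambda>x. c1st (k x))"
    "exp_inner c f (\<lambda>x. c2nd (h x)) = exp_inner c f (\<lambda>x. c2nd (k x))"
    "exp_inner c f (\<lambda>x. c3rd (h x)) = exp_inner c f (\<lambda>x. c3rd (k x))" for c f
    unfolding exp_inner_def
    by (intro unit_leb.integral_cong_AE_complete, use assms in eventually_elim, simp)+
  then show ?thesis unfolding lyap_form_def by presburger
qed

text \<open>A quadratic in c without negative values has no positive discriminant. The degenerate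
  case of a vanishing leading coefficient is included, so the criterion applies to semidefinite
  forms such as those on functions that are not identified modulo null sets.\<close>

lemma discriminant_le:
  fixes A B C :: real
  assumes "\<And>c. 0 \<le> A + 2 * c * B + c\<^sup>2 * C" "0 \<le> C"
  shows "B\<^sup>2 \<le> A * C"
proof (cases "C = 0")
  case True
  have "B = 0"
  proof (rule ccontr)
    assume "B \<noteq> 0"
    \<comment> \<open>With this c the polynomial, which is linear here, takes the value -1.\<close>
    then have "2 * (- (A + 1) / (2 * B)) * B = - (A + 1)" by (simp add: field_simps)
    then show False using assms(1)[of "- (A + 1) / (2 * B)"] True by simp
  qed
  then show ?thesis using True by simp
next
  case False
  \<comment> \<open>The vertex of the parabola.\<close>
  then have "A + 2 * (- B / C) * B + (- B / C)\<^sup>2 * C = (A * C - B\<^sup>2) / C"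
    by (simp add: field_simps power2_eq_square)
  then show ?thesis using assms(1)[of "- B / C"] assms(2) False
    by (simp add: zero_le_divide_iff)
qed

text \<open>\<open>L2_frechet\<close> is chosen by \<open>SOME\<close>, so uniqueness is what gives
  access to its value. Two candidates differ by a homogeneous functional that is small compared with
  the norm near 0; shrinking a given direction h shows that they agree on h. Only square integrable
  directions are constrained by the definition.\<close>

lemma has_L2_frechet_unique:
  assumes L: "has_L2_frechet \<Phi> L y" and L': "has_L2_frechet \<Phi> L' y" and h: "L2 h"
  shows "L h = L' h"
proof (rule ccontr)
  assume "L h \<noteq> L' h"
  \<comment> \<open>The added 1 keeps \<open>N\<close> positive when h has norm zero.\<close>
  define N where "N = L2norm h + 1"
  have N: "0 < N" "L2norm h < N" using L2norm_nonneg[of h] by (auto simp: N_def)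
  \<comment> \<open>Then 2 e N is half of the supposed difference, which is the contradiction at the
    end.\<close>
  define e where "e = \<bar>L h - L' h\<bar> / (4 * N)"
  have e: "0 < e" using \<open>L h \<noteq> L' h\<close> N by (simp add: e_def)
  obtain \<epsilon>1 where e1: "0 < \<epsilon>1"
    "\<And>k. L2 k \<Longrightarrow> L2norm k < \<epsilon>1 \<Longrightarrow> \<bar>\<Phi> (\<lambda>x. y x + k x) - \<Phi> y - L k\<bar> \<le> e * L2norm k"
    using L e unfolding has_L2_frechet_def by meson
  obtain \<epsilon>2 where e2: "0 < \<epsilon>2"
    "\<And>k. L2 k \<Longrightarrow> L2norm k < \<epsilon>2 \<Longrightarrow> \<bar>\<Phi> (\<lambda>x. y x + k x) - \<Phi> y - L' k\<bar> \<le> e * L2norm k"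
    using L' e unfolding has_L2_frechet_def by meson
  \<comment> \<open>The scaling brings h below both radii.\<close>
  define c where "c = min \<epsilon>1 \<epsilon>2 / N"
  have c: "0 < c" using e1 e2 N by (simp add: c_def)
  let ?k = "\<lambda>x. c *\<^sub>R h x"
  have norm_k: "L2norm ?k = c * L2norm h"
    using c by (simp add: L2norm_def power_mult_distrib real_sqrt_mult)
  have "L2norm ?k < c * N" unfolding norm_k using c N by simp
  moreover have "c * N = min \<epsilon>1 \<epsilon>2" using N by (simp add: c_def)
  ultimately have "L2norm ?k < \<epsilon>1" "L2norm ?k < \<epsilon>2" by linarith+
  from e1(2)[OF L2_scaleR[OF h] this(1)] e2(2)[OF L2_scaleR[OF h] this(2)]
  have "\<bar>L ?k - L' ?k\<bar> \<le> 2 * (e * L2norm ?k)" by linarith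
  moreover have "L ?k = c * L h" "L' ?k = c * L' h"
    using L L' h unfolding has_L2_frechet_def by blast+
  moreover have "\<bar>c * L h - c * L' h\<bar> = c * \<bar>L h - L' h\<bar>"
    using c by (simp only: right_diff_distrib[symmetric] abs_mult)
  ultimately have "c * \<bar>L h - L' h\<bar> \<le> c * (2 * (e * L2norm h))"
    unfolding norm_k by (simp only: mult.left_commute[of _ c])
  then have "\<bar>L h - L' h\<bar> \<le> 2 * (e * L2norm h)" using c by (simp only: mult_le_cancel_left_pos)
  also have "\<dots> \<le> 2 * (e * N)" using e N by simp
  also have "\<dots> = \<bar>L h - L' h\<bar> / 2" using N by (simp add: e_def)
  finally show False using \<open>L h \<noteq> L' h\<close> by simp
qed

section \<open>Differentiability of the quadratic functional in L2\<close>

locale lyapunov =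
  fixes D \<rho> \<rho>z a b C :: real
  assumes D_pos: "0 < D" and a_pos: "0 < a" and b_pos: "0 < b"
    and lyap_le: "\<And>h. L2 h \<Longrightarrow> lyap D \<rho> \<rho>z a b h \<le> C * (L2norm h)\<^sup>2"
begin

abbreviation V where "V \<equiv> lyap D \<rho> \<rho>z a b"
abbreviation B where "B \<equiv> lyap_form D \<rho> \<rho>z a b"

lemma V_nonneg: "0 \<le> V y"
  using lyap_nonneg[OF D_pos a_pos b_pos] .

text \<open>The functional is nonnegative on all combinations y + c h; expanding it gives a
  quadratic in c to which \<open>discriminant_le\<close> applies.\<close>

lemma form_Cauchy_Schwarz:
  assumes "L2 y" "L2 h"
  shows "\<bar>B y h\<bar> \<le> sqrt (V y) * sqrt (V h)"
proof -
  have "0 \<le> V y + 2 * c * B y h + c\<^sup>2 * V h" for c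
    using V_nonneg[of "\<lambda>x. y x + c *\<^sub>R h x"] lyap_add[OF assms(1) L2_scaleR[OF assms(2)], of D \<rho> \<rho>z a b c]
    by (simp add: lyap_form_scaleR lyap_scaleR mult.assoc)
  then have "(B y h)\<^sup>2 \<le> V y * V h"
    using V_nonneg by (rule discriminant_le)
  then have "sqrt ((B y h)\<^sup>2) \<le> sqrt (V y * V h)" by (rule real_sqrt_le_mono)
  then show ?thesis by (simp add: real_sqrt_mult)
qed

text \<open>The constant of the upper bound carries no sign condition in this locale, hence the
  absolute value under the root.\<close>

lemma sqrt_V_le:
  assumes "L2 h"
  shows "sqrt (V h) \<le> sqrt \<bar>C\<bar> * L2norm h"
proof -
  have "V h \<le> \<bar>C\<bar> * (L2norm h)\<^sup>2"
    using lyap_le[OF assms] mult_right_mono[OF abs_ge_self[of C], of "(L2norm h)\<^sup>2"] by simp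
  then have "sqrt (V h) \<le> sqrt (\<bar>C\<bar> * (L2norm h)\<^sup>2)" by (rule real_sqrt_le_mono)
  then show ?thesis using L2norm_nonneg[of h] by (simp add: real_sqrt_mult)
qed

lemma form_bound:
  assumes "L2 y" "L2 h"
  shows "\<bar>B y h\<bar> \<le> sqrt (V y) * sqrt \<bar>C\<bar> * L2norm h"
proof -
  have "sqrt (V y) * sqrt (V h) \<le> sqrt (V y) * (sqrt \<bar>C\<bar> * L2norm h)"
    using sqrt_V_le[OF assms(2)] V_nonneg by (intro mult_left_mono) auto
  then show ?thesis using form_Cauchy_Schwarz[OF assms] by (simp add: mult.assoc)
qed

lemma V_perturb:
  assumes "L2 y" "L2 h"
  shows "\<bar>V (\<lambda>x. y x + h x) - V y\<bar> \<le> 2 * (sqrt (V y) * sqrt \<bar>C\<bar>) * L2norm h + C * (L2norm h)\<^sup>2"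
  using form_bound[OF assms] lyap_le[OF assms(2)] V_nonneg[of h]
  unfolding lyap_add[OF assms] by (simp add: abs_le_iff)

text \<open>Nonnegativity of the functional at y - h bounds twice the cross term by
  \<open>V y + V h\<close>.\<close>

lemma V_add_le:
  assumes "L2 y" "L2 h"
  shows "V (\<lambda>x. y x + h x) \<le> 2 * V y + 2 * V h"
proof -
  have "0 \<le> V y - 2 * B y h + V h"
    using V_nonneg[of "\<lambda>x. y x + (-1) *\<^sub>R h x"] lyap_add[OF assms(1) L2_scaleR[OF assms(2)], of D \<rho> \<rho>z a b "-1"]
    unfolding lyap_form_scaleR lyap_scaleR by simp
  then show ?thesis unfolding lyap_add[OF assms] by simp
qed

text \<open>For a quadratic functional the remainder of the linear approximation is exactly
  \<open>V h\<close>, which is of second order in the norm of h.\<close>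

lemma has_L2_frechet_form:
  assumes y: "L2 y"
  shows "has_L2_frechet V (\<lambda>h. 2 * B y h) y"
  unfolding has_L2_frechet_def
proof (intro conjI allI impI)
  fix h k :: state assume "L2 h" "L2 k"
  then show "2 * B y (\<lambda>x. h x + k x) = 2 * B y h + 2 * B y k"
    using y by (simp add: lyap_form_add)
next
  show "2 * B y (\<lambda>x. c *\<^sub>R h x) = c * (2 * B y h)" for c h
    by (simp add: lyap_form_scaleR)
next
  show "\<exists>K. \<forall>h. L2 h \<longrightarrow> \<bar>2 * B y h\<bar> \<le> K * L2norm h"
    using form_bound[OF y]
    by (intro exI[of _ "2 * (sqrt (V y) * sqrt \<bar>C\<bar>)"]) (simp add: abs_mult mult.assoc)
next
  fix e :: real assume e: "0 < e"
  show "\<exists>\<epsilon>>0. \<forall>h. L2 h \<longrightarrow> L2norm h < \<epsilon> \<longrightarrow> \<bar>V (\<lambda>x. y x + h x) - V y - 2 * B y h\<bar> \<le> e * L2norm h"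
  proof (intro exI[of _ "e / (\<bar>C\<bar> + 1)"] conjI allI impI)
    \<comment> \<open>Adding 1 to the constant allows the division even if the constant is
      0.\<close>
    show "0 < e / (\<bar>C\<bar> + 1)" using e by (simp add: add_pos_pos add_nonneg_pos)
    fix h :: state assume h: "L2 h" "L2norm h < e / (\<bar>C\<bar> + 1)"
    have "\<bar>V (\<lambda>x. y x + h x) - V y - 2 * B y h\<bar> = V h"
      using V_nonneg[of h] by (simp add: lyap_add[OF y h(1)])
    also have "\<dots> \<le> C * (L2norm h)\<^sup>2" by (rule lyap_le[OF h(1)])
    also have "\<dots> \<le> (\<bar>C\<bar> + 1) * (L2norm h)\<^sup>2" by (intro mult_right_mono) auto
    also have "\<dots> = ((\<bar>C\<bar> + 1) * L2norm h) * L2norm h" by (simp add: power2_eq_square)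
    also have "\<dots> \<le> e * L2norm h"
    proof (intro mult_right_mono L2norm_nonneg)
      show "(\<bar>C\<bar> + 1) * L2norm h \<le> e"
        using h(2) by (simp add: field_simps add_nonneg_pos)
    qed
    finally show "\<bar>V (\<lambda>x. y x + h x) - V y - 2 * B y h\<bar> \<le> e * L2norm h" .
  qed
qed

lemma L2_frechet_V:
  assumes "L2 y" "L2 h"
  shows "L2_frechet V y h = 2 * B y h"
proof -
  have "has_L2_frechet V (L2_frechet V y) y"
    unfolding L2_frechet_def using has_L2_frechet_form[OF assms(1)]
    by (rule someI[of "\<lambda>L. has_L2_frechet V L y"])
  then show ?thesis using has_L2_frechet_unique has_L2_frechet_form assms by blast
qed

text \<open>A chain rule done by hand: with E the error of the difference quotient, Y(s) = Y(t) + (s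
  - t)(Y' + E(s)). Expanding the quadratic functional leaves a term linear in E(s) and a term with
  factor s - t, both tending to 0. The derivative is relative to S, so endpoints of a time interval
  are covered.\<close>

lemma V_has_derivative:
  assumes Y: "\<And>s. s \<in> S \<Longrightarrow> L2 (Y s)" and t: "t \<in> S" and Y': "L2 Y'"
    and lim: "((\<lambda>s. L2norm (\<lambda>x. (Y s x - Y t x) /\<^sub>R (s - t) - Y' x)) \<longlongrightarrow> 0) (at t within S)"
  shows "((\<lambda>s. V (Y s)) has_real_derivative 2 * B (Y t) Y') (at t within S)"
  unfolding has_field_derivative_iff
proof -
  \<comment> \<open>The error of the difference quotient, whose norm tends to 0 by
    hypothesis.\<close>
  define E where "E = (\<lambda>s x. (Y s x - Y t x) /\<^sub>R (s - t) - Y' x)"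
  define K where "K = 2 * (sqrt (V (Y t)) * sqrt \<bar>C\<bar>)"
  define bnd where "bnd = (\<lambda>s. K * L2norm (E s) + \<bar>s - t\<bar> * (2 * V Y' + 2 * (C * (L2norm (E s))\<^sup>2)))"
  have lim': "((\<lambda>s. L2norm (E s)) \<longlongrightarrow> 0) (at t within S)" using lim by (simp add: E_def)
  have "(bnd \<longlongrightarrow> K * 0 + \<bar>t - t\<bar> * (2 * V Y' + 2 * (C * 0\<^sup>2))) (at t within S)"
    unfolding bnd_def by (intro tendsto_intros lim')
  then have bnd0: "(bnd \<longlongrightarrow> 0) (at t within S)" by simp
  have le: "norm ((V (Y s) - V (Y t)) / (s - t) - 2 * B (Y t) Y') \<le> bnd s" if s: "s \<in> S" "s \<noteq> t" for s
  proof -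
    have E: "L2 (E s)"
      unfolding E_def by (intro L2_diff L2_scaleR Y s t Y')
    let ?W = "\<lambda>x. Y' x + E s x"
    have W: "L2 ?W" by (intro L2_add Y' E)
    have "Y s = (\<lambda>x. Y t x + (s - t) *\<^sub>R ?W x)"
      using s by (auto simp: E_def)
    then have "V (Y s) = V (Y t) + 2 * ((s - t) * B (Y t) ?W) + (s - t)\<^sup>2 * V ?W"
      by (simp only: lyap_add[OF Y[OF t] L2_scaleR[OF W]] lyap_form_scaleR lyap_scaleR)
    then have "V (Y s) - V (Y t) = (s - t) * (2 * B (Y t) ?W + (s - t) * V ?W)"
      by (simp add: algebra_simps power2_eq_square)
    then have "(V (Y s) - V (Y t)) / (s - t) - 2 * B (Y t) Y' = 2 * B (Y t) (E s) + (s - t) * V ?W"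
      using s by (simp add: lyap_form_add[OF Y[OF t] Y' E])
    moreover have "\<bar>2 * B (Y t) (E s)\<bar> \<le> K * L2norm (E s)"
      using form_bound[OF Y[OF t] E] by (simp add: K_def abs_mult)
    moreover have "\<bar>(s - t) * V ?W\<bar> \<le> \<bar>s - t\<bar> * (2 * V Y' + 2 * (C * (L2norm (E s))\<^sup>2))"
      unfolding abs_mult
      using V_nonneg[of ?W] V_add_le[OF Y' E] lyap_le[OF E] by (intro mult_left_mono) auto
    ultimately show ?thesis unfolding bnd_def real_norm_def by linarith
  qed
  have "((\<lambda>s. (V (Y s) - V (Y t)) / (s - t) - 2 * B (Y t) Y') \<longlongrightarrow> 0) (at t within S)"
    using bnd0 by (rule Lim_null_comparison[rotated]) (use le in \<open>auto simp: eventually_at_filter\<close>)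
  then show "((\<lambda>s. (V (Y s) - V (Y t)) / (s - t)) \<longlongrightarrow> 2 * B (Y t) Y') (at t within S)"
    by (rule LIM_zero_cancel)
qed

end

subsection \<open>Perturbation terms\<close>

lemma sq_int_Cauchy_Schwarz:
  assumes "sq_int f" "sq_int g"
  shows "(LINT x|unit_leb. f x * g x)\<^sup>2 \<le> (LINT x|unit_leb. (f x)\<^sup>2) * (LINT x|unit_leb. (g x)\<^sup>2)"
proof (rule discriminant_le)
  fix c :: real
  have "0 \<le> (LINT x|unit_leb. (f x + c * g x)\<^sup>2)" by (simp add: integral_nonneg_AE)
  also have "\<dots> = (LINT x|unit_leb. (f x)\<^sup>2 + 2 * c * (f x * g x) + c\<^sup>2 * (g x)\<^sup>2)"
    by (intro Bochner_Integration.integral_cong) (auto simp: power2_eq_square algebra_simps)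
  also have "\<dots> = (LINT x|unit_leb. (f x)\<^sup>2) + 2 * c * (LINT x|unit_leb. f x * g x)
      + c\<^sup>2 * (LINT x|unit_leb. (g x)\<^sup>2)"
    using sq_int_mult[OF assms] assms[THEN sq_int_square] by simp
  finally show "0 \<le> (LINT x|unit_leb. (f x)\<^sup>2) + 2 * c * (LINT x|unit_leb. f x * g x)
      + c\<^sup>2 * (LINT x|unit_leb. (g x)\<^sup>2)" .
qed (simp add: integral_nonneg_AE)

text \<open>The difference between the transformed state and the state consists of integrals of the
  state. It therefore depends only on the class of the state, and this at every point x.\<close>

lemma transf_diff_cong_AE:
  assumes w: "AE x in unit_leb. w x = w' x" and x: "x \<in> {0..1}"
  shows "transf D d0 K w x - w x = transf D d0 K w' x - w' x"
proof -
  have sub: "AE \<xi> in lebesgue_on {0..x}. w \<xi> = w' \<xi>"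
    by (rule AE_lebesgue_on_subset[OF w]) (use x in auto)
  have I: "(LINT \<xi>|lebesgue_on {0..x}. k1 \<xi> * c1st (w \<xi>) + k2 \<xi> * c2nd (w \<xi>))
      = (LINT \<xi>|lebesgue_on {0..x}. k1 \<xi> * c1st (w' \<xi>) + k2 \<xi> * c2nd (w' \<xi>))"
    "(LINT \<xi>|lebesgue_on {0..x}. k1 \<xi> * c3rd (w \<xi>)) = (LINT \<xi>|lebesgue_on {0..x}. k1 \<xi> * c3rd (w' \<xi>))"
    for k1 k2 :: "real \<Rightarrow> real"
    by (intro complete_measure.integral_cong_AE_complete complete_lebesgue_on, simp,
        use sub in eventually_elim, simp)+
  have J: "(LINT \<xi>|unit_leb. k1 \<xi> * c1st (w \<xi>)) = (LINT \<xi>|unit_leb. k1 \<xi> * c1st (w' \<xi>))"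
    "(LINT \<xi>|unit_leb. k1 \<xi> * c2nd (w \<xi>)) = (LINT \<xi>|unit_leb. k1 \<xi> * c2nd (w' \<xi>))"
    for k1 :: "real \<Rightarrow> real"
    by (intro unit_leb.integral_cong_AE_complete, use w in eventually_elim, simp)+
  show ?thesis
    unfolding transf_def I J by (simp add: prod_eq_iff)
qed

lemma preimg:
  assumes bij: "L2_bijective (transf D d0 K)" and y: "L2 y"
  shows "L2 (preimg D d0 K y)" "\<And>x. x \<in> {0..1} \<Longrightarrow> transf D d0 K (preimg D d0 K y) x = y x"
proof -
  obtain w where w: "L2 w" "AE x in unit_leb. transf D d0 K w x = y x"
    using bij y unfolding L2_bijective_def by blast
  \<comment> \<open>Solve the transformation equation for its leading term. As \<open>w'\<close> and
    \<open>w\<close> agree almost everywhere, their integral parts coincide, and the equation for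
    \<open>w'\<close> holds at every point.\<close>
  define w' where "w' = (\<lambda>x. y x - (transf D d0 K w x - w x))"
  have ae: "AE x in unit_leb. w x = w' x"
    using w(2) by eventually_elim (simp add: w'_def)
  have "L2 w'" by (rule L2_cong_AE[OF ae w(1)])
  moreover have "transf D d0 K w' x = y x" if "x \<in> {0..1}" for x
  proof -
    have "transf D d0 K w' x = w' x + (transf D d0 K w x - w x)"
      using transf_diff_cong_AE[OF ae that, of D d0 K] by (metis add.commute diff_add_cancel)
    then show ?thesis by (simp add: w'_def)
  qed
  ultimately have "\<exists>w. L2 w \<and> (\<forall>x \<in> {0..1}. transf D d0 K w x = y x)" by blast
  then have "L2 (preimg D d0 K y) \<and> (\<forall>x \<in> {0..1}. transf D d0 K (preimg D d0 K y) x = y x)"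
    unfolding preimg_def by (rule someI_ex)
  then show "L2 (preimg D d0 K y)" "\<And>x. x \<in> {0..1} \<Longrightarrow> transf D d0 K (preimg D d0 K y) x = y x"
    by blast+
qed

lemma preimg_norm:
  assumes bij: "L2_bijective (transf D d0 K)" and y: "L2 y" and cT: "0 < cT"
    and lower: "\<And>w. L2 w \<Longrightarrow> cT * (L2norm w)\<^sup>2 \<le> (L2norm (transf D d0 K w))\<^sup>2"
  shows "(L2norm (preimg D d0 K y))\<^sup>2 \<le> (L2norm y)\<^sup>2 / cT"
proof -
  have "L2norm (transf D d0 K (preimg D d0 K y)) = L2norm y"
    by (rule L2norm_cong_AE, rule AE_I2) (simp add: preimg(2)[OF bij y])
  then have "cT * (L2norm (preimg D d0 K y))\<^sup>2 \<le> (L2norm y)\<^sup>2"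
    using lower[OF preimg(1)[OF bij y]] by simp
  then show ?thesis using cT by (simp add: field_simps)
qed

text \<open>At x = 0 the Volterra integral runs over a single point and vanishes; eta(0) then
  differs from z(0) only by two pairings with the traces of \<open>q1\<close> and
  \<open>q2\<close>.\<close>

lemma transf_third_at_0:
  "c3rd (transf D d0 K w 0) = c3rd (w 0) - (LINT \<xi>|unit_leb. q1 K 0 \<xi> * c1st (w \<xi>))
     - (LINT \<xi>|unit_leb. q2 K 0 \<xi> * c2nd (w \<xi>))"
  by (simp add: transf_def integral_eq_zero_null_sets)

text \<open>Although \<open>q1\<close> and \<open>q2\<close> may jump inside the square, their
  traces at x = 0 are those of \<open>Kvu\<close> and \<open>Kvv\<close> at x = 1, which are
  continuous on the triangle.\<close>

lemma sq_int_q_at_0: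
  assumes "K_kernel_eqs d0 K" "q_kernel_eqs D d0 K"
  shows "sq_int (q1 K 0)" "sq_int (q2 K 0)"
proof -
  have cont: "continuous_on {0..1} (\<lambda>\<xi>. k 1 \<xi>)" if "C1_on tri_dom k" for k :: "real \<Rightarrow> real \<Rightarrow> real"
  proof -
    have "continuous_on tri_dom (\<lambda>(x, \<xi>). k x \<xi>)"
      using that by (auto simp: C1_on_def intro: differentiable_imp_continuous_on)
    then have "continuous_on {0..1} (\<lambda>\<xi>. (\<lambda>(x, \<xi>). k x \<xi>) (1, \<xi>))"
      by (rule continuous_on_compose2) (auto simp: tri_dom_def intro!: continuous_intros)
    then show ?thesis by simp
  qed
  have C1: "C1_on tri_dom (Kvu K)" "C1_on tri_dom (Kvv K)"
    using assms(1) unfolding K_kernel_eqs_def by blast+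
  have q: "\<forall>\<xi>\<in>{0..1}. q1 K 0 \<xi> = Kvu K 1 \<xi> \<and> q2 K 0 \<xi> = Kvv K 1 \<xi>"
    using assms(2) unfolding q_kernel_eqs_def by blast
  have "continuous_on {0..1} (q1 K 0)" "continuous_on {0..1} (q2 K 0)"
    using q by (auto intro: continuous_on_eq[OF cont[OF C1(1)]] continuous_on_eq[OF cont[OF C1(2)]])
  then show "sq_int (q1 K 0)" "sq_int (q2 K 0)" by (auto intro: continuous_sq_int)
qed

text \<open>eta(0) is z(0) plus two integrals, and Cauchy-Schwarz bounds each integral by the norm
  of a kernel trace times the norm of the preimage. This is where \<open>Q0\<close> comes
  from.\<close>

lemma preimg_third_at_0:
  assumes bij: "L2_bijective (transf D d0 K)" and y: "L2 y"
    and ker: "K_kernel_eqs d0 K" "q_kernel_eqs D d0 K"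
  shows "(c3rd (preimg D d0 K y 0))\<^sup>2 \<le> 3 * (c3rd (y 0))\<^sup>2
    + 3 * ((L2norm (q1 K 0))\<^sup>2 + (L2norm (q2 K 0))\<^sup>2) * (L2norm (preimg D d0 K y))\<^sup>2"
proof -
  let ?w = "preimg D d0 K y"
  note w = preimg(1)[OF bij y]
  define I where "I = (LINT \<xi>|unit_leb. q1 K 0 \<xi> * c1st (?w \<xi>))"
  define J where "J = (LINT \<xi>|unit_leb. q2 K 0 \<xi> * c2nd (?w \<xi>))"
  have eta: "c3rd (?w 0) = c3rd (y 0) + I + J"
    using transf_third_at_0[of D d0 K ?w] preimg(2)[OF bij y, of 0] by (simp add: I_def J_def)
  define N where "N = (L2norm ?w)\<^sup>2"
  have N: "(LINT x|unit_leb. (c1st (?w x))\<^sup>2) \<le> N" "(LINT x|unit_leb. (c2nd (?w x))\<^sup>2) \<le> N"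
    by (simp_all add: N_def L2norm_square_components[OF w] integral_nonneg_AE add_nonneg_nonneg)
  have q: "(L2norm (q1 K 0))\<^sup>2 = (LINT x|unit_leb. (q1 K 0 x)\<^sup>2)"
    "(L2norm (q2 K 0))\<^sup>2 = (LINT x|unit_leb. (q2 K 0 x)\<^sup>2)"
    by (simp_all add: L2norm_square)
  have "I\<^sup>2 \<le> (LINT x|unit_leb. (q1 K 0 x)\<^sup>2) * (LINT x|unit_leb. (c1st (?w x))\<^sup>2)"
    unfolding I_def by (intro sq_int_Cauchy_Schwarz sq_int_q_at_0[OF ker] L2D[OF w])
  also have "\<dots> \<le> (LINT x|unit_leb. (q1 K 0 x)\<^sup>2) * N"
    using N by (intro mult_left_mono) (simp_all add: integral_nonneg_AE)
  finally have I: "I\<^sup>2 \<le> (L2norm (q1 K 0))\<^sup>2 * N" by (simp only: q)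
  have "J\<^sup>2 \<le> (LINT x|unit_leb. (q2 K 0 x)\<^sup>2) * (LINT x|unit_leb. (c2nd (?w x))\<^sup>2)"
    unfolding J_def by (intro sq_int_Cauchy_Schwarz sq_int_q_at_0[OF ker] L2D[OF w])
  also have "\<dots> \<le> (LINT x|unit_leb. (q2 K 0 x)\<^sup>2) * N"
    using N by (intro mult_left_mono) (simp_all add: integral_nonneg_AE)
  finally have J: "J\<^sup>2 \<le> (L2norm (q2 K 0))\<^sup>2 * N" by (simp only: q)
  \<comment> \<open>The square of a sum of three terms: the origin of the factor 3 in
    \<open>Mz\<close> and in the \<open>Q0\<close> term of \<open>MV\<close>.\<close>
  have three: "(p + r + s)\<^sup>2 \<le> 3 * p\<^sup>2 + 3 * (r\<^sup>2 + s\<^sup>2)" for p r s :: real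
    using zero_le_power2[of "p - r"] zero_le_power2[of "p - s"] zero_le_power2[of "r - s"]
    by (simp add: power2_eq_square algebra_simps)
  show ?thesis
    unfolding eta N_def[symmetric] using three[of "c3rd (y 0)" I J] I J
    by (simp add: algebra_simps)
qed

text \<open>Both squares (p / sqrt c - sqrt c s) and (p / sqrt c + sqrt c s) are used, since the
  coefficient k may have either sign.\<close>

lemma young_le:
  fixes p s k m c :: real
  assumes "\<bar>k\<bar> \<le> m" "0 < c"
  shows "2 * p * (k * s) \<le> m * (p\<^sup>2 / c + c * s\<^sup>2)"
proof -
  have "0 \<le> (p / sqrt c - sqrt c * s)\<^sup>2" "0 \<le> (p / sqrt c + sqrt c * s)\<^sup>2" by simp_all
  then have "2 * (p * s) \<le> p\<^sup>2 / c + c * s\<^sup>2" "- (2 * (p * s)) \<le> p\<^sup>2 / c + c * s\<^sup>2"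
    using assms(2) by (simp_all add: power2_diff power2_sum power_divide power_mult_distrib)
  then have b: "\<bar>2 * (p * s)\<bar> \<le> p\<^sup>2 / c + c * s\<^sup>2" by linarith
  have "2 * p * (k * s) \<le> \<bar>k\<bar> * \<bar>2 * (p * s)\<bar>"
    by (simp only: abs_mult[symmetric]) (simp add: mult_ac)
  also have "\<dots> \<le> m * (p\<^sup>2 / c + c * s\<^sup>2)"
    using assms(1) b by (intro mult_mono) auto
  finally show ?thesis .
qed

text \<open>Young's inequality with weight 1 under the integral, followed by enlarging S to the unit
  interval, on which the constant p squared integrates to itself. The majorant does not contain the
  kernels, so they need to be bounded only almost everywhere on S.\<close>

lemma kernel_term_le:
  fixes k3 k4 u v :: "real \<Rightarrow> real" and p m :: real
  assumes S: "S \<subseteq> {0..1}" "S \<in> sets lebesgue"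
    and k: "AE \<xi> in lebesgue_on S. \<bar>k3 \<xi>\<bar> + \<bar>k4 \<xi>\<bar> \<le> m" and m: "0 \<le> m"
    and u: "sq_int u" and v: "sq_int v"
  shows "2 * p * (LINT \<xi>|lebesgue_on S. k3 \<xi> * u \<xi> + k4 \<xi> * v \<xi>)
    \<le> m * (p\<^sup>2 + (LINT \<xi>|unit_leb. (u \<xi>)\<^sup>2) + (LINT \<xi>|unit_leb. (v \<xi>)\<^sup>2))"
proof -
  let ?b = "\<lambda>\<xi>. m * (p\<^sup>2 + (u \<xi>)\<^sup>2 + (v \<xi>)\<^sup>2)"
  have "2 * p * (LINT \<xi>|lebesgue_on S. k3 \<xi> * u \<xi> + k4 \<xi> * v \<xi>)
      = (LINT \<xi>|lebesgue_on S. 2 * p * (k3 \<xi> * u \<xi> + k4 \<xi> * v \<xi>))" by simp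
  also have "\<dots> \<le> (LINT \<xi>|unit_leb. ?b \<xi>)"
  proof (rule integral_mono_lebesgue_on_AE)
    show "integrable unit_leb ?b" using u v by (simp add: sq_int_square)
    show "AE \<xi> in lebesgue_on S. 2 * p * (k3 \<xi> * u \<xi> + k4 \<xi> * v \<xi>) \<le> ?b \<xi>"
      using k
    proof eventually_elim
      fix \<xi> assume le: "\<bar>k3 \<xi>\<bar> + \<bar>k4 \<xi>\<bar> \<le> m"
      have t: "2 * p * (k * r) \<le> \<bar>k\<bar> * (p\<^sup>2 + r\<^sup>2)" for k r :: real
        using young_le[of k "\<bar>k\<bar>" 1 p r] by simp
      have "2 * p * (k3 \<xi> * u \<xi> + k4 \<xi> * v \<xi>) \<le> \<bar>k3 \<xi>\<bar> * (p\<^sup>2 + (u \<xi>)\<^sup>2) + \<bar>k4 \<xi>\<bar> * (p\<^sup>2 + (v \<xi>)\<^sup>2)"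
        using t[of "k3 \<xi>" "u \<xi>"] t[of "k4 \<xi>" "v \<xi>"] by (simp add: distrib_left)
      also have "\<dots> \<le> \<bar>k3 \<xi>\<bar> * (p\<^sup>2 + (u \<xi>)\<^sup>2 + (v \<xi>)\<^sup>2) + \<bar>k4 \<xi>\<bar> * (p\<^sup>2 + (u \<xi>)\<^sup>2 + (v \<xi>)\<^sup>2)"
        by (rule add_mono; rule mult_left_mono) auto
      also have "\<dots> = (\<bar>k3 \<xi>\<bar> + \<bar>k4 \<xi>\<bar>) * (p\<^sup>2 + (u \<xi>)\<^sup>2 + (v \<xi>)\<^sup>2)"
        by (simp only: distrib_right)
      also have "\<dots> \<le> ?b \<xi>" using le by (intro mult_right_mono) auto
      finally show "2 * p * (k3 \<xi> * u \<xi> + k4 \<xi> * v \<xi>) \<le> ?b \<xi>" .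
    qed
    show "AE \<xi> in unit_leb. 0 \<le> ?b \<xi>" using m by simp
  qed (use S in auto)
  also have "\<dots> = m * (p\<^sup>2 + (LINT \<xi>|unit_leb. (u \<xi>)\<^sup>2) + (LINT \<xi>|unit_leb. (v \<xi>)\<^sup>2))"
    using u v by (simp add: sq_int_square)
  finally show ?thesis .
qed

text \<open>The common shape of the three perturbation terms: a local term in s, a boundary term in
  \<open>\<beta>0\<close> and a kernel term. The Young weight c' belongs to the local term and c to
  the boundary term; W bounds the exponential weight. The set S x is [0, x] for the first two
  components and [0, 1] for the third, whose coefficient bounds hold for almost every x
  only.\<close>

lemma weighted_cross_le:
  fixes p s F k1 k2 :: "real \<Rightarrow> real" and k3 k4 :: "real \<Rightarrow> real \<Rightarrow> real"
  assumes p: "sq_int p" and s: "sq_int s" and u: "sq_int u" and v: "sq_int v" and m: "0 \<le> m"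
    and c: "0 < c'" "0 < c" and W: "\<And>x. x \<in> {0..1} \<Longrightarrow> exp (k * x) \<le> W"
    and S: "\<And>x. x \<in> {0..1} \<Longrightarrow> S x \<subseteq> {0..1} \<and> S x \<in> sets lebesgue"
    and coeff: "AE x in unit_leb. \<bar>k1 x\<bar> \<le> m \<and> \<bar>k2 x\<bar> \<le> m
      \<and> (AE \<xi> in lebesgue_on (S x). \<bar>k3 x \<xi>\<bar> + \<bar>k4 x \<xi>\<bar> \<le> m)"
    and F: "\<And>x. x \<in> {0..1} \<Longrightarrow> F x = k1 x * s x + k2 x * \<beta>0
      + (LINT \<xi>|lebesgue_on (S x). k3 x \<xi> * u \<xi> + k4 x \<xi> * v \<xi>)"
  shows "2 * exp_inner k p F \<le> W * (m * ((LINT x|unit_leb. (p x)\<^sup>2) / c' + c' * (LINT x|unit_leb. (s x)\<^sup>2)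
    + (LINT x|unit_leb. (p x)\<^sup>2) / c + c * \<beta>0\<^sup>2
    + (LINT x|unit_leb. (p x)\<^sup>2) + (LINT x|unit_leb. (u x)\<^sup>2) + (LINT x|unit_leb. (v x)\<^sup>2)))"
proof -
  let ?U = "LINT x|unit_leb. (u x)\<^sup>2" and ?V = "LINT x|unit_leb. (v x)\<^sup>2"
  define b where "b = (\<lambda>x. m * ((p x)\<^sup>2 / c' + c' * (s x)\<^sup>2 + (p x)\<^sup>2 / c + c * \<beta>0\<^sup>2 + (p x)\<^sup>2 + ?U + ?V))"
  have UV: "0 \<le> ?U" "0 \<le> ?V" by (simp_all add: integral_nonneg_AE)
  have b0: "0 \<le> b x" for x
    unfolding b_def using m c UV by (intro mult_nonneg_nonneg add_nonneg_nonneg divide_nonneg_pos) auto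
  have W0: "0 \<le> W" using W[of 0] by simp
  have "2 * exp_inner k p F = (LINT x|unit_leb. exp (k * x) * (2 * p x * F x))"
    unfolding exp_inner_def by (subst integral_mult_right_zero[symmetric]) (simp add: mult_ac)
  also have "\<dots> \<le> (LINT x|unit_leb. W * b x)"
  proof (rule integral_le_of_AE_le)
    show "integrable unit_leb (\<lambda>x. W * b x)"
      unfolding b_def using p s by (simp add: sq_int_square)
    show "AE x in unit_leb. exp (k * x) * (2 * p x * F x) \<le> W * b x"
      using coeff AE_space
    proof eventually_elim
      fix x assume co: "\<bar>k1 x\<bar> \<le> m \<and> \<bar>k2 x\<bar> \<le> m \<and> (AE \<xi> in lebesgue_on (S x). \<bar>k3 x \<xi>\<bar> + \<bar>k4 x \<xi>\<bar> \<le> m)"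
        and "x \<in> space unit_leb"
      then have x: "x \<in> {0..1}" by simp
      have "2 * p x * F x = 2 * p x * (k1 x * s x) + 2 * p x * (k2 x * \<beta>0)
          + 2 * p x * (LINT \<xi>|lebesgue_on (S x). k3 x \<xi> * u \<xi> + k4 x \<xi> * v \<xi>)"
        unfolding F[OF x] by (simp only: distrib_left)
      also have "\<dots> \<le> m * ((p x)\<^sup>2 / c' + c' * (s x)\<^sup>2) + m * ((p x)\<^sup>2 / c + c * \<beta>0\<^sup>2) + m * ((p x)\<^sup>2 + ?U + ?V)"
        using co S[OF x] by (intro add_mono young_le c kernel_term_le m u v) auto
      also have "\<dots> = b x" unfolding b_def by (simp only: distrib_left add.assoc)
      finally have "2 * p x * F x \<le> b x" .
      then have "exp (k * x) * (2 * p x * F x) \<le> exp (k * x) * b x" by simp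
      also have "\<dots> \<le> W * b x" using W[OF x] b0 by (intro mult_right_mono)
      finally show "exp (k * x) * (2 * p x * F x) \<le> W * b x" .
    qed
    show "AE x in unit_leb. 0 \<le> W * b x" using W0 b0 by simp
  qed
  also have "\<dots> = W * (m * ((LINT x|unit_leb. (p x)\<^sup>2) / c' + c' * (LINT x|unit_leb. (s x)\<^sup>2)
    + (LINT x|unit_leb. (p x)\<^sup>2) / c + c * \<beta>0\<^sup>2
    + (LINT x|unit_leb. (p x)\<^sup>2) + ?U + ?V))"
    unfolding b_def using p s by (simp add: sq_int_square)
  finally show ?thesis .
qed

text \<open>Fubini for null sets. The bounds on \<open>h1\<close>, ..., \<open>h4\<close> hold at
  the points of \<open>q_regular\<close>, and the estimates need them on almost every vertical
  section.\<close>

lemma AE_AE_of_negligible: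
  assumes "negligible (sq_dom - R)"
  shows "AE x in unit_leb. AE \<xi> in unit_leb. (x, \<xi>) \<in> R"
proof -
  have "sq_dom - R \<in> null_sets lebesgue" using assms negligible_iff_null_sets by blast
  then have "AE p in lebesgue. p \<notin> sq_dom - R" by (rule AE_not_in)
  \<comment> \<open>Completion does not change almost-everywhere statements, and
    \<open>lborel\<close> on the plane is a product measure, which its completion is not.\<close>
  then have "AE p in lborel \<Otimes>\<^sub>M lborel. p \<notin> sq_dom - R"
    unfolding lborel_prod by (simp only: AE_completion_iff)
  from lborel_pair.AE_pair[OF this]
  have "AE x in lborel. AE \<xi> in lborel. (x, \<xi>) \<notin> sq_dom - R" .
  then have "AE x in lborel. AE \<xi> in lebesgue. (x, \<xi>) \<notin> sq_dom - R"
    by eventually_elim (rule AE_completion)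
  then have "AE x in lebesgue. AE \<xi> in lebesgue. (x, \<xi>) \<notin> sq_dom - R"
    by (rule AE_completion)
  then show ?thesis
  proof (simp add: AE_restrict_space_iff, eventually_elim)
    fix x assume "AE \<xi> in lebesgue. (x, \<xi>) \<notin> sq_dom - R"
    then show "0 \<le> x \<and> x \<le> 1 \<longrightarrow> (AE \<xi> in lebesgue. 0 \<le> \<xi> \<and> \<xi> \<le> 1 \<longrightarrow> (x, \<xi>) \<in> R)"
      by (intro impI, eventually_elim) (auto simp: sq_dom_def)
  qed
qed

subsection \<open>The dissipation inequality\<close>

text \<open>Each component pays for the inflow of its neighbour. The inflow of alpha at 0 is phi
  beta(0), costing at most lam_hi phi_hi^2 beta(0)^2, which the outflow of beta at 0 covers; what
  remains is the coefficient \<open>\<gamma>\<beta>\<close>. The inflow of beta at 1 is z(0),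
  costing at most a mu_hi e^rho z(0)^2, covered by the outflow of z at 0, with
  \<open>\<gamma>z\<close> left over. There is no inflow of z at 1.\<close>

lemma transport_form_le:
  assumes dom: "target_domain d y" and D: "0 < D" and a: "0 < a" and b: "0 < b" and \<rho>: "0 < \<rho>"
    and lam: "0 < lam_lo" "lam_lo \<le> lam d" "lam d \<le> lam_hi"
    and mu: "0 < mu_lo" "mu_lo \<le> mu d" "mu d \<le> mu_hi" and phi: "\<bar>phi d\<bar> \<le> phi_hi"
    and \<nu>: "\<nu> \<le> \<rho> * lam_lo" "\<nu> \<le> \<rho> * mu_lo" "\<nu> \<le> \<rho>z"
  shows "2 * lyap_form D \<rho> \<rho>z a b y (transport D d y) \<le> - \<nu> * lyap D \<rho> \<rho>z a b y
    - (a * mu_lo - lam_hi * phi_hi\<^sup>2) * (c2nd (y 0))\<^sup>2 - (b - a * mu_hi * exp \<rho>) * (c3rd (y 0))\<^sup>2"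
proof -
  note wd = has_wderiv_weak_deriv[OF has_wderiv_wderiv[OF dom]]
  define A where "A = exp_inner (- \<rho>) (\<lambda>x. c1st (y x)) (\<lambda>x. c1st (y x))"
  define B where "B = exp_inner \<rho> (\<lambda>x. c2nd (y x)) (\<lambda>x. c2nd (y x))"
  define Z where "Z = exp_inner (\<rho>z * D) (\<lambda>x. c3rd (y x)) (\<lambda>x. c3rd (y x))"
  have nonneg: "0 \<le> A" "0 \<le> B" "0 \<le> Z" by (simp_all add: A_def B_def Z_def exp_inner_self_nonneg)
  have twice: "2 * exp_inner k f g = (LINT x|unit_leb. exp (k * x) * (2 * f x * g x))" for k f g
    unfolding exp_inner_def by (subst integral_mult_right_zero[symmetric]) (simp add: mult_ac)
  have parts: "2 * exp_inner k f f' = exp k * (f 1)\<^sup>2 - (f 0)\<^sup>2 - k * exp_inner k f f" if "weak_deriv f f'" for k f f'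
    unfolding twice weighted_by_parts[OF that] by (simp add: exp_inner_def power2_eq_square)
  have bc: "c1st (y 0) = phi d * c2nd (y 0)" "c2nd (y 1) = c3rd (y 0)" "c3rd (y 1) = 0"
    using dom by (auto simp: target_domain_def)
  have "2 * exp_inner (- \<rho>) (\<lambda>x. c1st (y x)) (\<lambda>x. c1st (transport D d y x))
      = - lam d * (exp (- \<rho>) * (c1st (y 1))\<^sup>2 - (phi d * c2nd (y 0))\<^sup>2 + \<rho> * A)"
    unfolding transport_def fst_conv snd_conv exp_inner_cmult mult.left_commute[of 2] parts[OF wd(1)] A_def bc by simp
  also have "\<dots> \<le> lam_hi * phi_hi\<^sup>2 * (c2nd (y 0))\<^sup>2 - \<nu> * A"
  proof -
    \<comment> \<open>The outflow of alpha at 1 has the favourable sign and is dropped.\<close>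
    have "0 \<le> lam d * (exp (- \<rho>) * (c1st (y 1))\<^sup>2)" using lam by simp
    moreover have "lam d * (phi d * c2nd (y 0))\<^sup>2 \<le> lam_hi * phi_hi\<^sup>2 * (c2nd (y 0))\<^sup>2"
      unfolding power_mult_distrib mult.assoc[symmetric]
      using lam phi by (intro mult_right_mono mult_mono) (auto simp: abs_le_square_iff[symmetric])
    moreover have "\<nu> * A \<le> (lam d * \<rho>) * A"
    proof (rule mult_right_mono)
      have "\<rho> * lam_lo \<le> \<rho> * lam d" using lam(2) \<rho> by (intro mult_left_mono) auto
      then show "\<nu> \<le> lam d * \<rho>" using \<nu>(1) by (simp add: mult.commute)
    qed (use nonneg in simp)
    ultimately show ?thesis by (simp add: algebra_simps)
  qed
  finally have 1: "2 * exp_inner (- \<rho>) (\<lambda>x. c1st (y x)) (\<lambda>x. c1st (transport D d y x))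
      \<le> lam_hi * phi_hi\<^sup>2 * (c2nd (y 0))\<^sup>2 - \<nu> * A" .
  have "2 * exp_inner \<rho> (\<lambda>x. c2nd (y x)) (\<lambda>x. c2nd (transport D d y x))
      = mu d * (exp \<rho> * (c3rd (y 0))\<^sup>2 - (c2nd (y 0))\<^sup>2 - \<rho> * B)"
    unfolding transport_def fst_conv snd_conv exp_inner_cmult mult.left_commute[of 2] parts[OF wd(2)] B_def bc by simp
  also have "\<dots> \<le> mu_hi * exp \<rho> * (c3rd (y 0))\<^sup>2 - mu_lo * (c2nd (y 0))\<^sup>2 - \<nu> * B"
  proof -
    have "mu d * exp \<rho> * (c3rd (y 0))\<^sup>2 \<le> mu_hi * exp \<rho> * (c3rd (y 0))\<^sup>2"
      using mu by (intro mult_right_mono) auto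
    moreover have "mu_lo * (c2nd (y 0))\<^sup>2 \<le> mu d * (c2nd (y 0))\<^sup>2"
      using mu by (intro mult_right_mono) auto
    moreover have "\<nu> * B \<le> (mu d * \<rho>) * B"
    proof (rule mult_right_mono)
      have "\<rho> * mu_lo \<le> \<rho> * mu d" using mu(2) \<rho> by (intro mult_left_mono) auto
      then show "\<nu> \<le> mu d * \<rho>" using \<nu>(2) by (simp add: mult.commute)
    qed (use nonneg in simp)
    ultimately show ?thesis unfolding right_diff_distrib mult.assoc mult.left_commute[of B] by linarith
  qed
  finally have 2: "a * (2 * exp_inner \<rho> (\<lambda>x. c2nd (y x)) (\<lambda>x. c2nd (transport D d y x)))
      \<le> a * (mu_hi * exp \<rho> * (c3rd (y 0))\<^sup>2 - mu_lo * (c2nd (y 0))\<^sup>2 - \<nu> * B)"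
    using a by (intro mult_left_mono) auto
  \<comment> \<open>The factor 1 / D of the transport speed cancels the D in front of the third
    integral of the functional.\<close>
  have c3: "c3rd (transport D d y x) = (1 / D) * c3rd (wderiv y x)" for x
    by (simp add: transport_def)
  have "D * (2 * exp_inner (\<rho>z * D) (\<lambda>x. c3rd (y x)) (\<lambda>x. c3rd (transport D d y x)))
      = 2 * exp_inner (\<rho>z * D) (\<lambda>x. c3rd (y x)) (\<lambda>x. c3rd (wderiv y x))"
    unfolding c3 exp_inner_cmult using D by simp
  also have "\<dots> = - (c3rd (y 0))\<^sup>2 - \<rho>z * D * Z"
    unfolding parts[OF wd(3)] Z_def bc by simp
  also have "\<dots> \<le> - (c3rd (y 0))\<^sup>2 - \<nu> * (D * Z)"
    using mult_right_mono[OF \<nu>(3), of "D * Z"] D nonneg by (simp add: mult.assoc)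
  finally have 3: "b * (D * (2 * exp_inner (\<rho>z * D) (\<lambda>x. c3rd (y x)) (\<lambda>x. c3rd (transport D d y x))))
      \<le> b * (- (c3rd (y 0))\<^sup>2 - \<nu> * (D * Z))"
    using b by (intro mult_left_mono) auto
  have V: "lyap D \<rho> \<rho>z a b y = A + a * B + b * D * Z"
    by (simp add: lyap_eq_form lyap_form_def A_def B_def Z_def)
  show ?thesis
    using 1 2 3 unfolding V lyap_form_def by (simp add: algebra_simps)
qed

text \<open>The exponential weights are replaced by their maxima 1, e^rho and e^(rhoz D). Local and
  kernel terms in u and v get Young weight 1 and produce multiples of n + N; the terms with beta(0)
  get c1, c2 and c4, and the term with eta(0) gets c3.\<close>

lemma pert_form_le:
  assumes D: "0 < D" and a: "0 < a" and b: "0 < b" and \<rho>: "0 < \<rho>" "0 < \<rho>z"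
    and c: "0 < c1" "0 < c2" "0 < c3" "0 < c4" and m: "0 \<le> m"
    and ker: "K_kernel_eqs d0 K" "q_kernel_eqs D d0 K" and bij: "L2_bijective (transf D d0 K)"
    and f: "\<And>x \<xi>. (x, \<xi>) \<in> tri_dom \<Longrightarrow>
      \<bar>f1 d0 d\<bar> + \<bar>f2 d0 K d x\<bar> + \<bar>f3 d0 K d x \<xi>\<bar> + \<bar>f4 d0 K d x \<xi>\<bar> \<le> m"
    and g: "\<And>x \<xi>. (x, \<xi>) \<in> tri_dom \<Longrightarrow>
      \<bar>g1 d0 d\<bar> + \<bar>g2 d0 K d x\<bar> + \<bar>g3 d0 K d x \<xi>\<bar> + \<bar>g4 d0 K d x \<xi>\<bar> \<le> m"
    and h: "\<And>x \<xi>. (x, \<xi>) \<in> q_regular K \<Longrightarrow>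
      \<bar>h1 D d0 K d x\<bar> + \<bar>h2 D K d x\<bar> + \<bar>h3 D d0 K d x \<xi>\<bar> + \<bar>h4 D d0 K d x \<xi>\<bar> \<le> m"
    and y: "L2 y"
    and n: "n = (L2norm y)\<^sup>2" and N: "N = (L2norm (preimg D d0 K y))\<^sup>2"
    and Q0: "Q0 = (L2norm (q1 K 0))\<^sup>2 + (L2norm (q2 K 0))\<^sup>2"
  shows "2 * lyap_form D \<rho> \<rho>z a b y (pert D d0 K d y)
    \<le> m * ((3 * (n + N) + n / c1 + c1 * (c2nd (y 0))\<^sup>2)
      + a * (exp \<rho> * (3 * (n + N) + n / c2 + c2 * (c2nd (y 0))\<^sup>2))
      + b * (exp (\<rho>z * D) * (2 * (n + N) + n / c3 + c3 * (3 * (c3rd (y 0))\<^sup>2 + 3 * Q0 * N)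
          + n / c4 + c4 * (c2nd (y 0))\<^sup>2)))"
proof -
  define w where "w = preimg D d0 K y"
  define sq where "sq = (\<lambda>p :: real \<Rightarrow> real. LINT x|unit_leb. (p x)\<^sup>2)"
  have sq0: "0 \<le> sq p" for p by (simp add: sq_def integral_nonneg_AE)
  define \<beta> where "\<beta> = c2nd (y 0)"
  define \<eta> where "\<eta> = c3rd (w 0)"
  have w: "L2 w" unfolding w_def by (rule preimg(1)[OF bij y])
  note yc = L2D[OF y] and wc = L2D[OF w]
  let ?\<alpha> = "\<lambda>x. c1st (y x)" and ?\<beta> = "\<lambda>x. c2nd (y x)" and ?z = "\<lambda>x. c3rd (y x)"
  let ?u = "\<lambda>x. c1st (w x)" and ?v = "\<lambda>x. c2nd (w x)"
  have n': "n = sq ?\<alpha> + sq ?\<beta> + sq ?z"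
    unfolding n sq_def by (rule L2norm_square_components[OF y])
  have N': "sq ?u + sq ?v \<le> N"
    using L2norm_square_components[OF w] sq0[of "\<lambda>x. c3rd (w x)"] unfolding N sq_def w_def by simp
  have tri: "AE \<xi> in lebesgue_on {0..x}. (x, \<xi>) \<in> tri_dom" if "x \<in> {0..1}" for x
    by (rule AE_I2) (use that in \<open>auto simp: tri_dom_def\<close>)
  have tri0: "(x, 0) \<in> tri_dom" if "x \<in> {0..1}" for x
    using that by (auto simp: tri_dom_def)
  \<comment> \<open>The leading 1 is the maximum of the weight; the other two factors 1 are the
    Young weight of the local term, kept visible to match \<open>weighted_cross_le\<close>.\<close>
  have "2 * exp_inner (- \<rho>) ?\<alpha> (pertF D d0 K d y)
      \<le> 1 * (m * (sq ?\<alpha> / 1 + 1 * sq ?v + sq ?\<alpha> / c1 + c1 * \<beta>\<^sup>2 + sq ?\<alpha> + sq ?u + sq ?v))"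
    unfolding sq_def
  proof (rule weighted_cross_le[where S = "\<lambda>x. {0..x}" and ?k1.0 = "\<lambda>_. f1 d0 d" and ?k2.0 = "f2 d0 K d"
        and ?k3.0 = "f3 d0 K d" and ?k4.0 = "f4 d0 K d"])
    show "AE x in unit_leb. \<bar>f1 d0 d\<bar> \<le> m \<and> \<bar>f2 d0 K d x\<bar> \<le> m
        \<and> (AE \<xi> in lebesgue_on {0..x}. \<bar>f3 d0 K d x \<xi>\<bar> + \<bar>f4 d0 K d x \<xi>\<bar> \<le> m)"
    proof (rule AE_I2)
      fix x assume "x \<in> space unit_leb"
      then have x: "x \<in> {0..1}" by simp
      have "AE \<xi> in lebesgue_on {0..x}. \<bar>f3 d0 K d x \<xi>\<bar> + \<bar>f4 d0 K d x \<xi>\<bar> \<le> m"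
        using tri[OF x]
      proof eventually_elim
        case (elim \<xi>)
        from f[OF elim] show ?case by linarith
      qed
      moreover have "\<bar>f1 d0 d\<bar> \<le> m \<and> \<bar>f2 d0 K d x\<bar> \<le> m" using f[OF tri0[OF x]] by linarith
      ultimately show "\<bar>f1 d0 d\<bar> \<le> m \<and> \<bar>f2 d0 K d x\<bar> \<le> m
        \<and> (AE \<xi> in lebesgue_on {0..x}. \<bar>f3 d0 K d x \<xi>\<bar> + \<bar>f4 d0 K d x \<xi>\<bar> \<le> m)" by blast
    qed
  qed (use yc wc m c \<rho> in \<open>auto simp: pertF_def Let_def w_def \<beta>_def\<close>)
  \<comment> \<open>The squares of alpha, u and v add up to at most 2 n + 2 N; this is rounded up to
    the coefficient 3 in \<open>MV\<close>.\<close>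
  also have "\<dots> \<le> m * (3 * (n + N) + n / c1 + c1 * \<beta>\<^sup>2)"
  proof -
    have "sq ?\<alpha> / c1 \<le> n / c1" using c sq0[of ?\<beta>] sq0[of ?z] unfolding n' by (intro divide_right_mono) auto
    then show ?thesis
      using N' sq0[of ?\<alpha>] sq0[of ?\<beta>] sq0[of ?z] sq0[of ?u] sq0[of ?v] unfolding n' mult_1
      by (intro mult_left_mono[OF _ m]) simp
  qed
  finally have F: "2 * exp_inner (- \<rho>) ?\<alpha> (pertF D d0 K d y) \<le> m * (3 * (n + N) + n / c1 + c1 * \<beta>\<^sup>2)" .
  have "2 * exp_inner \<rho> ?\<beta> (pertG D d0 K d y)
      \<le> exp \<rho> * (m * (sq ?\<beta> / 1 + 1 * sq ?u + sq ?\<beta> / c2 + c2 * \<beta>\<^sup>2 + sq ?\<beta> + sq ?u + sq ?v))"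
    unfolding sq_def
  proof (rule weighted_cross_le[where S = "\<lambda>x. {0..x}" and ?k1.0 = "\<lambda>_. g1 d0 d" and ?k2.0 = "g2 d0 K d"
        and ?k3.0 = "g3 d0 K d" and ?k4.0 = "g4 d0 K d"])
    show "AE x in unit_leb. \<bar>g1 d0 d\<bar> \<le> m \<and> \<bar>g2 d0 K d x\<bar> \<le> m
        \<and> (AE \<xi> in lebesgue_on {0..x}. \<bar>g3 d0 K d x \<xi>\<bar> + \<bar>g4 d0 K d x \<xi>\<bar> \<le> m)"
    proof (rule AE_I2)
      fix x assume "x \<in> space unit_leb"
      then have x: "x \<in> {0..1}" by simp
      have "AE \<xi> in lebesgue_on {0..x}. \<bar>g3 d0 K d x \<xi>\<bar> + \<bar>g4 d0 K d x \<xi>\<bar> \<le> m"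
        using tri[OF x]
      proof eventually_elim
        case (elim \<xi>)
        from g[OF elim] show ?case by linarith
      qed
      moreover have "\<bar>g1 d0 d\<bar> \<le> m \<and> \<bar>g2 d0 K d x\<bar> \<le> m" using g[OF tri0[OF x]] by linarith
      ultimately show "\<bar>g1 d0 d\<bar> \<le> m \<and> \<bar>g2 d0 K d x\<bar> \<le> m
        \<and> (AE \<xi> in lebesgue_on {0..x}. \<bar>g3 d0 K d x \<xi>\<bar> + \<bar>g4 d0 K d x \<xi>\<bar> \<le> m)" by blast
    qed
  qed (use yc wc m c \<rho> in \<open>auto simp: pertG_def Let_def w_def \<beta>_def\<close>)
  also have "\<dots> \<le> exp \<rho> * (m * (3 * (n + N) + n / c2 + c2 * \<beta>\<^sup>2))"
  proof -
    have "sq ?\<beta> / c2 \<le> n / c2" using c sq0[of ?\<alpha>] sq0[of ?z] unfolding n' by (intro divide_right_mono) auto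
    then show ?thesis
      using N' sq0[of ?\<alpha>] sq0[of ?\<beta>] sq0[of ?z] sq0[of ?u] sq0[of ?v] unfolding n'
      by (intro mult_left_mono[OF _ m] mult_left_mono[OF _ exp_ge_zero]) simp
  qed
  finally have G: "a * (2 * exp_inner \<rho> ?\<beta> (pertG D d0 K d y))
      \<le> a * (exp \<rho> * (m * (3 * (n + N) + n / c2 + c2 * \<beta>\<^sup>2)))"
    using a by (intro mult_left_mono) auto
  have reg: "AE x in unit_leb. AE \<xi> in unit_leb. (x, \<xi>) \<in> q_regular K"
    using ker(2) unfolding q_kernel_eqs_def by (intro AE_AE_of_negligible) blast
  \<comment> \<open>The number eta(0) takes the place of the local function as a constant; on an
    interval of length one its square is its own integral.\<close>
  have "2 * exp_inner (\<rho>z * D) ?z (pertH D d0 K d y)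
      \<le> exp (\<rho>z * D) * (m * (sq ?z / c3 + c3 * sq (\<lambda>_. \<eta>) + sq ?z / c4 + c4 * \<beta>\<^sup>2 + sq ?z + sq ?u + sq ?v))"
    unfolding sq_def
  proof (rule weighted_cross_le[where S = "\<lambda>_. {0..1}" and ?k1.0 = "h1 D d0 K d" and ?k2.0 = "h2 D K d"
        and ?k3.0 = "h3 D d0 K d" and ?k4.0 = "h4 D d0 K d"])
    show "AE x in unit_leb. \<bar>h1 D d0 K d x\<bar> \<le> m \<and> \<bar>h2 D K d x\<bar> \<le> m
        \<and> (AE \<xi> in unit_leb. \<bar>h3 D d0 K d x \<xi>\<bar> + \<bar>h4 D d0 K d x \<xi>\<bar> \<le> m)"
      using reg
    proof eventually_elim
      case (elim x)
      \<comment> \<open>The hypothesis speaks about points (x, \<xi>), also for \<open>h1\<close>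
        and \<open>h2\<close>, which depend on x alone. As the unit interval has measure one, a
        statement free of \<xi> that holds for almost every \<xi> holds outright.\<close>
      then have "AE \<xi> in unit_leb. \<bar>h1 D d0 K d x\<bar> \<le> m \<and> \<bar>h2 D K d x\<bar> \<le> m
          \<and> \<bar>h3 D d0 K d x \<xi>\<bar> + \<bar>h4 D d0 K d x \<xi>\<bar> \<le> m"
      proof eventually_elim
        case (elim \<xi>)
        from h[OF elim] show ?case by linarith
      qed
      then show ?case by simp
    qed
    show "exp (\<rho>z * D * x) \<le> exp (\<rho>z * D)" if "x \<in> {0..1}" for x
      using that \<rho> D by (simp add: mult_left_le)
  qed (use yc wc m c in \<open>auto simp: pertH_def Let_def w_def \<beta>_def \<eta>_def sq_int_const\<close>)
  also have "\<dots> \<le> exp (\<rho>z * D) * (m * (2 * (n + N) + n / c3 + c3 * (3 * (c3rd (y 0))\<^sup>2 + 3 * Q0 * N) + n / c4 + c4 * \<beta>\<^sup>2))"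
  proof -
    have "sq ?z / c3 \<le> n / c3" "sq ?z / c4 \<le> n / c4"
      using c sq0[of ?\<alpha>] sq0[of ?\<beta>] unfolding n' by (auto intro!: divide_right_mono)
    moreover have "c3 * sq (\<lambda>_. \<eta>) \<le> c3 * (3 * (c3rd (y 0))\<^sup>2 + 3 * Q0 * N)"
      using preimg_third_at_0[OF bij y ker] c
      by (intro mult_left_mono) (auto simp: sq_def \<eta>_def w_def N Q0)
    ultimately show ?thesis
      using N' sq0[of ?\<alpha>] sq0[of ?\<beta>] sq0[of ?z] sq0[of ?u] sq0[of ?v] unfolding n'
      by (intro mult_left_mono[OF _ m] mult_left_mono[OF _ exp_ge_zero]) simp
  qed
  finally have H: "b * (2 * exp_inner (\<rho>z * D) ?z (pertH D d0 K d y))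
      \<le> b * (exp (\<rho>z * D) * (m * (2 * (n + N) + n / c3 + c3 * (3 * (c3rd (y 0))\<^sup>2 + 3 * Q0 * N) + n / c4 + c4 * \<beta>\<^sup>2)))"
    using b by (intro mult_left_mono) auto
  \<comment> \<open>The perturbation enters the third equation divided by D, and the functional
    carries the factor D.\<close>
  have Hd: "D * exp_inner (\<rho>z * D) ?z (\<lambda>x. pertH D d0 K d y x / D) = exp_inner (\<rho>z * D) ?z (pertH D d0 K d y)"
    using D exp_inner_cmult[of "\<rho>z * D" ?z "1 / D" "pertH D d0 K d y"] by simp
  have "2 * lyap_form D \<rho> \<rho>z a b y (pert D d0 K d y) = 2 * exp_inner (- \<rho>) ?\<alpha> (pertF D d0 K d y)
      + a * (2 * exp_inner \<rho> ?\<beta> (pertG D d0 K d y)) + b * (2 * exp_inner (\<rho>z * D) ?z (pertH D d0 K d y))"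
    unfolding lyap_form_def pert_def fst_conv snd_conv Hd[symmetric] by (simp add: distrib_left)
  then show ?thesis
    using F G H unfolding \<beta>_def[symmetric] by (simp add: algebra_simps)
qed

text \<open>The arithmetic behind \<open>MV\<close>, \<open>M\<beta>\<close> and \<open>Mz\<close>,
  with s = a e^rho and t = b e^(rhoz D). The sum is grouped by its multiples of n + N, n and N,
  which are traded for the functional v through n <= v / cV and N <= v / (cV cT).\<close>

lemma coefficient_sum_le:
  fixes n N v c1 :: real
  assumes n: "n \<le> v / cV" and N: "N \<le> n / cT" and pos: "0 < cV" "0 < cT"
    and c: "0 < c1" "0 < c2" "0 < c3" "0 < c4" and nonneg: "0 \<le> s" "0 \<le> t" "0 \<le> Q0"
  shows "(3 * (n + N) + n / c1 + c1 * \<beta>\<^sup>2) + s * (3 * (n + N) + n / c2 + c2 * \<beta>\<^sup>2)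
      + t * (2 * (n + N) + n / c3 + c3 * (3 * z\<^sup>2 + 3 * Q0 * N) + n / c4 + c4 * \<beta>\<^sup>2)
    \<le> ((3 + 3 * s + 2 * t) / cV * (1 + 1 / cT) + 1 / (c1 * cV) + s / (cV * c2) + t / (cV * c3)
        + 3 * t * c3 * Q0 / (cT * cV) + t / (cV * c4)) * v
      + (c1 + s * c2 + t * c4) * \<beta>\<^sup>2 + 3 * t * c3 * z\<^sup>2"
proof -
  have "n / cT \<le> v / cV / cT" using n pos by (intro divide_right_mono) auto
  then have N': "N \<le> v / cV / cT" using N by linarith
  have "(3 + 3 * s + 2 * t) * (n + N) \<le> (3 + 3 * s + 2 * t) * (v / cV + v / cV / cT)"
    using n N' nonneg by (intro mult_left_mono add_mono) auto
  moreover have "(1 / c1 + s / c2 + t / c3 + t / c4) * n \<le> (1 / c1 + s / c2 + t / c3 + t / c4) * (v / cV)"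
    using n c nonneg by (intro mult_left_mono) auto
  moreover have "(3 * t * c3 * Q0) * N \<le> (3 * t * c3 * Q0) * (v / cV / cT)"
    using N' c nonneg by (intro mult_left_mono) auto
  moreover have "(3 * (n + N) + n / c1 + c1 * \<beta>\<^sup>2) + s * (3 * (n + N) + n / c2 + c2 * \<beta>\<^sup>2)
      + t * (2 * (n + N) + n / c3 + c3 * (3 * z\<^sup>2 + 3 * Q0 * N) + n / c4 + c4 * \<beta>\<^sup>2)
    = (3 + 3 * s + 2 * t) * (n + N) + (1 / c1 + s / c2 + t / c3 + t / c4) * n + (3 * t * c3 * Q0) * N
      + (c1 + s * c2 + t * c4) * \<beta>\<^sup>2 + 3 * t * c3 * z\<^sup>2"
    by (simp add: algebra_simps)
  moreover have "((3 + 3 * s + 2 * t) / cV * (1 + 1 / cT) + 1 / (c1 * cV) + s / (cV * c2) + t / (cV * c3)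
        + 3 * t * c3 * Q0 / (cT * cV) + t / (cV * c4)) * v
    = (3 + 3 * s + 2 * t) * (v / cV + v / cV / cT) + (1 / c1 + s / c2 + t / c3 + t / c4) * (v / cV)
      + (3 * t * c3 * Q0) * (v / cV / cT)"
  proof -
    have "(3 + 3 * s + 2 * t) / cV * (1 + 1 / cT) * v = (3 + 3 * s + 2 * t) * (v / cV + v / cV / cT)"
      using pos by (simp add: distrib_left distrib_right add_divide_distrib)
    moreover have "(1 / c1 + s / c2 + t / c3 + t / c4) * (v / cV)
        = 1 / (c1 * cV) * v + s / (cV * c2) * v + t / (cV * c3) * v + t / (cV * c4) * v"
      unfolding distrib_right by (simp add: mult_ac)
    moreover have "(3 * t * c3 * Q0) * (v / cV / cT) = 3 * t * c3 * Q0 / (cT * cV) * v"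
      by (simp add: mult_ac)
    ultimately show ?thesis unfolding distrib_right[of _ _ v] by linarith
  qed
  ultimately show ?thesis by linarith
qed

text \<open>Here m stands for the amplitude \<open>M0 * \<Delta> j\<close> of the coefficients.
  Linearity of the form in its second argument separates transport and perturbation.\<close>

lemma target_form_le:
  assumes D: "0 < D" and a: "0 < a" and b: "0 < b" and \<rho>: "0 < \<rho>" "0 < \<rho>z"
    and c: "0 < c1" "0 < c2" "0 < c3" "0 < c4" and m: "0 \<le> m" and cV: "0 < cV" and cT: "0 < cT"
    and lam: "0 < lam_lo" "lam_lo \<le> lam d" "lam d \<le> lam_hi"
    and mu: "0 < mu_lo" "mu_lo \<le> mu d" "mu d \<le> mu_hi" and phi: "\<bar>phi d\<bar> \<le> phi_hi"
    and \<nu>: "\<nu> \<le> \<rho> * lam_lo" "\<nu> \<le> \<rho> * mu_lo" "\<nu> \<le> \<rho>z"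
    and ker: "K_kernel_eqs d0 K" "q_kernel_eqs D d0 K" and bij: "L2_bijective (transf D d0 K)"
    and lower: "\<And>w. L2 w \<Longrightarrow> cT * (L2norm w)\<^sup>2 \<le> (L2norm (transf D d0 K w))\<^sup>2"
    and V_lower: "\<And>y. L2 y \<Longrightarrow> cV * (L2norm y)\<^sup>2 \<le> lyap D \<rho> \<rho>z a b y"
    and f: "\<And>x \<xi>. (x, \<xi>) \<in> tri_dom \<Longrightarrow>
      \<bar>f1 d0 d\<bar> + \<bar>f2 d0 K d x\<bar> + \<bar>f3 d0 K d x \<xi>\<bar> + \<bar>f4 d0 K d x \<xi>\<bar> \<le> m"
    and g: "\<And>x \<xi>. (x, \<xi>) \<in> tri_dom \<Longrightarrow>
      \<bar>g1 d0 d\<bar> + \<bar>g2 d0 K d x\<bar> + \<bar>g3 d0 K d x \<xi>\<bar> + \<bar>g4 d0 K d x \<xi>\<bar> \<le> m"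
    and h: "\<And>x \<xi>. (x, \<xi>) \<in> q_regular K \<Longrightarrow>
      \<bar>h1 D d0 K d x\<bar> + \<bar>h2 D K d x\<bar> + \<bar>h3 D d0 K d x \<xi>\<bar> + \<bar>h4 D d0 K d x \<xi>\<bar> \<le> m"
    and dom: "target_domain d y" and rhs: "L2 (target_rhs D d0 K d y)"
    and Q0: "Q0 = (L2norm (q1 K 0))\<^sup>2 + (L2norm (q2 K 0))\<^sup>2"
    and MV: "MV = (3 + 3 * (a * exp \<rho>) + 2 * (b * exp (\<rho>z * D))) / cV * (1 + 1 / cT) + 1 / (c1 * cV)
        + a * exp \<rho> / (cV * c2) + b * exp (\<rho>z * D) / (cV * c3)
        + 3 * (b * exp (\<rho>z * D)) * c3 * Q0 / (cT * cV) + b * exp (\<rho>z * D) / (cV * c4)"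
    and M\<beta>: "M\<beta> = c1 + a * exp \<rho> * c2 + b * exp (\<rho>z * D) * c4"
    and Mz: "Mz = 3 * (b * exp (\<rho>z * D)) * c3"
  shows "2 * lyap_form D \<rho> \<rho>z a b y (target_rhs D d0 K d y) \<le> - (\<nu> - m * MV) * lyap D \<rho> \<rho>z a b y
    - (a * mu_lo - lam_hi * phi_hi\<^sup>2 - m * M\<beta>) * (c2nd (y 0))\<^sup>2
    - (b - a * mu_hi * exp \<rho> - m * Mz) * (c3rd (y 0))\<^sup>2"
proof -
  define n where "n = (L2norm y)\<^sup>2"
  define N where "N = (L2norm (preimg D d0 K y))\<^sup>2"
  let ?V = "lyap D \<rho> \<rho>z a b y"
  note y = target_domain_L2[OF dom]
  have tr: "L2 (transport D d y)" by (rule transport_L2[OF dom])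
  \<comment> \<open>Square integrability of the perturbation comes from the right-hand side and the
    transport part, not from the kernels.\<close>
  have "pert D d0 K d y = (\<lambda>x. target_rhs D d0 K d y x - transport D d y x)"
    by (simp add: target_rhs_def)
  then have pe: "L2 (pert D d0 K d y)" using L2_diff[OF rhs tr] by simp
  have n: "n \<le> ?V / cV"
    using V_lower[OF y] cV by (simp add: n_def field_simps)
  have N: "N \<le> n / cT" unfolding N_def n_def by (rule preimg_norm[OF bij y cT lower])
  have "2 * lyap_form D \<rho> \<rho>z a b y (pert D d0 K d y)
    \<le> m * ((3 * (n + N) + n / c1 + c1 * (c2nd (y 0))\<^sup>2)
      + a * (exp \<rho> * (3 * (n + N) + n / c2 + c2 * (c2nd (y 0))\<^sup>2))
      + b * (exp (\<rho>z * D) * (2 * (n + N) + n / c3 + c3 * (3 * (c3rd (y 0))\<^sup>2 + 3 * Q0 * N)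
          + n / c4 + c4 * (c2nd (y 0))\<^sup>2)))"
    by (rule pert_form_le[OF D a b \<rho> c m ker bij f g h y n_def N_def Q0])
  also have "\<dots> \<le> m * (MV * ?V + M\<beta> * (c2nd (y 0))\<^sup>2 + Mz * (c3rd (y 0))\<^sup>2)"
    unfolding MV M\<beta> Mz mult.assoc[of a, symmetric] mult.assoc[of b, symmetric]
    by (intro mult_left_mono[OF _ m]
        coefficient_sum_le[OF n N cV cT c, of "a * exp \<rho>" "b * exp (\<rho>z * D)" Q0 "c2nd (y 0)" "c3rd (y 0)", unfolded mult.assoc[of a, symmetric] mult.assoc[of b, symmetric]])
      (use a b in \<open>simp_all add: Q0\<close>)
  finally have p: "2 * lyap_form D \<rho> \<rho>z a b y (pert D d0 K d y)
    \<le> m * (MV * ?V + M\<beta> * (c2nd (y 0))\<^sup>2 + Mz * (c3rd (y 0))\<^sup>2)" .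
  have "lyap_form D \<rho> \<rho>z a b y (target_rhs D d0 K d y)
      = lyap_form D \<rho> \<rho>z a b y (transport D d y) + lyap_form D \<rho> \<rho>z a b y (pert D d0 K d y)"
    unfolding target_rhs_def by (rule lyap_form_add[OF y tr pe])
  then show ?thesis
    using p transport_form_le[OF dom D a b \<rho>(1) lam mu phi \<nu>] by (simp add: algebra_simps)
qed

subsection \<open>Jumps of the mode process\<close>

text \<open>Rounding up puts the grid point to the right of s, where right-constancy of the paths
  gives it the mode of time s. The mesh h / 2^q is made smaller than e.\<close>

lemma dyadic_grid_dense:
  assumes h: "0 < h" and s: "t \<le> s" "s < t + h" and e: "0 < e"
  obtains q i where "i \<le> (2::nat) ^ q" "s \<le> t + h * (real i / 2 ^ q)" "t + h * (real i / 2 ^ q) < s + e"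
proof -
  obtain q where q: "h / e < 2 ^ q" using real_arch_pow[of 2 "h / e"] by auto
  define z where "z = (s - t) / h * 2 ^ q"
  define i where "i = nat \<lceil>z\<rceil>"
  have z0: "0 \<le> z" using h s by (simp add: z_def)
  have "(s - t) / h * 2 ^ q \<le> 1 * 2 ^ q" using h s by (intro mult_right_mono) auto
  then have "z \<le> 2 ^ q" by (simp add: z_def)
  then have "\<lceil>z\<rceil> \<le> int (2 ^ q)" by (intro ceiling_le) simp
  then have i_le: "i \<le> 2 ^ q" unfolding i_def by (simp only: nat_le_iff)
  have "real i = of_int \<lceil>z\<rceil>" using z0 by (simp add: i_def)
  then have i: "z \<le> real i" "real i < z + 1"
    using ceiling_correct[of z] by linarith+
  have sz: "s = t + h * (z / 2 ^ q)" using h by (simp add: z_def)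
  have "h * (z / 2 ^ q) \<le> h * (real i / 2 ^ q)"
    using i h by (intro mult_left_mono divide_right_mono) auto
  moreover have "h * (real i / 2 ^ q) < h * (z / 2 ^ q) + e"
  proof -
    have "h * (real i / 2 ^ q) < h * ((z + 1) / 2 ^ q)"
      using i h by (intro mult_strict_left_mono divide_strict_right_mono) auto
    also have "\<dots> = h * (z / 2 ^ q) + h / 2 ^ q" by (simp add: field_simps)
    also have "h / 2 ^ q < e" using q e by (simp add: field_simps)
    finally show ?thesis by simp
  qed
  ultimately show thesis
    using that[of i q] i_le sz by linarith
qed

locale mode_chain = prob_space P for P :: "'w measure" +
  fixes R :: "nat set" and t0 :: real and m :: "real \<Rightarrow> 'w \<Rightarrow> nat" and j :: nat and \<tau> :: real
  assumes chain: "mode_process P R t0 m" and fin: "finite R" and pos: "\<P>(\<omega> in P. m t0 \<omega> = j) > 0"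
    and rate: "\<And>s h i k. t0 \<le> s \<Longrightarrow> 0 \<le> h \<Longrightarrow> i \<in> R \<Longrightarrow> k \<in> R \<Longrightarrow> i \<noteq> k \<Longrightarrow>
      \<P>(\<omega> in P. m (s + h) \<omega> = k \<bar> m s \<omega> = i) \<le> \<tau> * h"
begin

lemma m_meas: "t0 \<le> s \<Longrightarrow> m s \<in> measurable P (count_space R)"
  using chain[unfolded mode_process_def, THEN conjunct2, THEN conjunct1] by simp

lemma m_in_R: "t0 \<le> s \<Longrightarrow> \<omega> \<in> space P \<Longrightarrow> m s \<omega> \<in> R"
  using measurable_space[OF m_meas] by simp

lemma m_sets [measurable]:
  assumes "t0 \<le> s"
  shows "{\<omega> \<in> space P. m s \<omega> = k} \<in> sets P"
proof -
  have "{\<omega> \<in> space P. m s \<omega> = k} = m s -` ({k} \<inter> R) \<inter> space P"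
    using m_in_R[OF assms] by blast
  then show ?thesis using measurable_sets[OF m_meas[OF assms], of "{k} \<inter> R"] by simp
qed

lemma j_in_R: "j \<in> R"
proof (rule ccontr)
  assume "j \<notin> R"
  then have "{\<omega> \<in> space P. m t0 \<omega> = j} = {}" using m_in_R[of t0] by auto
  then have "\<P>(\<omega> in P. m t0 \<omega> = j) = 0" by (simp only: measure_empty)
  then show False using pos by linarith
qed

lemma right_constant:
  assumes "\<omega> \<in> space P" "t0 \<le> s"
  obtains e where "0 < e" "\<And>s'. s \<le> s' \<Longrightarrow> s' < s + e \<Longrightarrow> m s' \<omega> = m s \<omega>"
proof -
  have "\<forall>\<omega> \<in> space P. \<forall>s\<ge>t0. \<exists>e>0. \<forall>s' \<in> {s..<s + e}. m s' \<omega> = m s \<omega>"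
    by (rule chain[unfolded mode_process_def, THEN conjunct2, THEN conjunct2, THEN conjunct1])
  from this[THEN bspec, OF assms(1), THEN spec, THEN mp, OF assms(2)]
  obtain e where e: "0 < e" and c: "\<forall>s' \<in> {s..<s + e}. m s' \<omega> = m s \<omega>"
    by (elim exE conjE)
  show thesis
  proof (rule that[OF e])
    fix s' assume "s \<le> s'" "s' < s + e"
    then have "s' \<in> {s..<s + e}" by simp
    then show "m s' \<omega> = m s \<omega>" by (rule c[THEN bspec])
  qed
qed

text \<open>The Markov property in \<open>mode_process\<close> concerns finitely many observation
  times, so staying in mode j is first described on a grid of mesh d.\<close>

definition stay :: "real \<Rightarrow> nat \<Rightarrow> 'w set" where
  "stay d n = {\<omega> \<in> space P. \<forall>i\<le>n. m (t0 + d * real i) \<omega> = j}"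

lemma stay_sets [measurable]: "0 \<le> d \<Longrightarrow> stay d n \<in> sets P"
proof -
  assume d: "0 \<le> d"
  have "stay d n = (\<Inter>i\<in>{..n}. {\<omega> \<in> space P. m (t0 + d * real i) \<omega> = j})"
    by (auto simp: stay_def)
  also have "\<dots> \<in> sets P" using d by (intro sets.finite_INT m_sets) simp_all
  finally show ?thesis .
qed

text \<open>A bound for the total rate of leaving a mode; the absolute value makes it nonnegative
  whatever the sign of the rate constant.\<close>

definition C where "C = real (card R) * \<bar>\<tau>\<bar>"

lemma C_nonneg: "0 \<le> C" by (simp add: C_def)

text \<open>Given that j has been observed at all grid points so far, the Markov property reduces
  the next step to the last observation, the rate bound applies to each target mode, and these
  finitely many targets are summed.\<close>

lemma leave_prob_le:
  assumes d: "0 < d"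
  shows "prob {\<omega> \<in> space P. m (t0 + d * real (Suc n)) \<omega> \<noteq> j \<and> \<omega> \<in> stay d n} \<le> C * d * prob (stay d n)"
proof (cases "prob (stay d n) = 0")
  case True
  \<comment> \<open>The Markov clause is available only for conditioning events of positive
    probability; on a null event both sides vanish.\<close>
  have "prob {\<omega> \<in> space P. m (t0 + d * real (Suc n)) \<omega> \<noteq> j \<and> \<omega> \<in> stay d n} \<le> prob (stay d n)"
    using d by (intro finite_measure_mono stay_sets) auto
  then show ?thesis using True by simp
next
  case False
  define s where "s = t0 + d * real n"
  have s: "t0 \<le> s" using d by (simp add: s_def)
  have sd: "t0 + d * real (Suc n) = s + d" by (simp add: s_def algebra_simps)
  have Spos: "0 < prob (stay d n)" using False by (simp add: zero_less_measure_iff)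
  have stay_eq: "{\<omega> \<in> space P. \<forall>i\<le>n. m (t0 + d * real i) \<omega> = j} = stay d n" by (simp add: stay_def)
  have one: "prob {\<omega> \<in> space P. m (s + d) \<omega> = k \<and> \<omega> \<in> stay d n} \<le> \<bar>\<tau>\<bar> * d * prob (stay d n)"
    if k: "k \<in> R" "k \<noteq> j" for k
  proof -
    have "\<P>(\<omega> in P. m (s + d) \<omega> = k \<bar> \<forall>i\<le>n. m (t0 + d * real i) \<omega> = j)
        = \<P>(\<omega> in P. m (s + d) \<omega> = k \<bar> m (t0 + d * real n) \<omega> = j)"
    proof -
      have all: "\<forall>n (ts :: nat \<Rightarrow> real) ks s k.
        t0 \<le> ts 0 \<longrightarrow> (\<forall>i<n. ts i < ts (Suc i)) \<longrightarrow> ts n < s \<longrightarrow>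
        \<P>(\<omega> in P. \<forall>i\<le>n. m (ts i) \<omega> = ks i) > 0 \<longrightarrow>
        \<P>(\<omega> in P. m s \<omega> = k \<bar> \<forall>i\<le>n. m (ts i) \<omega> = ks i)
          = \<P>(\<omega> in P. m s \<omega> = k \<bar> m (ts n) \<omega> = ks n)"
        by (rule chain[unfolded mode_process_def, THEN conjunct2, THEN conjunct2, THEN conjunct2, THEN conjunct1])
      show ?thesis
      proof (rule all[rule_format, of "\<lambda>i. t0 + d * real i" n "s + d" "\<lambda>_. j" k])
        show "0 < \<P>(\<omega> in P. \<forall>i\<le>n. m (t0 + d * real i) \<omega> = j)"
          unfolding stay_eq by (rule Spos)
      qed (use d in \<open>simp_all add: s_def\<close>)
    qed
    also have "\<dots> \<le> \<tau> * d"
      using rate[of s d j k] s d k j_in_R by (simp add: s_def)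
    also have "\<dots> \<le> \<bar>\<tau>\<bar> * d" using d by (intro mult_right_mono) auto
    finally have "prob {\<omega> \<in> space P. m (s + d) \<omega> = k \<and> (\<forall>i\<le>n. m (t0 + d * real i) \<omega> = j)} / prob (stay d n)
        \<le> \<bar>\<tau>\<bar> * d"
      unfolding cond_prob_def stay_eq .
    moreover have "{\<omega> \<in> space P. m (s + d) \<omega> = k \<and> (\<forall>i\<le>n. m (t0 + d * real i) \<omega> = j)}
        = {\<omega> \<in> space P. m (s + d) \<omega> = k \<and> \<omega> \<in> stay d n}"
      by (auto simp: stay_def)
    ultimately show ?thesis using Spos by (simp add: pos_divide_le_eq)
  qed
  have sets: "{\<omega> \<in> space P. m (s + d) \<omega> = k \<and> \<omega> \<in> stay d n} \<in> sets P" for k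
  proof -
    have "{\<omega> \<in> space P. m (s + d) \<omega> = k \<and> \<omega> \<in> stay d n} = {\<omega> \<in> space P. m (s + d) \<omega> = k} \<inter> stay d n"
      by auto
    then show ?thesis using m_sets[of "s + d"] s d by auto
  qed
  have "{\<omega> \<in> space P. m (s + d) \<omega> \<noteq> j \<and> \<omega> \<in> stay d n}
      = (\<Union>k\<in>R - {j}. {\<omega> \<in> space P. m (s + d) \<omega> = k \<and> \<omega> \<in> stay d n})"
    using m_in_R[of "s + d"] s d by auto
  then have "prob {\<omega> \<in> space P. m (s + d) \<omega> \<noteq> j \<and> \<omega> \<in> stay d n}
      \<le> (\<Sum>k\<in>R - {j}. prob {\<omega> \<in> space P. m (s + d) \<omega> = k \<and> \<omega> \<in> stay d n})"
    using fin sets by (auto intro!: finite_measure_subadditive_finite)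
  also have "\<dots> \<le> (\<Sum>k\<in>R - {j}. \<bar>\<tau>\<bar> * d * prob (stay d n))"
    by (intro sum_mono one) auto
  also have "\<dots> \<le> (\<Sum>k\<in>R. \<bar>\<tau>\<bar> * d * prob (stay d n))"
    using fin d by (intro sum_mono2) auto
  also have "\<dots> = C * d * prob (stay d n)" by (simp add: C_def)
  finally show ?thesis unfolding sd .
qed

text \<open>Each step loses at most C d times the probability still present, which never exceeds the
  initial one. Summing these losses gives a linear bound that depends on d and n only through d
  n.\<close>

lemma stay_prob_ge:
  assumes d: "0 < d"
  shows "prob (stay d n) \<ge> prob (stay d 0) - C * d * real n * prob (stay d 0)"
proof (induction n)
  case (Suc n)
  let ?L = "{\<omega> \<in> space P. m (t0 + d * real (Suc n)) \<omega> \<noteq> j \<and> \<omega> \<in> stay d n}"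
  have L: "?L = stay d n - stay d (Suc n)"
    by (auto simp: stay_def le_Suc_eq)
  have "prob (stay d n) \<le> prob (stay d (Suc n)) + prob ?L"
  proof -
    have "stay d n \<subseteq> stay d (Suc n) \<union> ?L" unfolding L by auto
    then have "prob (stay d n) \<le> prob (stay d (Suc n) \<union> ?L)"
      using d unfolding L by (intro finite_measure_mono) auto
    also have "\<dots> \<le> prob (stay d (Suc n)) + prob ?L"
      using d unfolding L by (intro measure_Un_le) auto
    finally show ?thesis .
  qed
  also have "prob ?L \<le> C * d * prob (stay d n)" by (rule leave_prob_le[OF d])
  \<comment> \<open>Longer observation shrinks the event.\<close>
  also have "\<dots> \<le> C * d * prob (stay d 0)"
    using d C_nonneg by (intro mult_left_mono finite_measure_mono) (auto simp: stay_def[of d n] stay_def[of d 0])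
  finally show ?case using Suc by (simp add: algebra_simps)
qed simp

definition no_jump :: "real \<Rightarrow> 'w set" where
  "no_jump h = {\<omega> \<in> space P. \<forall>s\<in>{t0..t0 + h}. m s \<omega> = j}"

definition start :: "'w set" where
  "start = {\<omega> \<in> space P. m t0 \<omega> = j}"

lemma start_sets [measurable]: "start \<in> sets P"
  unfolding start_def by (rule m_sets) simp

text \<open>Staying at all dyadic times is staying at all times, because every time before the end
  has a dyadic time in the interval to its right on which the path is constant. This expresses an
  uncountable condition by countably many measurable ones.\<close>

lemma no_jump_eq:
  assumes h: "0 < h"
  shows "no_jump h = (\<Inter>q. stay (h / 2 ^ q) (2 ^ q))"
proof
  show "no_jump h \<subseteq> (\<Inter>q. stay (h / 2 ^ q) (2 ^ q))"
  proof
    fix \<omega> assume w: "\<omega> \<in> no_jump h"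
    have "m (t0 + h / 2 ^ q * real i) \<omega> = j" if i: "i \<le> 2 ^ q" for q i
    proof -
      have "h / 2 ^ q * real i \<le> h / 2 ^ q * 2 ^ q"
        using i h by (intro mult_left_mono) auto
      then have "t0 + h / 2 ^ q * real i \<in> {t0..t0 + h}" using h by simp
      then show ?thesis using w unfolding no_jump_def by blast
    qed
    moreover have "\<omega> \<in> space P" using w by (simp add: no_jump_def)
    ultimately show "\<omega> \<in> (\<Inter>q. stay (h / 2 ^ q) (2 ^ q))"
      unfolding stay_def by blast
  qed
  show "(\<Inter>q. stay (h / 2 ^ q) (2 ^ q)) \<subseteq> no_jump h"
  proof
    fix \<omega> assume w: "\<omega> \<in> (\<Inter>q. stay (h / 2 ^ q) (2 ^ q))"
    then have "\<omega> \<in> stay (h / 2 ^ 0) (2 ^ 0)" by blast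
    then have sp: "\<omega> \<in> space P" unfolding stay_def by blast
    have g: "m (t0 + h * (real i / 2 ^ q)) \<omega> = j" if "i \<le> 2 ^ q" for q i
    proof -
      have "h * (real i / 2 ^ q) = h / 2 ^ q * real i" by simp
      moreover have "\<omega> \<in> stay (h / 2 ^ q) (2 ^ q)" using w by blast
      ultimately show ?thesis using that unfolding stay_def by (simp only: mem_Collect_eq)
    qed
    have "m s \<omega> = j" if s: "s \<in> {t0..t0 + h}" for s
    proof (cases "s = t0 + h")
      case True
      \<comment> \<open>No grid point lies beyond the right endpoint, but the endpoint itself
        belongs to the coarsest grid.\<close>
      then show ?thesis using g[of 1 0] by (simp only: of_nat_1 power_0 div_by_1 mult_1_right order_refl)
    next
      case False
      then have s': "t0 \<le> s" "s < t0 + h" using s by auto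
      obtain e where e: "0 < e" "\<And>s'. s \<le> s' \<Longrightarrow> s' < s + e \<Longrightarrow> m s' \<omega> = m s \<omega>"
        using right_constant[OF sp s'(1)] by blast
      \<comment> \<open>A dyadic time inside the constancy interval of s carries the mode of
        s.\<close>
      obtain q i where i: "i \<le> 2 ^ q" "s \<le> t0 + h * (real i / 2 ^ q)" "t0 + h * (real i / 2 ^ q) < s + e"
        using dyadic_grid_dense[OF h s' e(1)] .
      show ?thesis using g[OF i(1)] e(2)[OF i(2,3)] by (simp only:)
    qed
    then show "\<omega> \<in> no_jump h" using sp by (simp add: no_jump_def)
  qed
qed

text \<open>The bound on the grids is the same for every refinement, so it passes to the limit of
  the decreasing events.\<close>

lemma no_jump_prob_ge:
  assumes h: "0 < h"
  shows "no_jump h \<in> sets P" "prob (no_jump h) \<ge> (1 - C * h) * prob start"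
proof -
  let ?F = "\<lambda>q. stay (h / 2 ^ q) (2 ^ q)"
  have F1: "?F q \<in> sets P" for q using h by (intro stay_sets) simp
  then have F: "range ?F \<subseteq> sets P" by blast
  show "no_jump h \<in> sets P"
    unfolding no_jump_eq[OF h] using F by (intro sets.countable_INT) auto
  have "decseq ?F"
  proof (rule decseq_SucI)
    show "?F (Suc q) \<subseteq> ?F q" for q
    proof
      fix \<omega> assume w: "\<omega> \<in> ?F (Suc q)"
      have "m (t0 + h / 2 ^ q * real i) \<omega> = j" if i: "i \<le> 2 ^ q" for i
      proof -
        have e: "h / 2 ^ q * real i = h / 2 ^ Suc q * real (2 * i)" and "2 * i \<le> 2 ^ Suc q"
          using i by simp_all
        then have "m (t0 + h / 2 ^ Suc q * real (2 * i)) \<omega> = j"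
          using w unfolding stay_def by blast
        then show ?thesis unfolding e .
      qed
      moreover have "\<omega> \<in> space P" using w unfolding stay_def by blast
      ultimately show "\<omega> \<in> ?F q" unfolding stay_def by blast
    qed
  qed
  then have lim: "(\<lambda>q. prob (?F q)) \<longlonglongrightarrow> prob (no_jump h)"
    unfolding no_jump_eq[OF h] by (rule finite_Lim_measure_decseq[OF F])
  have st: "stay d 0 = start" for d by (simp add: stay_def start_def)
  have "prob (?F q) \<ge> (1 - C * h) * prob start" for q
  proof -
    \<comment> \<open>Mesh times number of steps is h for every q.\<close>
    have "C * (h / 2 ^ q) * real (2 ^ q) = C * h" by simp
    then show ?thesis
      using stay_prob_ge[of "h / 2 ^ q" "2 ^ q"] h unfolding st left_diff_distrib mult_1 by simp
  qed
  then show "prob (no_jump h) \<ge> (1 - C * h) * prob start"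
    by (intro LIMSEQ_le_const[OF lim]) auto
qed

end

section \<open>The generator along a classical solution\<close>

context lyapunov
begin

text \<open>Joint measurability of the state in outcome and position is what makes the integrals
  over the position measurable in the outcome.\<close>

lemma borel_measurable_lyap:
  assumes "(\<lambda>(\<omega>, x). X \<omega> x) \<in> borel_measurable (P \<Otimes>\<^sub>M unit_leb)"
  shows "(\<lambda>\<omega>. V (X \<omega>)) \<in> borel_measurable P"
proof -
  have c: "(\<lambda>p. c1st (case p of (\<omega>, x) \<Rightarrow> X \<omega> x)) \<in> borel_measurable (P \<Otimes>\<^sub>M unit_leb)"
    "(\<lambda>p. c2nd (case p of (\<omega>, x) \<Rightarrow> X \<omega> x)) \<in> borel_measurable (P \<Otimes>\<^sub>M unit_leb)"
    "(\<lambda>p. c3rd (case p of (\<omega>, x) \<Rightarrow> X \<omega> x)) \<in> borel_measurable (P \<Otimes>\<^sub>M unit_leb)"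
    using assms borel_measurable_triple_iff[of "\<lambda>p. case p of (\<omega>, x) \<Rightarrow> X \<omega> x"] by blast+
  have idm: "(\<lambda>x. x) \<in> borel_measurable unit_leb"
    using id_borel_measurable_lebesgue_on unfolding id_def .
  have sn [measurable]: "snd \<in> borel_measurable (P \<Otimes>\<^sub>M unit_leb)"
    using measurable_compose[OF measurable_snd[of P unit_leb] idm] by simp
  have int: "(\<lambda>\<omega>. LINT x|unit_leb. exp (k * x) * (g (\<omega>, x))\<^sup>2) \<in> borel_measurable P"
    if [measurable]: "g \<in> borel_measurable (P \<Otimes>\<^sub>M unit_leb)" for k :: real and g :: "_ \<Rightarrow> real"
  proof (rule unit_leb.borel_measurable_lebesgue_integral)
    have "(\<lambda>p. exp (k * snd p) * (g p)\<^sup>2) \<in> borel_measurable (P \<Otimes>\<^sub>M unit_leb)" by measurable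
    then show "(\<lambda>(\<omega>, x). exp (k * x) * (g (\<omega>, x))\<^sup>2) \<in> borel_measurable (P \<Otimes>\<^sub>M unit_leb)"
      by (simp add: split_beta')
  qed
  show ?thesis
    unfolding lyap_def using int[OF c(1), of "- \<rho>"] int[OF c(2), of \<rho>] int[OF c(3), of "\<rho>z * D"]
    by (intro borel_measurable_add borel_measurable_times borel_measurable_const) simp_all
qed

text \<open>For norms at most 1 the quadratic term of \<open>V_perturb\<close> is dominated by the
  linear one, which leaves a bound linear in e.\<close>

lemma V_close:
  assumes "L2 y" "L2 k" "L2norm k < e" "e \<le> 1"
  shows "\<bar>V (\<lambda>x. y x + k x) - V y\<bar> \<le> (2 * (sqrt (V y) * sqrt \<bar>C\<bar>) + \<bar>C\<bar>) * e"
proof -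
  let ?n = "L2norm k" and ?K = "2 * (sqrt (V y) * sqrt \<bar>C\<bar>)"
  have n: "0 \<le> ?n" "?n \<le> 1" "?n \<le> e" using assms L2norm_nonneg[of k] by auto
  have K: "0 \<le> ?K" using V_nonneg[of y] by simp
  have "?n\<^sup>2 \<le> ?n" using n by (simp add: power2_eq_square mult_left_le)
  then have "C * ?n\<^sup>2 \<le> \<bar>C\<bar> * ?n" by (intro mult_mono) auto
  then have "\<bar>V (\<lambda>x. y x + k x) - V y\<bar> \<le> ?K * ?n + \<bar>C\<bar> * ?n"
    using V_perturb[OF assms(1,2)] by linarith
  also have "\<dots> = (?K + \<bar>C\<bar>) * ?n" by (simp only: distrib_right)
  also have "\<dots> \<le> (?K + \<bar>C\<bar>) * e" using n K by (intro mult_left_mono) auto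
  finally show ?thesis .
qed

text \<open>The mode leaves \<open>j\<close> during \<open>[t, t + h]\<close> with probability \<open>O(h)\<close> only, and on that event the
  functional differs by \<open>o(1)\<close>; hence jumps do not contribute to the generator.\<close>

lemma generator_eq:
  fixes P :: "'w measure"
  assumes sp: "switched_process R P m X j t T Y" and fin: "finite R"
    and t: "0 \<le> t" "t < T" and Y: "\<And>s. s \<in> {0..T} \<Longrightarrow> L2 (Y s)"
    and der: "((\<lambda>s. V (Y s)) has_real_derivative l) (at t within {0..T})"
  shows "generator V P m X j t (Y t) = ereal l"
proof -
  note sp1 = sp[unfolded switched_process_def]
  note sp2 = sp1[THEN conjunct2]
  note sp3 = sp2[THEN conjunct2]
  note sp4 = sp3[THEN conjunct2]
  note sp5 = sp4[THEN conjunct2]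
  note chain = sp1[THEN conjunct1] and pos = sp2[THEN conjunct1] and meas = sp3[THEN conjunct1]
    and XL2 = sp4[THEN conjunct1] and follow = sp5[THEN conjunct1] and cont = sp5[THEN conjunct2]
  note ps = chain[unfolded mode_process_def, THEN conjunct1]
    and rates = chain[unfolded mode_process_def, THEN conjunct2, THEN conjunct2, THEN conjunct2, THEN conjunct2]
  obtain \<tau> where \<tau>: "\<forall>s\<ge>t. \<forall>h\<ge>0. \<forall>i\<in>R. \<forall>k\<in>R. i \<noteq> k \<longrightarrow>
      \<P>(\<omega> in P. m (s + h) \<omega> = k \<bar> m s \<omega> = i) \<le> \<tau> * h"
    using rates by (elim exE)
  interpret P: prob_space P by (rule ps)
  interpret c: mode_chain P R t m j \<tau>
  proof
    show "mode_process P R t m" by (rule chain)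
    show "\<P>(\<omega> in P. m (s + h) \<omega> = k \<bar> m s \<omega> = i) \<le> \<tau> * h"
      if "t \<le> s" "0 \<le> h" "i \<in> R" "k \<in> R" "i \<noteq> k" for s h i k
      using \<tau> that by simp
  qed (use fin pos in simp_all)
  \<comment> \<open>The conditional law given mode j at time t, as in
    \<open>generator\<close>.\<close>
  define Q where "Q = uniform_measure P c.start"
  have start0: "0 < P.prob c.start" using pos by (simp add: c.start_def)
  have em: "emeasure P c.start \<noteq> 0" "emeasure P c.start \<noteq> \<infinity>"
    using start0 by (auto simp: P.emeasure_eq_measure)
  interpret Q: prob_space Q unfolding Q_def by (rule prob_space_uniform_measure[OF em])
  have AEQ: "AE \<omega> in Q. \<omega> \<in> c.start"
    unfolding Q_def by (rule AE_uniform_measureI) auto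
  have setsQ: "sets Q = sets P" "space Q = space P" by (simp_all add: Q_def)
  define v where "v = V (Y t)"
  \<comment> \<open>The Lipschitz-type constant of \<open>V_close\<close> at the starting state,
    whose functional has the value v for all outcomes in \<open>c.start\<close>.\<close>
  define K where "K = 2 * (sqrt v * sqrt \<bar>C\<bar>) + \<bar>C\<bar>"
  have K: "0 \<le> K" using V_nonneg[of "Y t"] by (simp add: K_def v_def)
  define G where "G = (\<lambda>h. LINT \<omega>|Q. V (X (t + h) \<omega>))"
  define d where "d = (\<lambda>h. V (Y (t + h)))"
  \<comment> \<open>The integrand of G(h) - d(h) vanishes unless a jump occurs. The event of a jump
    has conditional probability at most \<open>c.C * h\<close>, and on it both values are compared
    with v.\<close>
  have key: "\<bar>G h - d h\<bar> \<le> c.C * h * (K * e + \<bar>d h - v\<bar>)"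
    if h: "0 < h" "t + h \<le> T" and e: "e \<le> 1"
      and close: "\<And>\<omega>. \<omega> \<in> space P \<Longrightarrow> m t \<omega> = j \<Longrightarrow> L2norm (\<lambda>x. X (t + h) \<omega> x - X t \<omega> x) < e" for h e
  proof -
    let ?g = "\<lambda>\<omega>. V (X (t + h) \<omega>)"
    let ?M = "K * e + \<bar>d h - v\<bar>"
    have g_close: "\<bar>?g \<omega> - v\<bar> \<le> K * e" if w: "\<omega> \<in> c.start" for \<omega>
    proof -
      have wP: "\<omega> \<in> space P" "m t \<omega> = j" using w by (auto simp: c.start_def)
      \<comment> \<open>At s = t the absence of jumps just says that the mode at time t is
        j.\<close>
      have "AE x in unit_leb. X t \<omega> x = Y t x"
        using follow wP t by simp
      then have v: "V (X t \<omega>) = v" unfolding v_def by (rule lyap_cong_AE)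
      have L: "L2 (X t \<omega>)" "L2 (X (t + h) \<omega>)" using XL2 wP h by auto
      have "\<bar>V (\<lambda>x. X t \<omega> x + (X (t + h) \<omega> x - X t \<omega> x)) - V (X t \<omega>)\<bar>
          \<le> (2 * (sqrt (V (X t \<omega>)) * sqrt \<bar>C\<bar>) + \<bar>C\<bar>) * e"
        by (rule V_close[OF L(1) L2_diff[OF L(2,1)] close[OF wP] e])
      then show ?thesis by (simp add: v K_def)
    qed
    have g_eq: "?g \<omega> = d h" if w: "\<omega> \<in> c.no_jump h" for \<omega>
    proof -
      have "\<omega> \<in> space P" "\<forall>s'\<in>{t..t + h}. m s' \<omega> = j" using w by (auto simp: c.no_jump_def)
      then have "AE x in unit_leb. X (t + h) \<omega> x = Y (t + h) x"
        using follow t h by simp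
      then show ?thesis unfolding d_def by (rule lyap_cong_AE)
    qed
    have gm: "?g \<in> borel_measurable Q"
      using borel_measurable_lyap[of "X (t + h)" P] meas h unfolding measurable_cong_sets[OF setsQ(1) refl]
      by simp
    have gi: "integrable Q ?g"
    proof (rule Q.integrable_const_bound[OF _ gm])
      show "AE \<omega> in Q. norm (?g \<omega>) \<le> \<bar>v\<bar> + K * e"
        using AEQ
      proof eventually_elim
        case (elim \<omega>)
        from g_close[OF elim] show ?case by (simp only: real_norm_def)
      qed
    qed
    have N: "c.no_jump h \<in> sets Q" using c.no_jump_prob_ge(1)[OF h(1)] setsQ by simp
    have Ke: "0 \<le> ?M"
    proof -
      \<comment> \<open>Nonnegativity of the bound follows from one outcome in
        \<open>c.start\<close>, which exists because this event has positive probability.\<close>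
      obtain \<omega> where "\<omega> \<in> c.start" using start0 by (metis P.prob_space equals0I less_irrefl measure_empty)
      from g_close[OF this] show ?thesis by linarith
    qed
    have "G h - d h = (LINT \<omega>|Q. ?g \<omega> - d h)"
      unfolding G_def using gi by (simp add: Q.prob_space)
    then have "\<bar>G h - d h\<bar> \<le> (LINT \<omega>|Q. \<bar>?g \<omega> - d h\<bar>)" by simp
    also have "\<dots> \<le> (LINT \<omega>|Q. ?M * indicator (space Q - c.no_jump h) \<omega>)"
    proof (rule integral_mono_AE)
      show "integrable Q (\<lambda>\<omega>. \<bar>?g \<omega> - d h\<bar>)" using gi by simp
      show "integrable Q (\<lambda>\<omega>. ?M * indicator (space Q - c.no_jump h) \<omega>)"
        using N by (intro integrable_mult_right integrable_real_indicator) (auto simp: Q.emeasure_eq_measure)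
      show "AE \<omega> in Q. \<bar>?g \<omega> - d h\<bar> \<le> ?M * indicator (space Q - c.no_jump h) \<omega>"
        using AEQ
      proof eventually_elim
        case (elim \<omega>)
        show ?case
        proof (cases "\<omega> \<in> c.no_jump h")
          case True
          then show ?thesis by (simp add: g_eq)
        next
          case False
          have "\<bar>?g \<omega> - d h\<bar> \<le> ?M" using g_close[OF elim] by linarith
          moreover have "\<omega> \<in> space Q" using elim by (simp add: c.start_def setsQ)
          ultimately show ?thesis using False by simp
        qed
      qed
    qed
    also have "\<dots> = ?M * Q.prob (space Q - c.no_jump h)"
      using N by simp
    also have "Q.prob (space Q - c.no_jump h) = 1 - Q.prob (c.no_jump h)"
      by (rule Q.prob_compl[OF N])
    also have "Q.prob (c.no_jump h) = P.prob (c.no_jump h) / P.prob c.start"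
    proof -
      have "c.start \<inter> c.no_jump h = c.no_jump h"
        using h by (auto simp: c.start_def c.no_jump_def)
      then show ?thesis
        unfolding Q_def using c.no_jump_prob_ge(1)[OF h(1)] by (simp add: measure_uniform_measure[OF em])
    qed
    also have "?M * (1 - P.prob (c.no_jump h) / P.prob c.start) \<le> ?M * (c.C * h)"
    proof (rule mult_left_mono[OF _ Ke])
      have "1 - c.C * h \<le> P.prob (c.no_jump h) / P.prob c.start"
        using c.no_jump_prob_ge(2)[OF h(1)] start0 by (simp add: pos_le_divide_eq)
      then show "1 - P.prob (c.no_jump h) / P.prob c.start \<le> c.C * h" by linarith
    qed
    finally show ?thesis by (simp add: mult.commute)
  qed
  \<comment> \<open>The generator is a limit from the right; as t < T, the derivative restricted to
    [t, T] is the right derivative.\<close>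
  have "((\<lambda>s. V (Y s)) has_real_derivative l) (at t within {t..T})"
    by (rule DERIV_subset[OF der]) (use t in auto)
  then have "((\<lambda>s. (V (Y s) - v) / (s - t)) \<longlongrightarrow> l) (at_right t)"
    unfolding has_field_derivative_iff v_def at_within_Icc_at_right[OF t(2)] .
  then have dq: "((\<lambda>h. (d h - v) / h) \<longlongrightarrow> l) (at_right 0)"
    unfolding filterlim_at_right_to_0[of _ _ t] d_def by (simp add: add.commute)
  have idr: "((\<lambda>h::real. h) \<longlongrightarrow> 0) (at_right 0)" by (rule tendsto_ident_at)
  have "((\<lambda>h. (d h - v) / h * h) \<longlongrightarrow> l * 0) (at_right 0)"
    by (rule tendsto_mult[OF dq idr])
  moreover have "\<forall>\<^sub>F h in at_right 0. (d h - v) / h * h = d h - v"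
    using eventually_at_right_less[of "0::real"] by eventually_elim simp
  ultimately have "((\<lambda>h. d h - v) \<longlongrightarrow> l * 0) (at_right 0)"
    by (rule Lim_transform_eventually)
  then have d0: "((\<lambda>h. d h - v) \<longlongrightarrow> 0) (at_right 0)" by simp
  have "((\<lambda>h. (G h - d h) / h) \<longlongrightarrow> 0) (at_right 0)"
  proof (rule tendstoI)
    fix \<epsilon> :: real assume eps: "0 < \<epsilon>"
    \<comment> \<open>Chosen such that \<open>c.C * K * e\<close> is at most half of the tolerance;
      the added 1 avoids division by zero, and the cap 1 is what \<open>V_close\<close> asks
      for.\<close>
    define e where "e = min 1 (\<epsilon> / (2 * (c.C * K + 1)))"
    have CK: "0 \<le> c.C * K" using c.C_nonneg K by simp
    have e: "0 < e" "e \<le> 1" using eps CK by (auto simp: e_def add_nonneg_pos)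
    have "c.C * K * e \<le> c.C * K * (\<epsilon> / (2 * (c.C * K + 1)))"
      using CK by (intro mult_left_mono) (auto simp: e_def)
    also have "\<dots> = (\<epsilon> / 2) * (c.C * K / (c.C * K + 1))" by simp
    also have "\<dots> \<le> (\<epsilon> / 2) * 1" using eps CK by (intro mult_left_mono) auto
    finally have CKe: "c.C * (K * e) \<le> \<epsilon> / 2" by (simp add: mult.assoc)
    obtain \<epsilon>1 where e1: "0 < \<epsilon>1" and close: "\<forall>h \<in> {0..<\<epsilon>1}. \<forall>\<omega> \<in> space P. m t \<omega> = j \<longrightarrow>
        L2norm (\<lambda>x. X (t + h) \<omega> x - X t \<omega> x) < e"
      using cont[THEN spec, THEN mp, OF e(1)] by (elim exE conjE)
    \<comment> \<open>The other half of the tolerance absorbs the drift of the unswitched solution,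
      which tends to 0 by differentiability.\<close>
    have "((\<lambda>h. c.C * \<bar>d h - v\<bar>) \<longlongrightarrow> c.C * \<bar>0\<bar>) (at_right 0)"
      by (intro tendsto_intros d0)
    then have "\<forall>\<^sub>F h in at_right 0. c.C * \<bar>d h - v\<bar> < \<epsilon> / 2"
      using eps by (intro order_tendstoD(2)[of _ "c.C * \<bar>0\<bar>"]) auto
    moreover have "\<forall>\<^sub>F h in at_right 0. h \<in> {0<..<min \<epsilon>1 (T - t)}"
      using e1 t by (intro eventually_at_right_real) auto
    ultimately show "\<forall>\<^sub>F h in at_right 0. dist ((G h - d h) / h) 0 < \<epsilon>"
    proof eventually_elim
      case (elim h)
      then have h: "0 < h" "h < \<epsilon>1" "t + h \<le> T" by auto
      have "L2norm (\<lambda>x. X (t + h) \<omega> x - X t \<omega> x) < e" if "\<omega> \<in> space P" "m t \<omega> = j" for \<omega>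
        using close[THEN bspec, of h] that h by simp
      from key[OF h(1,3) e(2) this]
      have "\<bar>G h - d h\<bar> \<le> (c.C * (K * e) + c.C * \<bar>d h - v\<bar>) * h"
        by (simp add: algebra_simps)
      also have "\<dots> < \<epsilon> * h" using CKe elim(1) h(1) by (intro mult_strict_right_mono) linarith+
      finally show ?case using h(1) by (simp add: dist_real_def abs_divide pos_divide_less_eq)
    qed
  qed
  from tendsto_add[OF this dq]
  have "((\<lambda>h. (G h - d h) / h + (d h - v) / h) \<longlongrightarrow> l) (at_right 0)" by simp
  then have "((\<lambda>h. (G h - v) / h) \<longlongrightarrow> l) (at_right 0)"
    by (simp add: add_divide_distrib[symmetric])
  then have "((\<lambda>h. ereal ((G h - v) / h)) \<longlongrightarrow> ereal l) (at_right 0)" by simp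
  then have "Limsup (at_right 0) (\<lambda>h. ereal ((G h - v) / h)) = ereal l"
    by (intro lim_imp_Limsup) auto
  then show ?thesis
    unfolding generator_def G_def Q_def c.start_def v_def .
qed

end

theorem lemma3:
  fixes D :: real and r :: nat and \<delta> :: "nat \<Rightarrow> mode" and \<delta>0 :: mode and K :: kernels
    and lam_lo lam_hi mu_lo mu_hi sigp_lo sigp_hi sigm_lo sigm_hi phi_lo phi_hi :: real
    and cT CT M0 cV CV \<rho> \<rho>z a b c1 c2 c3 c4 :: real
    and \<gamma>\<beta> \<gamma>z d\<beta> dz Q0 MV M\<beta> Mz \<nu> \<Delta>max \<epsilon>star \<kappa> :: real
    and \<Delta> :: "nat \<Rightarrow> real" and V :: "state \<Rightarrow> real" and LV :: "nat \<Rightarrow> state \<Rightarrow> real"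
  assumes "D > 0" and "r \<ge> 1"
    and "0 < lam_lo" and "\<And>j. j \<in> {1..r} \<Longrightarrow> lam_lo \<le> lam (\<delta> j) \<and> lam (\<delta> j) \<le> lam_hi"
    and "0 < mu_lo" and "\<And>j. j \<in> {1..r} \<Longrightarrow> mu_lo \<le> mu (\<delta> j) \<and> mu (\<delta> j) \<le> mu_hi"
    and "\<And>j. j \<in> {1..r} \<Longrightarrow> sigp_lo \<le> sigp (\<delta> j) \<and> sigp (\<delta> j) \<le> sigp_hi"
    and "\<And>j. j \<in> {1..r} \<Longrightarrow> sigm_lo \<le> sigm (\<delta> j) \<and> sigm (\<delta> j) \<le> sigm_hi"
    and "\<And>j. j \<in> {1..r} \<Longrightarrow> phi_lo \<le> phi (\<delta> j) \<and> phi (\<delta> j) \<le> phi_hi \<and> \<bar>phi (\<delta> j)\<bar> \<le> phi_hi"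
    and "lam \<delta>0 > 0" and "mu \<delta>0 > 0" and "phi \<delta>0 \<noteq> 0"
    and "\<Delta> = (\<lambda>j. mode_dist (\<delta> j) \<delta>0)" and "\<Delta>max = Max (\<Delta> ` {1..r})"
    and "K_kernel_eqs \<delta>0 K" and "q_kernel_eqs D \<delta>0 K"
    and "L2_bijective (transf D \<delta>0 K)"
    and "0 < cT" and "cT \<le> CT"
    and "\<And>w. L2 w \<Longrightarrow> cT * (L2norm w)\<^sup>2 \<le> (L2norm (transf D \<delta>0 K w))\<^sup>2
                 \<and> (L2norm (transf D \<delta>0 K w))\<^sup>2 \<le> CT * (L2norm w)\<^sup>2"
    and "M0 > 0"
    and "\<And>j x \<xi>. j \<in> {1..r} \<Longrightarrow> (x, \<xi>) \<in> tri_dom \<Longrightarrow>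
           \<bar>f1 \<delta>0 (\<delta> j)\<bar> + \<bar>f2 \<delta>0 K (\<delta> j) x\<bar> + \<bar>f3 \<delta>0 K (\<delta> j) x \<xi>\<bar> + \<bar>f4 \<delta>0 K (\<delta> j) x \<xi>\<bar>
             \<le> M0 * \<Delta> j"
    and "\<And>j x \<xi>. j \<in> {1..r} \<Longrightarrow> (x, \<xi>) \<in> tri_dom \<Longrightarrow>
           \<bar>g1 \<delta>0 (\<delta> j)\<bar> + \<bar>g2 \<delta>0 K (\<delta> j) x\<bar> + \<bar>g3 \<delta>0 K (\<delta> j) x \<xi>\<bar> + \<bar>g4 \<delta>0 K (\<delta> j) x \<xi>\<bar>
             \<le> M0 * \<Delta> j"
    and "\<And>j x \<xi>. j \<in> {1..r} \<Longrightarrow> (x, \<xi>) \<in> q_regular K \<Longrightarrow>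
           \<bar>h1 D \<delta>0 K (\<delta> j) x\<bar> + \<bar>h2 D K (\<delta> j) x\<bar> + \<bar>h3 D \<delta>0 K (\<delta> j) x \<xi>\<bar> + \<bar>h4 D \<delta>0 K (\<delta> j) x \<xi>\<bar>
             \<le> M0 * \<Delta> j"
    and "c1 > 0" and "c2 > 0" and "c3 > 0" and "c4 > 0"
    and "\<rho> > 0" and "\<rho>z > 0" and "a > 0" and "b > 0"
    and "\<gamma>\<beta> = a * mu_lo - lam_hi * phi_hi\<^sup>2" and "\<gamma>\<beta> > 0"
    and "\<gamma>z = b - a * mu_hi * exp \<rho>" and "\<gamma>z > 0"
    and "V = lyap D \<rho> \<rho>z a b"
    and "0 < cV" and "cV \<le> CV"
    and "\<And>y. L2 y \<Longrightarrow> cV * (L2norm y)\<^sup>2 \<le> V y \<and> V y \<le> CV * (L2norm y)\<^sup>2"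
    and "d\<beta> = exp \<rho>" and "dz = exp (\<rho>z * D)"
    and "Q0 = (L2norm (\<lambda>\<xi>. q1 K 0 \<xi>))\<^sup>2 + (L2norm (\<lambda>\<xi>. q2 K 0 \<xi>))\<^sup>2"
    and "MV = (3 + 3 * a * d\<beta> + 2 * b * dz) / cV * (1 + 1 / cT) + 1 / (c1 * cV)
              + a * d\<beta> / (cV * c2) + b * dz / (cV * c3) + 3 * b * dz * c3 * Q0 / (cT * cV)
              + b * dz / (cV * c4)"
    and "M\<beta> = c1 + a * d\<beta> * c2 + b * dz * c4" and "Mz = 3 * b * dz * c3"
    and "\<nu> = Min {\<rho> * lam_lo, \<rho> * mu_lo, \<rho>z}"
    and "\<epsilon>star = Min {\<nu> / (2 * M0 * MV), \<gamma>\<beta> / (2 * M0 * M\<beta>), \<gamma>z / (2 * M0 * Mz)}"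
    and "\<kappa> = \<nu> - M0 * MV * \<Delta>max"
    and "LV = (\<lambda>j y. L2_frechet V y (target_rhs D \<delta>0 K (\<delta> j) y))"
  shows "\<nu> > 0
    \<and> (\<forall>j \<in> {1..r}. \<forall>T>0. \<forall>Y. classical_solution D \<delta>0 K (\<delta> j) T Y \<longrightarrow>
         (\<forall>t \<in> {0..<T}. \<forall>(P :: 'w measure) m X. switched_process {1..r} P m X j t T Y \<longrightarrow>
            generator V P m X j t (Y t) = ereal (LV j (Y t)))
       \<and> (\<forall>t \<in> {0..T}.
            LV j (Y t) \<le> - (\<nu> - M0 * MV * \<Delta> j) * V (Y t)
              - (\<gamma>\<beta> - M0 * M\<beta> * \<Delta> j) * (c2nd (Y t 0))\<^sup>2
              - (\<gamma>z - M0 * Mz * \<Delta> j) * (c3rd (Y t 0))\<^sup>2))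
    \<and> (\<Delta>max < \<epsilon>star \<longrightarrow>
         \<kappa> > 0
       \<and> (\<forall>j \<in> {1..r}. \<forall>T>0. \<forall>Y. classical_solution D \<delta>0 K (\<delta> j) T Y \<longrightarrow>
            (\<forall>t \<in> {0..T}.
               ((\<lambda>s. V (Y s)) has_real_derivative LV j (Y t)) (at t within {0..T})
             \<and> LV j (Y t) \<le> - \<kappa> * V (Y t))))"
proof -
  interpret L: lyapunov D \<rho> \<rho>z a b CV
    using assms(1,31,32,40) unfolding assms(37) by unfold_locales auto
  have \<nu>: "0 < \<nu>" "\<nu> \<le> \<rho> * lam_lo" "\<nu> \<le> \<rho> * mu_lo" "\<nu> \<le> \<rho>z"
    unfolding assms(47) using assms(3,5,29,30) by auto
  have Q0: "0 \<le> Q0" unfolding assms(43) by simp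
  have d_pos: "0 < d\<beta>" "0 < dz" unfolding assms(41,42) by simp_all
  have MV: "0 < MV"
    unfolding assms(44) using assms(18,25-28,31,32,38) d_pos Q0
    by (intro add_pos_nonneg add_nonneg_nonneg mult_pos_pos divide_pos_pos mult_nonneg_nonneg divide_nonneg_pos)
      (auto intro!: add_pos_nonneg)
  have M: "0 < M\<beta>" "0 < Mz"
    unfolding assms(45,46) using assms(25-28,31,32) d_pos by (auto intro!: add_pos_pos)
  have \<Delta>: "0 \<le> \<Delta> j" for j unfolding assms(13) mode_dist_def by simp
  have sol: "target_domain (\<delta> j) (Y t)" "L2 (target_rhs D \<delta>0 K (\<delta> j) (Y t))"
      "((\<lambda>s. V (Y s)) has_real_derivative LV j (Y t)) (at t within {0..T})"
      "LV j (Y t) = 2 * lyap_form D \<rho> \<rho>z a b (Y t) (target_rhs D \<delta>0 K (\<delta> j) (Y t))"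
    if cs: "classical_solution D \<delta>0 K (\<delta> j) T Y" and t: "t \<in> {0..T}" for j T Y t
  proof -
    obtain Y' where Y': "\<forall>t \<in> {0..T}.
       target_domain (\<delta> j) (Y t) \<and> L2 (Y' t)
     \<and> ((\<lambda>s. L2norm (\<lambda>x. (Y s x - Y t x) /\<^sub>R (s - t) - Y' t x)) \<longlongrightarrow> 0) (at t within {0..T})
     \<and> ((\<lambda>s. L2norm (\<lambda>x. Y' s x - Y' t x)) \<longlongrightarrow> 0) (at t within {0..T})
     \<and> (AE x in unit_leb. Y' t x = target_rhs D \<delta>0 K (\<delta> j) (Y t) x)"
      using cs unfolding classical_solution_def by (elim exE)
    note at_t = Y'[THEN bspec, OF t]
    have ae: "AE x in unit_leb. Y' t x = target_rhs D \<delta>0 K (\<delta> j) (Y t) x"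
      and Y't: "L2 (Y' t)"
      and lim: "((\<lambda>s. L2norm (\<lambda>x. (Y s x - Y t x) /\<^sub>R (s - t) - Y' t x)) \<longlongrightarrow> 0) (at t within {0..T})"
      using at_t by blast+
    show dom: "target_domain (\<delta> j) (Y t)" using at_t by blast
    \<comment> \<open>Completeness carries square integrability over from the time
      derivative.\<close>
    show rhs: "L2 (target_rhs D \<delta>0 K (\<delta> j) (Y t))" by (rule L2_cong_AE[OF ae Y't])
    have Y: "L2 (Y s)" if "s \<in> {0..T}" for s
      using Y'[THEN bspec, OF that] target_domain_L2 by blast
    show LV: "LV j (Y t) = 2 * lyap_form D \<rho> \<rho>z a b (Y t) (target_rhs D \<delta>0 K (\<delta> j) (Y t))"
      unfolding assms(50,37) by (rule L.L2_frechet_V[OF Y[OF t] rhs])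
    \<comment> \<open>The chain rule yields the form at \<open>Y' t\<close>; the form does not see
      null sets, so the right-hand side of the target system may replace it.\<close>
    show "((\<lambda>s. V (Y s)) has_real_derivative LV j (Y t)) (at t within {0..T})"
      unfolding LV lyap_form_cong_AE[OF ae, symmetric] assms(37)
      by (rule L.V_has_derivative[OF Y t Y't lim])
  qed
  have main: "LV j (Y t) \<le> - (\<nu> - M0 * MV * \<Delta> j) * V (Y t)
      - (\<gamma>\<beta> - M0 * M\<beta> * \<Delta> j) * (c2nd (Y t 0))\<^sup>2 - (\<gamma>z - M0 * Mz * \<Delta> j) * (c3rd (Y t 0))\<^sup>2"
    if j: "j \<in> {1..r}" and cs: "classical_solution D \<delta>0 K (\<delta> j) T Y" and t: "t \<in> {0..T}" for j T Y t
  proof -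
    have "2 * lyap_form D \<rho> \<rho>z a b (Y t) (target_rhs D \<delta>0 K (\<delta> j) (Y t))
      \<le> - (\<nu> - (M0 * \<Delta> j) * MV) * lyap D \<rho> \<rho>z a b (Y t)
        - (a * mu_lo - lam_hi * phi_hi\<^sup>2 - (M0 * \<Delta> j) * M\<beta>) * (c2nd (Y t 0))\<^sup>2
        - (b - a * mu_hi * exp \<rho> - (M0 * \<Delta> j) * Mz) * (c3rd (Y t 0))\<^sup>2"
    proof (rule target_form_le)
      show "0 \<le> M0 * \<Delta> j" using assms(21) \<Delta> by simp
      show "lam_lo \<le> lam (\<delta> j)" "lam (\<delta> j) \<le> lam_hi" using assms(4)[OF j] by auto
      show "mu_lo \<le> mu (\<delta> j)" "mu (\<delta> j) \<le> mu_hi" using assms(6)[OF j] by auto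
      show "\<bar>phi (\<delta> j)\<bar> \<le> phi_hi" using assms(9)[OF j] by auto
      show "cT * (L2norm w)\<^sup>2 \<le> (L2norm (transf D \<delta>0 K w))\<^sup>2" if "L2 w" for w
        using assms(20)[OF that] by blast
      show "cV * (L2norm y)\<^sup>2 \<le> lyap D \<rho> \<rho>z a b y" if "L2 y" for y
        using assms(40)[OF that] unfolding assms(37) by blast
      show "Q0 = (L2norm (q1 K 0))\<^sup>2 + (L2norm (q2 K 0))\<^sup>2" by (rule assms(43))
    qed (use assms(22,23,24)[OF j] sol(1,2)[OF cs t] assms(1,3,5,15-18,25-32,38) \<nu>(2-4)
        in \<open>simp_all add: assms(41,42,44-46) mult.assoc\<close>)
    then show ?thesis
      unfolding sol(4)[OF cs t] assms(33,35,37) by (simp only: mult_ac)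
  qed
  have decay: "0 < \<kappa> \<and> (\<forall>j\<in>{1..r}. \<forall>T>0. \<forall>Y. classical_solution D \<delta>0 K (\<delta> j) T Y \<longrightarrow>
      (\<forall>t \<in> {0..T}. ((\<lambda>s. V (Y s)) has_real_derivative LV j (Y t)) (at t within {0..T})
        \<and> LV j (Y t) \<le> - \<kappa> * V (Y t)))"
    if small: "\<Delta>max < \<epsilon>star"
  proof (intro conjI ballI allI impI)
    \<comment> \<open>The 2 in the denominators of \<open>\<epsilon>star\<close> means that the
      perturbation consumes less than half of each of the three margins.\<close>
    have half: "M0 * X * \<Delta>max < Z / 2" if "\<Delta>max < Z / (2 * M0 * X)" "0 < X" for X Z
      using that assms(21) by (simp add: field_simps)
    have lt: "\<Delta>max < \<nu> / (2 * M0 * MV)" "\<Delta>max < \<gamma>\<beta> / (2 * M0 * M\<beta>)" "\<Delta>max < \<gamma>z / (2 * M0 * Mz)"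
      using small unfolding assms(48) by auto
    note halves = half[OF lt(1) MV] half[OF lt(2) M(1)] half[OF lt(3) M(2)]
    show "0 < \<kappa>" using halves(1) \<nu>(1) unfolding assms(49) by linarith
    fix j T Y t
    assume j: "j \<in> {1..r}" and cs: "classical_solution D \<delta>0 K (\<delta> j) T Y" and t: "t \<in> {0..T}"
    show "((\<lambda>s. V (Y s)) has_real_derivative LV j (Y t)) (at t within {0..T})"
      by (rule sol(3)[OF cs t])
    have "\<Delta> j \<le> \<Delta>max" unfolding assms(14) using j by (intro Max_ge) auto
    then have le: "M0 * X * \<Delta> j \<le> M0 * X * \<Delta>max" if "0 < X" for X
      using that assms(21) by (intro mult_left_mono) auto
    \<comment> \<open>Both boundary coefficients stay positive under the smallness condition, so the
      boundary terms only help and can be discarded.\<close>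
    have "0 \<le> (\<gamma>\<beta> - M0 * M\<beta> * \<Delta> j) * (c2nd (Y t 0))\<^sup>2"
      using le[OF M(1)] halves(2) assms(34) by (intro mult_nonneg_nonneg) auto
    moreover have "0 \<le> (\<gamma>z - M0 * Mz * \<Delta> j) * (c3rd (Y t 0))\<^sup>2"
      using le[OF M(2)] halves(3) assms(36) by (intro mult_nonneg_nonneg) auto
    moreover have "\<kappa> * V (Y t) \<le> (\<nu> - M0 * MV * \<Delta> j) * V (Y t)"
      using le[OF MV] L.V_nonneg unfolding assms(49,37) by (intro mult_right_mono) auto
    ultimately show "LV j (Y t) \<le> - \<kappa> * V (Y t)"
      using main[OF j cs t] unfolding mult_minus_left by linarith
  qed
  have gen: "generator V P m X j t (Y t) = ereal (LV j (Y t))"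
    if cs: "classical_solution D \<delta>0 K (\<delta> j) T Y" and t: "t \<in> {0..<T}"
      and sp: "switched_process {1..r} P m X j t T Y" for j T Y t and P :: "'w measure" and m X
  proof -
    have t': "t \<in> {0..T}" using t by simp
    have Y: "L2 (Y s)" if "s \<in> {0..T}" for s
      by (rule target_domain_L2[OF sol(1)[OF cs that]])
    show ?thesis
      unfolding assms(37) using sol(3)[OF cs t'] t unfolding assms(37)
      by (intro L.generator_eq[OF sp _ _ _ Y]) auto
  qed
  show ?thesis
    by (intro conjI ballI allI impI \<nu>(1) gen main decay[THEN conjunct1]
        decay[THEN conjunct2, rule_format, THEN conjunct1] decay[THEN conjunct2, rule_format, THEN conjunct2])
      assumption+
qed

end
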